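(* Let $h_1,\dots,h_k:\mathbb R^d\to\mathbb R^d$ be conformal $C^1$ maps such that $\log h_i'$ is bounded and $\alpha$-Hölder for some $\alpha\in(0,1]$, where $h_i'(x)=\|Dh_i(x)\|$. Let $p_1,\dots,p_k:\mathbb R^d\to(0,1]$ be $\alpha$-Hölder, uniformly bounded away from $0$, with $\sum_ip_i\equiv1$. Assume there is $b>0$ with $$\sum_{j=1}^k p_j(x)\log\frac{|h_j(x)-h_j(y)|}{|x-y|}<-b\quad\text{for all }x\neq y.$$ Assume moreover that the system satisfies either the strong open set condition (SOSC) or the regular open set condition (ROSC). Let $\nu$ be the invariant measure. Then $\dim_H(\nu)$ exists and $$\dim_H(\nu)=s:=\frac{\int\sum_{i=1}^k p_i(x)\log p_i(x)\,d\nu(x)}{\int\sum_{i=1}^k p_i(x)\log h_i'(x)\,d\nu(x)}.$$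
   Context: The invariant measure is the unique Borel probability measure $\nu$ with $\nu=\sum_i h_{i*}(p_i\cdot\nu)$. Upper Hausdorff dimension $\overline{\dim}_H(\nu)$: infimum of $\dim_H(Y)$ over Borel $Y$ with $\nu(Y)=1$; lower Hausdorff dimension $\underline{\dim}_H(\nu)$: infimum of $\dim_H(Y)$ over Borel $Y$ with $\nu(Y)>0$; if they coincide the common value is $\dim_H(\nu)$. Open set condition (OSC): there is a nonempty open $U\subset\mathbb R^d$ with $h_i(U)\subset U$ for all $i$ and $h_i(U)\cap h_j(U)=\emptyset$ for $i\ne j$. SOSC: OSC holds for some $U$ and there is $R_1>0$ with $\operatorname{dist}(h_i(U),h_j(U))\ge R_1$ for all $i\neq j$. ROSC: OSC holds for some $U$ and there are $R_2,R_3>0$ with $\operatorname{vol}(B_r(x)\cap U)\ge R_3r^d$ for all $x\in U$ and all $0<r<R_2$. *)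

theory Defs
  imports "HOL-Analysis.Analysis" "HOL-Probability.Probability"
begin

definition hausdorff_pre :: "real \<Rightarrow> real \<Rightarrow> 'a::metric_space set \<Rightarrow> ennreal" where
  "hausdorff_pre s \<delta> Y =
     (INF U \<in> {U :: nat \<Rightarrow> 'a set. Y \<subseteq> (\<Union>n. U n) \<and> (\<forall>n. bounded (U n) \<and> diameter (U n) \<le> \<delta>)}.
        (\<Sum>n. ennreal (diameter (U n) powr s)))"

definition hausdorff_measure :: "real \<Rightarrow> 'a::metric_space set \<Rightarrow> ennreal" where
  "hausdorff_measure s Y = (SUP \<delta> \<in> {0<..}. hausdorff_pre s \<delta> Y)"

definition hausdorff_dim :: "'a::euclidean_space set \<Rightarrow> real" where
  "hausdorff_dim Y = Inf {s. s > 0 \<and> hausdorff_measure s Y = 0}"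

definition upper_hdim :: "'a::euclidean_space measure \<Rightarrow> real" where
  "upper_hdim \<nu> = Inf {hausdorff_dim Y | Y. Y \<in> sets borel \<and> emeasure \<nu> Y = 1}"

definition lower_hdim :: "'a::euclidean_space measure \<Rightarrow> real" where
  "lower_hdim \<nu> = Inf {hausdorff_dim Y | Y. Y \<in> sets borel \<and> emeasure \<nu> Y > 0}"

definition holder :: "real \<Rightarrow> ('a::metric_space \<Rightarrow> real) \<Rightarrow> bool" where
  "holder \<alpha> f \<longleftrightarrow> (\<exists>C. \<forall>x y. \<bar>f x - f y\<bar> \<le> C * dist x y powr \<alpha>)"

definition osc_with :: "nat \<Rightarrow> (nat \<Rightarrow> 'a::metric_space \<Rightarrow> 'a) \<Rightarrow> 'a set \<Rightarrow> bool" where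
  "osc_with k h U \<longleftrightarrow> open U \<and> U \<noteq> {} \<and> (\<forall>i<k. h i ` U \<subseteq> U) \<and>
     (\<forall>i<k. \<forall>j<k. i \<noteq> j \<longrightarrow> h i ` U \<inter> h j ` U = {})"

definition SOSC :: "nat \<Rightarrow> (nat \<Rightarrow> 'a::euclidean_space \<Rightarrow> 'a) \<Rightarrow> bool" where
  "SOSC k h \<longleftrightarrow> (\<exists>U. osc_with k h U \<and>
     (\<exists>R1>0. \<forall>i<k. \<forall>j<k. i \<noteq> j \<longrightarrow> setdist (h i ` U) (h j ` U) \<ge> R1))"

definition ROSC :: "nat \<Rightarrow> (nat \<Rightarrow> 'a::euclidean_space \<Rightarrow> 'a) \<Rightarrow> bool" where
  "ROSC k h \<longleftrightarrow> (\<exists>U. osc_with k h U \<and>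
     (\<exists>R2>0. \<exists>R3>0. \<forall>x\<in>U. \<forall>r. 0 < r \<and> r < R2 \<longrightarrow>
        emeasure lborel (ball x r \<inter> U) \<ge> ennreal (R3 * r ^ DIM('a))))"

text \<open>Invariant measure: nu = sum_i (h_i)_* (p_i nu).\<close>
definition invariant_measure :: "nat \<Rightarrow> (nat \<Rightarrow> 'a::euclidean_space \<Rightarrow> 'a) \<Rightarrow> (nat \<Rightarrow> 'a \<Rightarrow> real) \<Rightarrow> 'a measure \<Rightarrow> bool" where
  "invariant_measure k h p \<nu> \<longleftrightarrow> prob_space \<nu> \<and> sets \<nu> = sets borel \<and>
     (\<forall>A\<in>sets borel. emeasure \<nu> A = (\<Sum>i<k. \<integral>\<^sup>+ x. ennreal (p i x) * indicator A (h i x) \<partial>\<nu>))"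

end

theory Submission
  imports Defs "HOL-Real_Asymp.Real_Asymp"
begin

text \<open>
  Truncating logarithms turns the hypothesis into a contraction of \<^term>\<open>dist x y powr q\<close> in the mean, for
  some small \<^term>\<open>q\<close>. Hence the transfer operator has a Doeblin-Fortet inequality, and the sums \<^term>\<open>T\<close>
  of its iterates of a centred Hoelder observable grow sublinearly in the mean: by stationarity \<^term>\<open>T\<close> hardly
  changes along an orbit, two orbits driven by the same word approach each other, and the weights of
  a short word at two points are comparable. This gives polynomial bounds for the variances of Birkhoff sums and
  a law of large numbers at a polynomial rate.

  For most pairs of a point and a word, an initial segment of the word of small relative length leads
  to a point of a fixed ball after which all partial sums of the logarithmic derivatives are negative.
  From there on conformality controls the distortion on a ball of fixed radius. Counting words
  by their weights gives covers for the upper bound. For the lower bound, words with images near one point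
  are counted by volume: by the open set condition and the injectivity of the maps they contain disjoint balls of comparable
  radius, and in a compact part of the closure of \<^term>\<open>U\<close> these balls can be taken of a uniform
  size.
\<close>

section \<open>Words and orbits\<close>

text \<open>The hypothesis contracts only in the mean: along a given word two points may separate,
  so there is no bounded distortion from an arbitrary point on. After a regular time a ball of fixed
  radius stays small, and distortion costs a factor exp(\<epsilon> n). Such factors, and the n + 1
  choices of the regular time, do not affect the dimension, since \<epsilon> is arbitrary. The sup
  norm and the Hoelder constant of \<open>T n\<close> are only known to grow at most linearly in n.
  What breaks the linear growth is that one step of the walk changes \<open>T n\<close> only by the
  order of sqrt n in quadratic mean. Orbits are compared over about log n letters, a time for which
  the ratio of weights, at most \<delta>^(-l), is still a small power of n. For the upper bound it
  is enough that exceptional probabilities tend to 0, as a limsup set needs only infinitely many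
  scales. For the lower bound the sets of a cover have many different scales, and the exceptional
  probabilities are summed over them. The polynomial rate makes them summable along the lengths j^Q,
  which are dense enough because (j + 1)^Q / j^Q tends to 1.\<close>

definition words :: "nat \<Rightarrow> nat \<Rightarrow> nat list set" where
  "words k n = {w. length w = n \<and> set w \<subseteq> {..<k}}"

text \<open>The head of the word is the first map to act, so that a word is a trajectory of the
  random walk, \<open>take\<close> gives its past and \<open>drop\<close> its future.\<close>

primrec orbit :: "(nat \<Rightarrow> 'a \<Rightarrow> 'a) \<Rightarrow> nat list \<Rightarrow> 'a \<Rightarrow> 'a" where
  "orbit h [] x = x"
| "orbit h (i # w) x = orbit h w (h i x)"

primrec weight :: "(nat \<Rightarrow> 'a \<Rightarrow> 'a) \<Rightarrow> (nat \<Rightarrow> 'a \<Rightarrow> real) \<Rightarrow> nat list \<Rightarrow> 'a \<Rightarrow> real" where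
  "weight h p [] x = 1"
| "weight h p (i # w) x = p i x * weight h p w (h i x)"

text \<open>Observables see the letter about to be used and the point it is applied to, because the
  logarithms of p_i and of h_i' depend on both.\<close>

primrec birkhoff :: "(nat \<Rightarrow> 'a \<Rightarrow> 'a) \<Rightarrow> (nat \<Rightarrow> 'a \<Rightarrow> real) \<Rightarrow> nat list \<Rightarrow> 'a \<Rightarrow> real" where
  "birkhoff h f [] x = 0"
| "birkhoff h f (i # w) x = f i x + birkhoff h f w (h i x)"

lemma finite_words [simp]: "finite (words k n)"
  using finite_lists_length_eq[of "{..<k}" n] by (simp add: words_def conj_commute)

lemma words_0 [simp]: "words k 0 = {[]}"
  by (auto simp: words_def)

lemma words_Suc: "words k (Suc n) = (\<lambda>(i, w). i # w) ` ({..<k} \<times> words k n)"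
  by (force simp: words_def length_Suc_conv)

lemma words_SucE:
  assumes "w \<in> words k (Suc n)"
  obtains i v where "w = i # v" "i < k" "v \<in> words k n"
  using assms by (auto simp: words_Suc)

lemma sum_words_Suc:
  "(\<Sum>w\<in>words k (Suc n). F w) = (\<Sum>i<k. \<Sum>w\<in>words k n. F (i # w))"
proof -
  have "inj_on (\<lambda>(i, w). i # w) ({..<k} \<times> words k n)"
    by (auto simp: inj_on_def)
  then have "(\<Sum>w\<in>words k (Suc n). F w) = (\<Sum>(i, w)\<in>{..<k} \<times> words k n. F (i # w))"
    unfolding words_Suc by (subst sum.reindex) (auto simp: case_prod_unfold)
  then show ?thesis by (simp add: sum.cartesian_product)
qed

lemma sum_words_add:
  "(\<Sum>w\<in>words k (m + n). F w) = (\<Sum>u\<in>words k m. \<Sum>v\<in>words k n. F (u @ v))"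
  by (induction m arbitrary: F) (simp_all add: sum_words_Suc)

lemma length_words: "w \<in> words k n \<Longrightarrow> length w = n"
  by (simp add: words_def)

lemma take_words: "w \<in> words k n \<Longrightarrow> m \<le> n \<Longrightarrow> take m w \<in> words k m"
  by (auto simp: words_def dest: in_set_takeD)

lemma drop_words: "w \<in> words k n \<Longrightarrow> drop m w \<in> words k (n - m)"
  by (auto simp: words_def dest: in_set_dropD)

lemma nth_words: "w \<in> words k n \<Longrightarrow> m < n \<Longrightarrow> w ! m < k"
  using nth_mem by (force simp: words_def)

lemma orbit_append: "orbit h (u @ v) x = orbit h v (orbit h u x)"
  by (induction u arbitrary: x) auto

lemma weight_append: "weight h p (u @ v) x = weight h p u x * weight h p v (orbit h u x)"
  by (induction u arbitrary: x) auto

lemma birkhoff_append: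
  "birkhoff h f (u @ v) x = birkhoff h f u x + birkhoff h f v (orbit h u x)"
  by (induction u arbitrary: x) auto

lemma birkhoff_diff_const:
  "birkhoff h (\<lambda>i x. f i x - c) w x = birkhoff h f w x - real (length w) * c"
  by (induction w arbitrary: x) (auto simp: algebra_simps)

lemma birkhoff_abs_le:
  assumes "\<And>i x. i < k \<Longrightarrow> \<bar>f i x\<bar> \<le> B" "w \<in> words k n"
  shows "\<bar>birkhoff h f w x\<bar> \<le> real n * B"
  using assms(2)
proof (induction n arbitrary: w x)
  case (Suc n)
  from Suc.prems(1) obtain i v where w: "w = i # v" "i < k" "v \<in> words k n"
    by (rule words_SucE)
  show ?case
    using Suc.IH[OF w(3), of "h i x"] assms(1)[OF w(2), of x]
    by (simp add: w(1) algebra_simps)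
qed simp

lemma birkhoff_step_le:
  assumes "\<And>i x. i < k \<Longrightarrow> \<bar>f i x\<bar> \<le> B" "w \<in> words k n" "m \<le> m'" "m' \<le> n"
  shows "\<bar>birkhoff h f (take m' w) x - birkhoff h f (take m w) x\<bar> \<le> real (m' - m) * B"
proof -
  have "take m' w = take m w @ drop m (take m' w)"
    by (metis append_take_drop_id assms(3) min.absorb1 take_take)
  then have "birkhoff h f (take m' w) x - birkhoff h f (take m w) x
      = birkhoff h f (drop m (take m' w)) (orbit h (take m w) x)"
    using birkhoff_append[of h f "take m w" "drop m (take m' w)" x] by simp
  moreover have "drop m (take m' w) \<in> words k (m' - m)"
    using assms by (intro drop_words take_words)
  ultimately show ?thesis
    using birkhoff_abs_le[where h = h and f = f and B = B and k = k, OF assms(1)] by simp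
qed

lemma weight_eq_exp:
  assumes "\<And>i x. i < k \<Longrightarrow> 0 < p i x" "w \<in> words k n"
  shows "weight h p w x = exp (birkhoff h (\<lambda>i x. ln (p i x)) w x)"
  using assms(2)
proof (induction n arbitrary: w x)
  case (Suc n)
  from Suc.prems(1) obtain i v where w: "w = i # v" "i < k" "v \<in> words k n"
    by (rule words_SucE)
  show ?case
    using Suc.IH[OF w(3), of "h i x"] assms(1)[OF w(2), of x]
    by (simp add: w(1) exp_add)
qed simp

lemma continuous_on_orbit:
  assumes "\<And>i. i < k \<Longrightarrow> continuous_on UNIV (h i)" "w \<in> words k n"
  shows "continuous_on UNIV (orbit h w)"
  using assms(2)
proof (induction n arbitrary: w)
  case 0
  then show ?case by (simp add: continuous_on_id)
next
  case (Suc n)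
  from Suc.prems(1) obtain i v where w: "w = i # v" "i < k" "v \<in> words k n"
    by (rule words_SucE)
  show ?case
    using continuous_on_compose2[OF Suc.IH[OF w(3)] assms(1)[OF w(2)]] by (simp add: w(1))
qed

lemma continuous_on_weight:
  assumes "\<And>i. i < k \<Longrightarrow> continuous_on UNIV (h i)" "\<And>i. i < k \<Longrightarrow> continuous_on UNIV (p i)"
    "w \<in> words k n"
  shows "continuous_on UNIV (weight h p w)"
  using assms(3)
proof (induction n arbitrary: w)
  case 0
  then show ?case by simp
next
  case (Suc n)
  from Suc.prems(1) obtain i v where w: "w = i # v" "i < k" "v \<in> words k n"
    by (rule words_SucE)
  show ?case
    using continuous_on_mult[OF assms(2)[OF w(2)]
      continuous_on_compose2[OF Suc.IH[OF w(3)] assms(1)[OF w(2)]]]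
    by (simp add: w(1))
qed

lemma continuous_on_birkhoff:
  assumes "\<And>i. i < k \<Longrightarrow> continuous_on UNIV (h i)" "\<And>i. i < k \<Longrightarrow> continuous_on UNIV (f i)"
    "w \<in> words k n"
  shows "continuous_on UNIV (birkhoff h f w)"
  using assms(3)
proof (induction n arbitrary: w)
  case 0
  then show ?case by simp
next
  case (Suc n)
  from Suc.prems(1) obtain i v where w: "w = i # v" "i < k" "v \<in> words k n"
    by (rule words_SucE)
  show ?case
    using continuous_on_add[OF assms(2)[OF w(2)]
      continuous_on_compose2[OF Suc.IH[OF w(3)] assms(1)[OF w(2)]]]
    by (simp add: w(1))
qed

section \<open>Average contraction\<close>

lemma powr_add_le:
  fixes a b q :: real
  assumes "0 \<le> a" "0 \<le> b" "0 < q" "q \<le> 1"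
  shows "(a + b) powr q \<le> a powr q + b powr q"
proof (cases "a + b = 0")
  case False
  then have s: "a + b > 0" using assms by linarith
  \<comment> \<open>By homogeneity the sum may be scaled to 1; then both summands lie in [0,1],
    where the power q <= 1 can only increase them.\<close>
  have *: "t \<le> t powr q" if "0 \<le> t" "t \<le> 1" for t :: real
    using powr_mono'[of q 1 t] that assms by auto
  have "1 = a / (a + b) + b / (a + b)"
    using s by (simp add: add_divide_distrib[symmetric])
  also have "\<dots> \<le> (a / (a + b)) powr q + (b / (a + b)) powr q"
    using s assms by (intro add_mono *) (auto simp: divide_simps)
  also have "\<dots> = (a powr q + b powr q) / (a + b) powr q"
    using s assms by (simp add: powr_divide add_divide_distrib)
  finally show ?thesis using s by (simp add: divide_simps)
qed (use assms in auto)

text \<open>Distances up to 1 are served by the exponent \<alpha>, larger ones by the oscillation 2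
  B. This allows \<alpha> to be replaced by one small exponent that suits all estimates.\<close>

lemma holder_of_bounded:
  fixes f :: "'a::metric_space \<Rightarrow> real"
  assumes "\<And>x. \<bar>f x\<bar> \<le> B" "\<And>x y. \<bar>f x - f y\<bar> \<le> C * dist x y powr \<alpha>"
    "0 < q" "q \<le> \<alpha>" "0 \<le> C"
  shows "\<bar>f x - f y\<bar> \<le> (2 * B + C) * dist x y powr q"
proof (cases "dist x y \<le> 1")
  case True
  have "dist x y powr \<alpha> \<le> dist x y powr q"
    using True assms by (intro powr_mono') auto
  moreover have "0 \<le> B" using assms(1)[of x] by linarith
  ultimately have "C * dist x y powr \<alpha> \<le> (2 * B + C) * dist x y powr q"
    using assms by (intro mult_mono) auto
  then show ?thesis using assms(2)[of x y] by linarith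
next
  case False
  then have d: "1 \<le> dist x y powr q" using assms by (intro ge_one_powr_ge_zero) auto
  have "0 \<le> B" using assms(1)[of x] by linarith
  have "\<bar>f x - f y\<bar> \<le> 2 * B" using assms(1)[of x] assms(1)[of y] by linarith
  also have "\<dots> \<le> (2 * B + C) * 1" using assms by simp
  also have "\<dots> \<le> (2 * B + C) * dist x y powr q"
    using d \<open>0 \<le> B\<close> assms by (intro mult_left_mono) auto
  finally show ?thesis .
qed

lemma continuous_on_of_holder:
  fixes f :: "'a::metric_space \<Rightarrow> real"
  assumes "\<And>x y. \<bar>f x - f y\<bar> \<le> C * dist x y powr q" "0 < q"
  shows "continuous_on UNIV f"
proof (intro continuous_at_imp_continuous_on ballI)
  fix x :: 'a
  have "((\<lambda>y. C * dist y x powr q) \<longlongrightarrow> C * 0 powr q) (at x)"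
    using assms by (intro tendsto_intros tendsto_powr') (auto intro!: tendsto_eq_intros)
  then have "((\<lambda>y. C * dist y x powr q) \<longlongrightarrow> 0) (at x)" by simp
  then have "((\<lambda>y. f y - f x) \<longlongrightarrow> 0) (at x)"
    by (rule Lim_null_comparison[rotated]) (use assms in auto)
  then show "isCont f x" by (simp add: isCont_def LIM_zero_iff)
qed

text \<open>A random walk that goes from x to h_i x with probability p_i x. The same
  \<open>q\<close> serves the contraction and the Hoelder bounds, so that bounded q-Hoelder
  functions stay in their class under averaging over a step; q <= 1 gives
  \<open>dist x y powr q\<close> a triangle inequality. The bound \<delta> < 1 makes ln \<delta>
  negative.\<close>

locale average_contraction =
  fixes k :: nat and h :: "nat \<Rightarrow> 'a::euclidean_space \<Rightarrow> 'a"
    and p :: "nat \<Rightarrow> 'a \<Rightarrow> real" and \<nu> :: "'a measure"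
    and \<delta> q \<rho> Cp :: real
  assumes h_cont: "\<And>i. i < k \<Longrightarrow> continuous_on UNIV (h i)"
    and \<delta>: "0 < \<delta>" "\<delta> < 1"
    and p_ge: "\<And>i x. i < k \<Longrightarrow> \<delta> \<le> p i x"
    and p_le: "\<And>i x. i < k \<Longrightarrow> p i x \<le> 1"
    and p_sum: "\<And>x. (\<Sum>i<k. p i x) = 1"
    and q: "0 < q" "q \<le> 1"
    and \<rho>: "0 < \<rho>" "\<rho> < 1"
    and contraction: "\<And>x y. (\<Sum>i<k. p i x * dist (h i x) (h i y) powr q) \<le> \<rho> * dist x y powr q"
    and Cp: "0 \<le> Cp"
    and p_holder: "\<And>i x y. i < k \<Longrightarrow> \<bar>p i x - p i y\<bar> \<le> Cp * dist x y powr q"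
    and invariant: "invariant_measure k h p \<nu>"
begin

sublocale prob_space \<nu>
  using invariant by (simp add: invariant_measure_def)

lemma sets_\<nu> [measurable_cong, simp]: "sets \<nu> = sets borel"
  using invariant by (simp add: invariant_measure_def)

lemma space_\<nu> [simp]: "space \<nu> = UNIV"
  using sets_eq_imp_space_eq[OF sets_\<nu>] by simp

lemma p_pos: "i < k \<Longrightarrow> 0 < p i x"
  using p_ge[of i x] \<delta> by linarith

lemma weighted_sum_abs_le:
  assumes "\<And>i. i < k \<Longrightarrow> \<bar>a i\<bar> \<le> B" shows "\<bar>\<Sum>i<k. p i x * a i\<bar> \<le> B"
proof -
  have "\<bar>\<Sum>i<k. p i x * a i\<bar> \<le> (\<Sum>i<k. p i x * B)"
    using assms p_pos
    by (intro order.trans[OF sum_abs] sum_mono) (auto simp: abs_mult less_imp_le intro!: mult_left_mono)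
  then show ?thesis by (simp add: sum_distrib_right[symmetric] p_sum)
qed

lemma p_cont: "i < k \<Longrightarrow> continuous_on UNIV (p i)"
  using p_holder q by (intro continuous_on_of_holder)

lemma weight_cont: "w \<in> words k n \<Longrightarrow> continuous_on UNIV (weight h p w)"
  using h_cont p_cont by (rule continuous_on_weight)

lemma orbit_cont: "w \<in> words k n \<Longrightarrow> continuous_on UNIV (orbit h w)"
  using h_cont by (rule continuous_on_orbit)

lemma weight_bounds:
  "w \<in> words k n \<Longrightarrow> \<delta> ^ n \<le> weight h p w x \<and> weight h p w x \<le> 1"
proof (induction n arbitrary: w x)
  case (Suc n)
  from Suc.prems(1) obtain i v where w: "w = i # v" "i < k" "v \<in> words k n"
    by (rule words_SucE)
  have "\<delta> * \<delta> ^ n \<le> p i x * weight h p v (h i x)"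
    using Suc.IH[OF w(3), of "h i x"] p_ge[OF w(2), of x] \<delta> by (intro mult_mono) auto
  moreover have "p i x * weight h p v (h i x) \<le> 1 * 1"
    using Suc.IH[OF w(3), of "h i x"] p_le[OF w(2), of x] p_pos[OF w(2), of x] \<delta>
      zero_less_power[of \<delta> n]
    by (intro mult_mono) linarith+
  ultimately show ?case by (simp add: w(1))
qed simp

lemma weight_nonneg: "w \<in> words k n \<Longrightarrow> 0 \<le> weight h p w x"
  using weight_bounds[of w n x] \<delta> zero_less_power[of \<delta> n] by linarith

text \<open>Expectation over n steps of the walk started at x. The functional may mention points
  itself, so the trajectories of another point can be averaged with the weights at x.\<close>

definition expect :: "nat \<Rightarrow> (nat list \<Rightarrow> real) \<Rightarrow> 'a \<Rightarrow> real" where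
  "expect n F x = (\<Sum>w\<in>words k n. weight h p w x * F w)"

lemma expect_0 [simp]: "expect 0 F x = F []"
  by (simp add: expect_def)

lemma expect_Suc: "expect (Suc n) F x = (\<Sum>i<k. p i x * expect n (\<lambda>w. F (i # w)) (h i x))"
  by (simp add: expect_def sum_words_Suc sum_distrib_left mult.assoc)

lemma expect_const [simp]: "expect n (\<lambda>_. c) x = c"
  by (induction n arbitrary: x) (simp_all add: expect_Suc sum_distrib_right[symmetric] p_sum)

lemma sum_weight: "(\<Sum>w\<in>words k n. weight h p w x) = 1"
  using expect_const[of n 1 x] by (simp add: expect_def del: expect_const)

lemma expect_add: "expect n (\<lambda>w. F w + G w) x = expect n F x + expect n G x"
  by (simp add: expect_def sum.distrib algebra_simps)

lemma expect_cmult: "expect n (\<lambda>w. c * F w) x = c * expect n F x"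
  by (simp add: expect_def sum_distrib_left algebra_simps)

lemma expect_mono: "(\<And>w. w \<in> words k n \<Longrightarrow> F w \<le> G w) \<Longrightarrow> expect n F x \<le> expect n G x"
  unfolding expect_def by (intro sum_mono mult_left_mono weight_nonneg)

lemma expect_abs_le: "(\<And>w. w \<in> words k n \<Longrightarrow> \<bar>F w\<bar> \<le> B) \<Longrightarrow> \<bar>expect n F x\<bar> \<le> B"
  using expect_mono[of n F "\<lambda>_. B" x] expect_mono[of n "\<lambda>_. - B" F x]
  by (force simp: abs_le_iff)

lemma expect_cont:
  assumes "\<And>w. w \<in> words k n \<Longrightarrow> continuous_on UNIV (F w)"
  shows "continuous_on UNIV (\<lambda>x. expect n (\<lambda>w. F w x) x)"
  unfolding expect_def using assms weight_cont
  by (intro continuous_on_sum continuous_on_mult)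

lemma integrable_cont_bounded:
  fixes g :: "'a \<Rightarrow> real"
  assumes "continuous_on UNIV g" "\<And>x. \<bar>g x\<bar> \<le> B"
  shows "integrable \<nu> g"
proof (rule integrable_const_bound[where B = B])
  show "AE x in \<nu>. norm (g x) \<le> B" using assms by simp
  show "g \<in> borel_measurable \<nu>"
    using borel_measurable_continuous_onI[OF assms(1)] by (simp cong: measurable_cong_sets)
qed

lemma measurable_h [measurable]: "i < k \<Longrightarrow> h i \<in> borel_measurable borel"
  by (intro borel_measurable_continuous_onI h_cont)

lemma measurable_p [measurable]: "i < k \<Longrightarrow> p i \<in> borel_measurable borel"
  by (intro borel_measurable_continuous_onI p_cont)

lemma measurable_weight [measurable]:
  "w \<in> words k n \<Longrightarrow> weight h p w \<in> borel_measurable borel"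
  by (intro borel_measurable_continuous_onI weight_cont)

lemma measurable_orbit [measurable]:
  "w \<in> words k n \<Longrightarrow> orbit h w \<in> borel_measurable borel"
  by (intro borel_measurable_continuous_onI orbit_cont)

text \<open>Invariance is given for indicators only; induction over measurable functions extends it.
  The maps are treated one at a time, hence the sum in front of the integral.\<close>

lemma stationary_nn_sum:
  assumes "g \<in> borel_measurable borel"
  shows "(\<integral>\<^sup>+x. g x \<partial>\<nu>) = (\<Sum>i<k. \<integral>\<^sup>+x. ennreal (p i x) * g (h i x) \<partial>\<nu>)"
  using assms
proof (induction g rule: borel_measurable_induct)
  case (cong f g)
  then have "f = g" by auto
  then show ?case using cong by simp
next
  case (set A)
  then show ?case using invariant by (simp add: invariant_measure_def)
next
  case (mult u c)
  have [measurable]: "u \<in> borel_measurable borel" by fact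
  have "(\<integral>\<^sup>+x. ennreal (p i x) * (c * u (h i x)) \<partial>\<nu>) = c * (\<integral>\<^sup>+x. ennreal (p i x) * u (h i x) \<partial>\<nu>)"
    if "i < k" for i
  proof -
    have [measurable]: "i < k" by fact
    show ?thesis
      by (subst nn_integral_cmult[symmetric]) (auto intro!: nn_integral_cong simp: ac_simps)
  qed
  then show ?case
    using mult by (simp add: nn_integral_cmult sum_distrib_left)
next
  case (add u v)
  have [measurable]: "u \<in> borel_measurable borel" "v \<in> borel_measurable borel" by fact+
  have "(\<integral>\<^sup>+x. ennreal (p i x) * (v (h i x) + u (h i x)) \<partial>\<nu>)
      = (\<integral>\<^sup>+x. ennreal (p i x) * v (h i x) \<partial>\<nu>) + (\<integral>\<^sup>+x. ennreal (p i x) * u (h i x) \<partial>\<nu>)"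
    if "i < k" for i
  proof -
    have [measurable]: "i < k" by fact
    show ?thesis
      by (subst nn_integral_add[symmetric]) (auto intro!: nn_integral_cong simp: distrib_left)
  qed
  then show ?case
    using add by (simp add: nn_integral_add sum.distrib)
next
  case (seq U)
  have [measurable]: "\<And>i. U i \<in> borel_measurable borel" by fact
  have inc: "incseq (\<lambda>n. U n y)" for y
    using \<open>incseq U\<close> by (auto simp: incseq_def le_fun_def)
  have S: "(SUP i. U i) y = (SUP i. U i y)" for y
    by (simp add: SUP_apply image_image)
  have "(\<integral>\<^sup>+x. ennreal (p i x) * (SUP n. U n (h i x)) \<partial>\<nu>)
      = (SUP n. \<integral>\<^sup>+x. ennreal (p i x) * U n (h i x) \<partial>\<nu>)" if "i < k" for i
  proof -
    have [measurable]: "i < k" by fact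
    show ?thesis unfolding SUP_mult_left_ennreal
      using inc by (intro nn_integral_monotone_convergence_SUP)
        (auto simp: incseq_def le_fun_def intro!: mult_left_mono)
  qed
  then have "(\<Sum>i<k. \<integral>\<^sup>+x. ennreal (p i x) * (SUP i. U i) (h i x) \<partial>\<nu>)
      = (\<Sum>i<k. SUP n. \<integral>\<^sup>+x. ennreal (p i x) * U n (h i x) \<partial>\<nu>)"
    unfolding S by (intro sum.cong) auto
  also have "\<dots> = (SUP n. \<Sum>i<k. \<integral>\<^sup>+x. ennreal (p i x) * U n (h i x) \<partial>\<nu>)"
    using inc by (intro ennreal_SUP_sum[symmetric])
      (auto simp: incseq_def intro!: nn_integral_mono mult_left_mono)
  also have "\<dots> = (SUP n. \<integral>\<^sup>+x. U n x \<partial>\<nu>)"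
    using seq by simp
  also have "\<dots> = (\<integral>\<^sup>+x. (SUP i. U i) x \<partial>\<nu>)"
    unfolding S using \<open>incseq U\<close> by (intro nn_integral_monotone_convergence_SUP[symmetric]) auto
  finally show ?case by simp
qed

lemma stationary_nn:
  assumes [measurable]: "g \<in> borel_measurable borel"
  shows "(\<integral>\<^sup>+x. g x \<partial>\<nu>) = (\<integral>\<^sup>+x. (\<Sum>i<k. ennreal (p i x) * g (h i x)) \<partial>\<nu>)"
  by (subst stationary_nn_sum[OF assms], subst nn_integral_sum) auto

lemma stationary:
  fixes g :: "'a \<Rightarrow> real"
  assumes g: "continuous_on UNIV g" "\<And>x. \<bar>g x\<bar> \<le> B"
  shows "(\<integral>x. (\<Sum>i<k. p i x * g (h i x)) \<partial>\<nu>) = (\<integral>x. g x \<partial>\<nu>)"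
proof -
  have B: "0 \<le> g x + B" for x using g(2)[of x] by linarith
  have [measurable]: "g \<in> borel_measurable borel"
    using g by (intro borel_measurable_continuous_onI)
  have eq: "(\<Sum>i<k. p i x * (g (h i x) + B)) = (\<Sum>i<k. p i x * g (h i x)) + B" for x
    by (simp add: distrib_left sum.distrib sum_distrib_right[symmetric] p_sum)
  have c: "continuous_on UNIV (\<lambda>x. \<Sum>i<k. p i x * g (h i x))"
    using p_cont h_cont continuous_on_compose2[OF g(1)]
    by (intro continuous_on_sum continuous_on_mult) auto
  have b: "\<bar>\<Sum>i<k. p i x * g (h i x)\<bar> \<le> B" for x
    using g(2) by (rule weighted_sum_abs_le)
  have b': "0 \<le> (\<Sum>i<k. p i x * g (h i x)) + B" for x using b[of x] by linarith
  have ig: "integrable \<nu> g" by (rule integrable_cont_bounded[OF g])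
  have ip: "integrable \<nu> (\<lambda>x. \<Sum>i<k. p i x * g (h i x))"
    by (rule integrable_cont_bounded[OF c b])
  \<comment> \<open>The shift by B makes the integrand nonnegative, so that the
    \<open>ennreal\<close> version applies; it passes through the average because the p_i sum to
    1.\<close>
  have "ennreal (\<integral>x. g x + B \<partial>\<nu>) = (\<integral>\<^sup>+x. ennreal (g x + B) \<partial>\<nu>)"
    using ig B by (intro nn_integral_eq_integral[symmetric]) auto
  also have "\<dots> = (\<integral>\<^sup>+x. (\<Sum>i<k. ennreal (p i x) * ennreal (g (h i x) + B)) \<partial>\<nu>)"
    by (rule stationary_nn) measurable
  also have "\<dots> = (\<integral>\<^sup>+x. ennreal ((\<Sum>i<k. p i x * g (h i x)) + B) \<partial>\<nu>)"
    using B p_pos by (intro nn_integral_cong)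
      (auto simp: eq[symmetric] ennreal_mult''[symmetric] less_imp_le intro!: sum_ennreal)
  also have "\<dots> = ennreal (\<integral>x. (\<Sum>i<k. p i x * g (h i x)) + B \<partial>\<nu>)"
    using ip b' by (intro nn_integral_eq_integral) auto
  finally have "(\<integral>x. g x + B \<partial>\<nu>) = (\<integral>x. (\<Sum>i<k. p i x * g (h i x)) + B \<partial>\<nu>)"
    using B b' by (subst (asm) ennreal_inj) (auto intro!: integral_nonneg_AE AE_I2)
  then show ?thesis using ig ip by simp
qed

end

section \<open>Moments and support of the invariant measure\<close>

context average_contraction
begin

text \<open>Both points are driven by the same word, which is drawn with the weights at x alone. The
  hypothesis has the same asymmetry, and this lets it be iterated.\<close>

lemma contraction_words:
  "expect n (\<lambda>w. dist (orbit h w x) (orbit h w y) powr q) x \<le> \<rho> ^ n * dist x y powr q"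
proof (induction n arbitrary: x y)
  case (Suc n)
  have "expect (Suc n) (\<lambda>w. dist (orbit h w x) (orbit h w y) powr q) x
      \<le> (\<Sum>i<k. p i x * (\<rho> ^ n * dist (h i x) (h i y) powr q))"
    using Suc.IH p_pos by (auto simp: expect_Suc less_imp_le intro!: sum_mono mult_left_mono)
  also have "\<dots> = \<rho> ^ n * (\<Sum>i<k. p i x * dist (h i x) (h i y) powr q)"
    by (simp add: sum_distrib_left algebra_simps)
  also have "\<dots> \<le> \<rho> ^ n * (\<rho> * dist x y powr q)"
    using contraction \<rho> by (intro mult_left_mono) auto
  finally show ?case by (simp add: ac_simps)
qed simp

lemma cont_comp_orbit:
  "continuous_on UNIV g \<Longrightarrow> w \<in> words k n \<Longrightarrow> continuous_on UNIV (\<lambda>x. g (orbit h w x))"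
  using continuous_on_compose2[of UNIV g UNIV "orbit h w"] orbit_cont by auto

lemma stationary_words:
  fixes g :: "'a \<Rightarrow> real"
  assumes g: "continuous_on UNIV g" "\<And>x. \<bar>g x\<bar> \<le> B"
  shows "(\<integral>x. expect n (\<lambda>w. g (orbit h w x)) x \<partial>\<nu>) = (\<integral>x. g x \<partial>\<nu>)"
proof (induction n)
  case (Suc n)
  let ?G = "\<lambda>x. expect n (\<lambda>w. g (orbit h w x)) x"
  have "(\<integral>x. expect (Suc n) (\<lambda>w. g (orbit h w x)) x \<partial>\<nu>) = (\<integral>x. (\<Sum>i<k. p i x * ?G (h i x)) \<partial>\<nu>)"
    by (simp add: expect_Suc)
  also have "\<dots> = (\<integral>x. ?G x \<partial>\<nu>)"
    using g by (intro stationary[where B = B] expect_cont cont_comp_orbit expect_abs_le) auto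
  finally show ?case using Suc by simp
qed simp

text \<open>The device for forgetting the starting point: V is not known to be integrable, and the
  truncation at L makes dominated convergence available.\<close>

lemma tendsto_integral_min:
  fixes V :: "'a \<Rightarrow> real"
  assumes V: "continuous_on UNIV V" "\<And>x. 0 \<le> V x" and c: "0 \<le> c" "0 \<le> L"
  shows "(\<lambda>n. \<integral>x. min L (\<rho> ^ n * V x + c) \<partial>\<nu>) \<longlonglongrightarrow> min L c"
proof -
  have [measurable]: "V \<in> borel_measurable borel"
    using V by (intro borel_measurable_continuous_onI)
  have "(\<lambda>n. \<integral>x. min L (\<rho> ^ n * V x + c) \<partial>\<nu>) \<longlonglongrightarrow> (\<integral>x. min L c \<partial>\<nu>)"
  proof (rule integral_dominated_convergence[where w = "\<lambda>_. L"])
    show "AE x in \<nu>. (\<lambda>n. min L (\<rho> ^ n * V x + c)) \<longlonglongrightarrow> min L c"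
    proof (intro AE_I2)
      fix x
      have "(\<lambda>n. min L (\<rho> ^ n * V x + c)) \<longlonglongrightarrow> min L (0 * V x + c)"
        using \<rho> by (intro tendsto_intros LIMSEQ_realpow_zero) auto
      then show "(\<lambda>n. min L (\<rho> ^ n * V x + c)) \<longlonglongrightarrow> min L c" by simp
    qed
    show "AE x in \<nu>. norm (min L (\<rho> ^ n * V x + c)) \<le> L" for n
      using V c \<rho> by (intro AE_I2) auto
  qed auto
  then show ?thesis using prob_space by simp
qed

text \<open>An invariant measure comes without moments. The drift inequality bounds the expected
  q-th moment after n steps by \<rho>^n |x|^q + c, but integrating it against \<nu> would presuppose
  the claim. So stationarity is used for the truncated moment, n tends to infinity, and only then is
  the truncation removed.\<close>

lemma integrable_norm_powr: "integrable \<nu> (\<lambda>x. norm x powr q)"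
proof -
  define A where "A = (\<Sum>i<k. norm (h i 0) powr q)"
  have A: "0 \<le> A" unfolding A_def by (intro sum_nonneg) auto
  have drift: "(\<Sum>i<k. p i x * norm (h i x) powr q) \<le> \<rho> * norm x powr q + A" for x
  proof -
    have "(\<Sum>i<k. p i x * norm (h i x) powr q)
        \<le> (\<Sum>i<k. p i x * dist (h i x) (h i 0) powr q + norm (h i 0) powr q)"
    proof (intro sum_mono)
      fix i assume i: "i \<in> {..<k}"
      have "norm (h i x) powr q \<le> (dist (h i x) (h i 0) + norm (h i 0)) powr q"
        using q norm_triangle_ineq2[of "h i x" "h i 0"]
        by (intro powr_mono2) (auto simp: dist_norm)
      also have "\<dots> \<le> dist (h i x) (h i 0) powr q + norm (h i 0) powr q"
        using q by (intro powr_add_le) auto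
      finally have "p i x * norm (h i x) powr q
          \<le> p i x * dist (h i x) (h i 0) powr q + p i x * norm (h i 0) powr q"
        using p_pos[of i x] i by (metis distrib_left lessThan_iff less_imp_le mult_left_mono)
      also have "p i x * norm (h i 0) powr q \<le> 1 * norm (h i 0) powr q"
        using p_le i by (intro mult_right_mono) auto
      finally show "p i x * norm (h i x) powr q
          \<le> p i x * dist (h i x) (h i 0) powr q + norm (h i 0) powr q" by simp
    qed
    then show ?thesis using contraction[of x 0] by (simp add: sum.distrib A_def)
  qed
  have iter: "expect n (\<lambda>w. norm (orbit h w x) powr q) x
      \<le> \<rho> ^ n * norm x powr q + A * (1 - \<rho> ^ n) / (1 - \<rho>)" for n x
  proof (induction n arbitrary: x)
    case (Suc n)
    have "expect (Suc n) (\<lambda>w. norm (orbit h w x) powr q) x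
        \<le> (\<Sum>i<k. p i x * (\<rho> ^ n * norm (h i x) powr q + A * (1 - \<rho> ^ n) / (1 - \<rho>)))"
      using Suc p_pos by (auto simp: expect_Suc less_imp_le intro!: sum_mono mult_left_mono)
    also have "\<dots> = \<rho> ^ n * (\<Sum>i<k. p i x * norm (h i x) powr q) + A * (1 - \<rho> ^ n) / (1 - \<rho>)"
    proof -
      have "(\<Sum>i<k. p i x * (\<rho> ^ n * norm (h i x) powr q + A * (1 - \<rho> ^ n) / (1 - \<rho>)))
        = (\<Sum>i<k. \<rho> ^ n * (p i x * norm (h i x) powr q)) + (\<Sum>i<k. p i x) * (A * (1 - \<rho> ^ n) / (1 - \<rho>))"
        unfolding sum_distrib_right sum.distrib[symmetric] by (intro sum.cong) (simp_all add: algebra_simps)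
      then show ?thesis by (simp add: p_sum sum_distrib_left)
    qed
    also have "\<dots> \<le> \<rho> ^ n * (\<rho> * norm x powr q + A) + A * (1 - \<rho> ^ n) / (1 - \<rho>)"
      using drift \<rho> by (intro add_right_mono mult_left_mono) auto
    also have "\<dots> = \<rho> ^ Suc n * norm x powr q + A * (1 - \<rho> ^ Suc n) / (1 - \<rho>)"
      using \<rho> by (simp add: field_simps)
    finally show ?case .
  qed simp
  define c where "c = A / (1 - \<rho>)"
  have c: "0 \<le> c" using A \<rho> by (simp add: c_def)
  have cont: "continuous_on UNIV (\<lambda>x::'a. norm x powr q)"
    using q by (intro continuous_on_powr' continuous_intros) auto
  have trunc: "(\<integral>x. min L (norm x powr q) \<partial>\<nu>) \<le> c" if L: "0 \<le> L" for L
  proof -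
    have "(\<integral>x. min L (norm x powr q) \<partial>\<nu>) \<le> min L c"
    proof (rule LIMSEQ_le_const)
    show "(\<lambda>n. \<integral>x. min L (\<rho> ^ n * norm x powr q + c) \<partial>\<nu>) \<longlonglongrightarrow> min L c"
      using cont c L by (intro tendsto_integral_min) auto
    have cL: "continuous_on UNIV (\<lambda>x::'a. min L (norm x powr q))"
      by (intro continuous_on_min cont continuous_on_const)
    have "(\<integral>x. min L (norm x powr q) \<partial>\<nu>) \<le> (\<integral>x. min L (\<rho> ^ n * norm x powr q + c) \<partial>\<nu>)" for n
    proof -
      have "(\<integral>x. min L (norm x powr q) \<partial>\<nu>)
          = (\<integral>x. expect n (\<lambda>w. min L (norm (orbit h w x) powr q)) x \<partial>\<nu>)"
        using cL L by (intro stationary_words[symmetric, where B = L]) auto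
      also have "\<dots> \<le> (\<integral>x. min L (\<rho> ^ n * norm x powr q + c) \<partial>\<nu>)"
      proof (rule integral_mono)
        show "integrable \<nu> (\<lambda>x. expect n (\<lambda>w. min L (norm (orbit h w x) powr q)) x)"
          using L by (intro integrable_cont_bounded[where B = L] expect_cont expect_abs_le
            cont_comp_orbit[where g = "\<lambda>x. min L (norm x powr q)"] cL) auto
        show "integrable \<nu> (\<lambda>x. min L (\<rho> ^ n * norm x powr q + c))"
          using L c \<rho> by (intro integrable_cont_bounded[where B = L] continuous_on_min
            continuous_on_add continuous_on_mult cont continuous_on_const) auto
        fix x
        have "expect n (\<lambda>w. min L (norm (orbit h w x) powr q)) x \<le> L"
          using expect_mono[of n "\<lambda>w. min L (norm (orbit h w x) powr q)" "\<lambda>_. L" x] by simp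
        moreover have "expect n (\<lambda>w. min L (norm (orbit h w x) powr q)) x
            \<le> expect n (\<lambda>w. norm (orbit h w x) powr q) x"
          by (intro expect_mono) auto
        moreover have "A * (1 - \<rho> ^ n) / (1 - \<rho>) \<le> c"
          using A \<rho> by (auto simp: c_def intro!: divide_right_mono mult_left_le)
        ultimately show "expect n (\<lambda>w. min L (norm (orbit h w x) powr q)) x
            \<le> min L (\<rho> ^ n * norm x powr q + c)"
          using iter[of n x] by auto
      qed
      finally show ?thesis .
    qed
    then show "\<exists>N. \<forall>n\<ge>N. (\<integral>x. min L (norm x powr q) \<partial>\<nu>) \<le> (\<integral>x. min L (\<rho> ^ n * norm x powr q + c) \<partial>\<nu>)"
      by blast
    qed
    then show ?thesis by simp
  qed
  have "(\<lambda>n. \<integral>\<^sup>+x. ennreal (min (real n) (norm x powr q)) \<partial>\<nu>) \<longlonglongrightarrow> (\<integral>\<^sup>+x. ennreal (norm x powr q) \<partial>\<nu>)"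
  proof (rule nn_integral_LIMSEQ)
    show "incseq (\<lambda>n x. ennreal (min (real n) (norm (x::'a) powr q)))"
      by (auto simp: incseq_def le_fun_def intro!: ennreal_leI)
    show "(\<lambda>n. ennreal (min (real n) (norm x powr q))) \<longlonglongrightarrow> ennreal (norm x powr q)" for x :: 'a
    proof (rule tendsto_eventually)
      show "\<forall>\<^sub>F n in sequentially. ennreal (min (real n) (norm x powr q)) = ennreal (norm x powr q)"
        using eventually_ge_at_top[of "nat \<lceil>norm x powr q\<rceil>"]
        by eventually_elim (simp add: min_def nat_ceiling_le_eq)
    qed
  qed measurable
  moreover have "(\<integral>\<^sup>+x. ennreal (min (real n) (norm x powr q)) \<partial>\<nu>) \<le> ennreal c" for n
  proof -
    have "(\<integral>\<^sup>+x. ennreal (min (real n) (norm x powr q)) \<partial>\<nu>) = ennreal (\<integral>x. min (real n) (norm x powr q) \<partial>\<nu>)"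
      by (intro nn_integral_eq_integral integrable_cont_bounded[where B = "real n"]
          continuous_on_min cont continuous_on_const) auto
    then show ?thesis using trunc[of "real n"] by (simp add: ennreal_leI)
  qed
  ultimately have "(\<integral>\<^sup>+x. ennreal (norm x powr q) \<partial>\<nu>) \<le> ennreal c"
    by (intro LIMSEQ_le_const2) auto
  also have "\<dots> < \<infinity>" by simp
  finally show ?thesis by (intro integrableI_nonneg) auto
qed

text \<open>In the mean the walk approaches the walk started at a point u of S, which never leaves
  S. The integral of the truncated distance to S does not change with n by stationarity, and tends
  to 0.\<close>

lemma AE_in_closed_invariant:
  assumes S: "closed S" "S \<noteq> {}" "\<And>i. i < k \<Longrightarrow> h i ` S \<subseteq> S"
  shows "AE x in \<nu>. x \<in> S"
proof -
  obtain u where u: "u \<in> S" using S by auto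
  have orb: "orbit h w u \<in> S" if "w \<in> words k n" for n w
    using that u
  proof (induction n arbitrary: w u)
    case (Suc n)
    then show ?case using S(3) by (fastforce simp: words_Suc)
  qed simp
  define g where "g x = min 1 (infdist x S powr q)" for x
  have cont: "continuous_on UNIV g"
    unfolding g_def using q by (intro continuous_on_min continuous_on_powr' continuous_intros) (auto simp: infdist_nonneg)
  have cd: "continuous_on UNIV (\<lambda>x. dist x u powr q)"
    using q by (intro continuous_on_powr' continuous_intros) auto
  have le: "(\<integral>x. g x \<partial>\<nu>) \<le> (\<integral>x. min 1 (\<rho> ^ n * dist x u powr q + 0) \<partial>\<nu>)" for n
  proof -
    have "(\<integral>x. g x \<partial>\<nu>) = (\<integral>x. expect n (\<lambda>w. g (orbit h w x)) x \<partial>\<nu>)"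
      using cont by (intro stationary_words[symmetric, where B = 1]) (auto simp: g_def)
    also have "\<dots> \<le> (\<integral>x. min 1 (\<rho> ^ n * dist x u powr q + 0) \<partial>\<nu>)"
    proof (rule integral_mono)
      show "integrable \<nu> (\<lambda>x. expect n (\<lambda>w. g (orbit h w x)) x)"
        by (intro integrable_cont_bounded[where B = 1] expect_cont expect_abs_le
            cont_comp_orbit cont) (auto simp: g_def)
      show "integrable \<nu> (\<lambda>x. min 1 (\<rho> ^ n * dist x u powr q + 0))"
        using \<rho> by (intro integrable_cont_bounded[where B = 1] continuous_on_min
            continuous_on_add continuous_on_mult cd continuous_on_const) auto
      fix x
      have "expect n (\<lambda>w. g (orbit h w x)) x \<le> 1"
        using expect_mono[of n "\<lambda>w. g (orbit h w x)" "\<lambda>_. 1" x] by (simp add: g_def)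
      moreover have "expect n (\<lambda>w. g (orbit h w x)) x
          \<le> expect n (\<lambda>w. dist (orbit h w x) (orbit h w u) powr q) x"
      proof (intro expect_mono)
        fix w assume "w \<in> words k n"
        then have "infdist (orbit h w x) S \<le> dist (orbit h w x) (orbit h w u)"
          by (intro infdist_le orb)
        then show "g (orbit h w x) \<le> dist (orbit h w x) (orbit h w u) powr q"
          unfolding g_def using q infdist_nonneg[of "orbit h w x" S]
          by (intro min.coboundedI2 powr_mono2) auto
      qed
      ultimately show "expect n (\<lambda>w. g (orbit h w x)) x \<le> min 1 (\<rho> ^ n * dist x u powr q + 0)"
        using contraction_words[of n x u] by auto
    qed
    finally show ?thesis .
  qed
  have "(\<integral>x. g x \<partial>\<nu>) \<le> min 1 0"
    using le by (intro LIMSEQ_le_const[OF tendsto_integral_min[of "\<lambda>x. dist x u powr q" 0 1]] exI[of _ 0])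
      (auto intro: cd)
  moreover have g0: "0 \<le> g x" for x by (simp add: g_def)
  then have "0 \<le> (\<integral>x. g x \<partial>\<nu>)" by (intro integral_nonneg_AE) auto
  ultimately have "(\<integral>x. g x \<partial>\<nu>) = 0" by simp
  moreover have "integrable \<nu> g"
    using cont by (intro integrable_cont_bounded[where B = 1]) (auto simp: g_def)
  ultimately have "AE x in \<nu>. g x = 0"
    using g0 by (subst (asm) integral_nonneg_eq_0_iff_AE) auto
  then show ?thesis
  proof eventually_elim
    fix x assume "g x = 0"
    then have "infdist x S = 0" using q by (auto simp: g_def min_def split: if_splits)
    then show "x \<in> S" using S in_closed_iff_infdist_zero by blast
  qed
qed

end

section \<open>A law of large numbers with a rate\<close>

context average_contraction
begin

definition transfer :: "('a \<Rightarrow> real) \<Rightarrow> 'a \<Rightarrow> real" where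
  "transfer g x = (\<Sum>i<k. p i x * g (h i x))"

lemma transfer_bounded:
  assumes "\<And>x. \<bar>g x\<bar> \<le> B" shows "\<bar>transfer g x\<bar> \<le> B"
  unfolding transfer_def using assms by (rule weighted_sum_abs_le)

lemma transfer_cont:
  "continuous_on UNIV g \<Longrightarrow> continuous_on UNIV (transfer g)"
  unfolding transfer_def using p_cont h_cont continuous_on_compose2[of UNIV g]
  by (intro continuous_on_sum continuous_on_mult) auto

lemma weighted_sum_holder:
  assumes "\<And>i. i < k \<Longrightarrow> \<bar>b i\<bar> \<le> B" "0 \<le> B"
  shows "\<bar>(\<Sum>i<k. p i x * a i) - (\<Sum>i<k. p i y * b i)\<bar>
      \<le> (\<Sum>i<k. p i x * \<bar>a i - b i\<bar>) + real k * Cp * B * dist x y powr q"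
proof -
  have "(\<Sum>i<k. p i x * a i) - (\<Sum>i<k. p i y * b i)
      = (\<Sum>i<k. p i x * (a i - b i)) + (\<Sum>i<k. (p i x - p i y) * b i)"
    by (simp add: sum.distrib[symmetric] sum_subtractf[symmetric] algebra_simps)
  moreover have "\<bar>\<Sum>i<k. p i x * (a i - b i)\<bar> \<le> (\<Sum>i<k. p i x * \<bar>a i - b i\<bar>)"
    using p_pos by (intro order.trans[OF sum_abs] sum_mono) (auto simp: abs_mult less_imp_le)
  moreover have "\<bar>\<Sum>i<k. (p i x - p i y) * b i\<bar> \<le> (\<Sum>i<k. (Cp * dist x y powr q) * B)"
    using assms p_holder Cp
    by (intro order.trans[OF sum_abs] sum_mono) (auto simp: abs_mult intro!: mult_mono)
  ultimately show ?thesis by (simp add: algebra_simps)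
qed

text \<open>Moving the points contracts the Hoelder constant by \<rho>, and changing the weights
  from x to y costs only the sup norm: the inequality of Doeblin and Fortet.\<close>

lemma transfer_holder:
  assumes "\<And>x. \<bar>g x\<bar> \<le> B" "\<And>x y. \<bar>g x - g y\<bar> \<le> D * dist x y powr q" "0 \<le> D"
  shows "\<bar>transfer g x - transfer g y\<bar> \<le> (\<rho> * D + real k * Cp * B) * dist x y powr q"
proof -
  have "0 \<le> B" using assms(1)[of x] by linarith
  have "(\<Sum>i<k. p i x * \<bar>g (h i x) - g (h i y)\<bar>) \<le> (\<Sum>i<k. D * (p i x * dist (h i x) (h i y) powr q))"
  proof (intro sum_mono)
    fix i assume "i \<in> {..<k}"
    then have "p i x * \<bar>g (h i x) - g (h i y)\<bar> \<le> p i x * (D * dist (h i x) (h i y) powr q)"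
      using assms p_pos by (intro mult_left_mono) (auto simp: less_imp_le)
    then show "p i x * \<bar>g (h i x) - g (h i y)\<bar> \<le> D * (p i x * dist (h i x) (h i y) powr q)"
      by (simp add: ac_simps)
  qed
  also have "\<dots> \<le> D * (\<rho> * dist x y powr q)"
    unfolding sum_distrib_left[symmetric] using contraction assms by (intro mult_left_mono) auto
  finally show ?thesis
    using weighted_sum_holder[of "\<lambda>i. g (h i y)" B x "\<lambda>i. g (h i x)" y] assms(1) \<open>0 \<le> B\<close>
    by (simp add: transfer_def algebra_simps)
qed

lemma integral_transfer:
  assumes "continuous_on UNIV g" "\<And>x. \<bar>g x\<bar> \<le> B"
  shows "(\<integral>x. transfer g x \<partial>\<nu>) = (\<integral>x. g x \<partial>\<nu>)"
  unfolding transfer_def by (rule stationary[OF assms])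

end

section \<open>Sublinear growth of the sums \<open>T n\<close>\<close>

locale centered_observable = average_contraction k h p \<nu> \<delta> q \<rho> Cp
  for k and h :: "nat \<Rightarrow> 'a::euclidean_space \<Rightarrow> 'a" and p \<nu> \<delta> q \<rho> Cp +
  fixes f :: "nat \<Rightarrow> 'a \<Rightarrow> real" and B D :: real
  assumes B: "0 < B" and D: "0 \<le> D"
    and f_le: "\<And>i x. i < k \<Longrightarrow> \<bar>f i x\<bar> \<le> B"
    and f_holder: "\<And>i x y. i < k \<Longrightarrow> \<bar>f i x - f i y\<bar> \<le> D * dist x y powr q"
    and f_mean: "(\<integral>x. (\<Sum>i<k. p i x * f i x) \<partial>\<nu>) = 0"
begin

definition F where "F x = (\<Sum>i<k. p i x * f i x)"

definition T where "T n x = expect n (\<lambda>w. birkhoff h f w x) x"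

text \<open>The solution of K = \<rho> K + (D + k Cp B): with this constant the bound n K for the
  Hoelder constant of \<open>T n\<close> reproduces itself under the recursion
  \<open>T_Suc\<close>.\<close>

definition K where "K = (D + real k * Cp * B) / (1 - \<rho>)"

lemma K: "0 \<le> K"
  using B D Cp \<rho> by (simp add: K_def)

lemma f_cont: "i < k \<Longrightarrow> continuous_on UNIV (f i)"
  using f_holder q by (intro continuous_on_of_holder)

lemma F_cont: "continuous_on UNIV F"
  unfolding F_def using f_cont p_cont by (intro continuous_on_sum continuous_on_mult) auto

lemma F_le: "\<bar>F x\<bar> \<le> B"
  unfolding F_def using f_le by (rule weighted_sum_abs_le)

lemma F_holder: "\<bar>F x - F y\<bar> \<le> (D + real k * Cp * B) * dist x y powr q"
proof -
  have "(\<Sum>i<k. p i x * \<bar>f i x - f i y\<bar>) \<le> (\<Sum>i<k. p i x * (D * dist x y powr q))"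
    using f_holder p_pos by (intro sum_mono mult_left_mono) (auto simp: less_imp_le)
  also have "\<dots> = D * dist x y powr q" by (simp add: sum_distrib_right[symmetric] p_sum)
  finally show ?thesis
    using weighted_sum_holder[of "\<lambda>i. f i y" B x "\<lambda>i. f i x" y] f_le B
    by (simp add: F_def algebra_simps)
qed

lemma T_0 [simp]: "T 0 x = 0"
  by (simp add: T_def)

lemma T_Suc: "T (Suc n) x = F x + transfer (T n) x"
  unfolding T_def F_def transfer_def expect_Suc birkhoff.simps expect_add expect_const distrib_left sum.distrib ..

lemma T_cont: "continuous_on UNIV (T n)"
  unfolding T_def using h_cont f_cont by (intro expect_cont continuous_on_birkhoff)

lemma T_le: "\<bar>T n x\<bar> \<le> real n * B"
  unfolding T_def using f_le by (intro expect_abs_le birkhoff_abs_le)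

lemma T_holder: "\<bar>T n x - T n y\<bar> \<le> real n * K * dist x y powr q"
proof (induction n arbitrary: x y)
  case (Suc n)
  let ?d = "dist x y powr q"
  have K_eq: "D + real k * Cp * B = (1 - \<rho>) * K" using \<rho> by (simp add: K_def)
  have "\<bar>T (Suc n) x - T (Suc n) y\<bar> \<le> \<bar>F x - F y\<bar> + \<bar>transfer (T n) x - transfer (T n) y\<bar>"
    by (simp add: T_Suc)
  also have "\<dots> \<le> (D + real k * Cp * B) * ?d + (\<rho> * (real n * K) + real k * Cp * (real n * B)) * ?d"
    using Suc K by (intro add_mono F_holder transfer_holder T_le) auto
  also have "\<dots> = ((1 - \<rho>) * K + \<rho> * (real n * K) + real n * (real k * Cp * B)) * ?d"
    unfolding K_eq by (simp add: algebra_simps)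
  also have "\<dots> \<le> ((1 - \<rho>) * K + \<rho> * (real n * K) + real n * ((1 - \<rho>) * K)) * ?d"
    using D by (intro mult_right_mono add_left_mono mult_left_mono) (auto simp: K_eq[symmetric])
  \<comment> \<open>The coefficient on the left is (n + 1 - \<rho>) K.\<close>
  also have "\<dots> \<le> (real (Suc n) * K) * ?d"
    using \<rho> K by (intro mult_right_mono) (auto simp: algebra_simps)
  finally show ?case .
qed simp

text \<open>The difference is the n-th iterate of \<open>transfer\<close> on \<open>F\<close>, and
  \<open>transfer\<close> does not increase the sup norm.\<close>

lemma T_diff_le: "\<bar>T (Suc n) x - T n x\<bar> \<le> B"
proof (induction n arbitrary: x)
  case 0
  then show ?case using F_le by (simp add: T_Suc transfer_def)
next
  case (Suc n)
  have "T (Suc (Suc n)) x - T (Suc n) x = transfer (\<lambda>y. T (Suc n) y - T n y) x"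
    unfolding T_Suc[of "Suc n"] T_Suc[of n] by (simp add: transfer_def sum_subtractf algebra_simps)
  then show ?case by (simp only: transfer_bounded[OF Suc])
qed

lemma T_transfer_le: "\<bar>T n x - transfer (T n) x\<bar> \<le> 2 * B"
  using T_diff_le[of n x] F_le[of x] by (simp add: T_Suc abs_le_iff)

lemma integral_T: "(\<integral>x. T n x \<partial>\<nu>) = 0"
proof (induction n)
  case (Suc n)
  have "(\<integral>x. T (Suc n) x \<partial>\<nu>) = (\<integral>x. F x \<partial>\<nu>) + (\<integral>x. transfer (T n) x \<partial>\<nu>)"
    unfolding T_Suc using F_cont F_le transfer_cont[OF T_cont] transfer_bounded[OF T_le]
    by (intro Bochner_Integration.integral_add integrable_cont_bounded)
  then show ?case
    using Suc f_mean integral_transfer[OF T_cont T_le] by (simp add: F_def)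
qed simp

text \<open>By stationarity the squares cancel and twice the integral of T (T - transfer T) remains.
  Its second factor is bounded uniformly in n by \<open>T_transfer_le\<close>, so the result is
  linear in n although \<open>T n\<close> itself is only bounded by n B.\<close>

lemma step_square:
  "(\<integral>x. (\<Sum>i<k. p i x * (T n (h i x) - T n x)\<^sup>2) \<partial>\<nu>) \<le> 4 * B\<^sup>2 * real n"
proof -
  have sq_le: "(T n x)\<^sup>2 \<le> (real n * B)\<^sup>2" for x
    using T_le[of n x] by (metis abs_le_square_iff abs_of_nonneg abs_ge_zero order.trans)
  have c2: "continuous_on UNIV (\<lambda>x. (T n x)\<^sup>2)" using T_cont by (intro continuous_on_power)
  have b2: "\<bar>(T n x)\<^sup>2\<bar> \<le> (real n * B)\<^sup>2" for x using sq_le by simp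
  have bp: "\<bar>T n x * (T n x - transfer (T n) x)\<bar> \<le> real n * B * (2 * B)" for x
    using mult_mono[OF T_le[of n x] T_transfer_le[of n x]] B by (simp add: abs_mult)
  have cp: "continuous_on UNIV (\<lambda>x. T n x * (T n x - transfer (T n) x))"
    using T_cont transfer_cont by (intro continuous_intros) auto
  have "(\<Sum>i<k. p i x * (T n (h i x) - T n x)\<^sup>2)
      = transfer (\<lambda>y. (T n y)\<^sup>2) x - (T n x)\<^sup>2 + 2 * (T n x * (T n x - transfer (T n) x))" for x
  proof -
    have "p i x * (T n (h i x) - T n x)\<^sup>2
        = p i x * (T n (h i x))\<^sup>2 - 2 * T n x * (p i x * T n (h i x)) + p i x * (T n x)\<^sup>2" for i
      by (simp add: power2_diff algebra_simps)
    then have "(\<Sum>i<k. p i x * (T n (h i x) - T n x)\<^sup>2)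
        = (\<Sum>i<k. p i x * (T n (h i x))\<^sup>2) - 2 * T n x * (\<Sum>i<k. p i x * T n (h i x))
          + (\<Sum>i<k. p i x) * (T n x)\<^sup>2"
      by (simp only: sum.distrib sum_subtractf sum_distrib_left sum_distrib_right)
    then show ?thesis by (simp add: transfer_def p_sum power2_eq_square algebra_simps)
  qed
  then have "(\<integral>x. (\<Sum>i<k. p i x * (T n (h i x) - T n x)\<^sup>2) \<partial>\<nu>)
      = (\<integral>x. transfer (\<lambda>y. (T n y)\<^sup>2) x - (T n x)\<^sup>2 + 2 * (T n x * (T n x - transfer (T n) x)) \<partial>\<nu>)"
    by simp
  also have "\<dots> = (\<integral>x. transfer (\<lambda>y. (T n y)\<^sup>2) x \<partial>\<nu>) - (\<integral>x. (T n x)\<^sup>2 \<partial>\<nu>)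
      + 2 * (\<integral>x. T n x * (T n x - transfer (T n) x) \<partial>\<nu>)"
    using integrable_cont_bounded[OF transfer_cont[OF c2] transfer_bounded[OF b2]]
      integrable_cont_bounded[OF c2 b2] integrable_cont_bounded[OF cp bp] by simp
  also have "\<dots> = 2 * (\<integral>x. T n x * (T n x - transfer (T n) x) \<partial>\<nu>)"
    using integral_transfer[OF c2 b2] by simp
  also have "\<dots> \<le> 2 * (\<integral>x. real n * B * (2 * B) \<partial>\<nu>)"
    using integrable_cont_bounded[OF cp bp] bp
    by (intro mult_left_mono integral_mono) (auto simp: abs_le_iff)
  finally show ?thesis using prob_space by (simp add: power2_eq_square ac_simps)
qed

text \<open>The oscillation of \<open>T n\<close> along l steps of the walk; unrelated to the open
  set condition.\<close>

definition osc :: "nat \<Rightarrow> nat \<Rightarrow> 'a \<Rightarrow> real" where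
  "osc n l x = expect l (\<lambda>w. \<bar>T n (orbit h w x) - T n x\<bar>) x"

lemma osc_cont: "continuous_on UNIV (osc n l)"
  unfolding osc_def
  by (intro expect_cont continuous_on_rabs continuous_on_diff cont_comp_orbit T_cont)

lemma osc_le: "\<bar>osc n l x\<bar> \<le> 2 * (real n * B)"
  unfolding osc_def
proof (intro expect_abs_le)
  fix w show "\<bar>\<bar>T n (orbit h w x) - T n x\<bar>\<bar> \<le> 2 * (real n * B)"
    using T_le[of n x] T_le[of n "orbit h w x"] by linarith
qed

lemma integrable_osc: "integrable \<nu> (osc n l)"
  using osc_cont osc_le by (rule integrable_cont_bounded)

lemma integral_osc_1:
  assumes n: "n \<ge> 1" shows "(\<integral>x. osc n 1 x \<partial>\<nu>) \<le> 2 * B * sqrt n"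
proof -
  \<comment> \<open>The parameter of |u| <= u^2 / (2 s) + s / 2, which takes the place of the
    Cauchy-Schwarz inequality; s^2 = 4 B^2 n is the bound of \<open>step_square\<close> and balances
    the two terms.\<close>
  define s where "s = 2 * B * sqrt n"
  have s: "0 < s" using n B by (simp add: s_def)
  have amgm: "\<bar>u\<bar> \<le> u\<^sup>2 / (2 * s) + s / 2" for u :: real
    using sum_squares_bound[of "\<bar>u\<bar>" s] s by (simp add: field_simps power2_eq_square)
  let ?Q = "\<lambda>x. \<Sum>i<k. p i x * (T n (h i x) - T n x)\<^sup>2"
  have Qc: "continuous_on UNIV ?Q"
    using continuous_on_compose2[OF T_cont h_cont]
    by (intro continuous_on_sum continuous_on_mult continuous_on_power continuous_on_diff T_cont p_cont) auto
  have Qb: "\<bar>?Q x\<bar> \<le> (2 * (real n * B))\<^sup>2" for x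
  proof -
    have "\<bar>?Q x\<bar> = ?Q x" using p_pos by (intro abs_of_nonneg sum_nonneg mult_nonneg_nonneg) (auto simp: less_imp_le)
    also have "\<dots> \<le> (\<Sum>i<k. p i x * (2 * (real n * B))\<^sup>2)"
    proof (intro sum_mono mult_left_mono)
      fix i
      have "\<bar>T n (h i x) - T n x\<bar> \<le> \<bar>2 * (real n * B)\<bar>"
        using T_le[of n x] T_le[of n "h i x"] by linarith
      then show "(T n (h i x) - T n x)\<^sup>2 \<le> (2 * (real n * B))\<^sup>2" by (simp only: abs_le_square_iff)
    qed (use p_pos in \<open>auto simp: less_imp_le\<close>)
    finally show ?thesis by (simp add: sum_distrib_right[symmetric] p_sum)
  qed
  have iQ: "integrable \<nu> ?Q" by (rule integrable_cont_bounded[OF Qc Qb])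
  have "(\<integral>x. osc n 1 x \<partial>\<nu>) \<le> (\<integral>x. ?Q x / (2 * s) + s / 2 \<partial>\<nu>)"
  proof (rule integral_mono)
    fix x
    have "osc n 1 x = (\<Sum>i<k. p i x * \<bar>T n (h i x) - T n x\<bar>)"
      unfolding osc_def One_nat_def expect_Suc by simp
    also have "\<dots> \<le> (\<Sum>i<k. p i x * ((T n (h i x) - T n x)\<^sup>2 / (2 * s) + s / 2))"
      using p_pos by (intro sum_mono mult_left_mono amgm) (auto simp: less_imp_le)
    also have "\<dots> = ?Q x / (2 * s) + s / 2"
      using p_sum[of x]
      by (simp add: distrib_left sum.distrib sum_divide_distrib[symmetric] sum_distrib_right[symmetric])
    finally show "osc n 1 x \<le> ?Q x / (2 * s) + s / 2" .
  qed (use iQ integrable_osc in auto)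
  also have "\<dots> = (\<integral>x. ?Q x \<partial>\<nu>) / (2 * s) + s / 2"
    using iQ prob_space by simp
  also have "\<dots> \<le> 4 * B\<^sup>2 * real n / (2 * s) + s / 2"
    using step_square s by (intro add_right_mono divide_right_mono) auto
  also have "4 * B\<^sup>2 * real n = s\<^sup>2" by (simp add: s_def power_mult_distrib)
  also have "s\<^sup>2 / (2 * s) + s / 2 = s" using s by (simp add: power2_eq_square)
  finally show ?thesis by (simp add: s_def)
qed

lemma integral_osc:
  assumes n: "n \<ge> 1" shows "(\<integral>x. osc n l x \<partial>\<nu>) \<le> real l * (2 * B * sqrt n)"
proof (induction l)
  case (Suc l)
  have "osc n (Suc l) x \<le> transfer (osc n l) x + osc n 1 x" for x
  proof -
    have "osc n (Suc l) x \<le> (\<Sum>i<k. p i x * (osc n l (h i x) + \<bar>T n (h i x) - T n x\<bar>))"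
      unfolding osc_def expect_Suc
    proof (intro sum_mono mult_left_mono)
      fix i
      have "expect l (\<lambda>w. \<bar>T n (orbit h (i # w) x) - T n x\<bar>) (h i x)
          \<le> expect l (\<lambda>w. \<bar>T n (orbit h w (h i x)) - T n (h i x)\<bar> + \<bar>T n (h i x) - T n x\<bar>) (h i x)"
        by (intro expect_mono) auto
      then show "expect l (\<lambda>w. \<bar>T n (orbit h (i # w) x) - T n x\<bar>) (h i x)
          \<le> expect l (\<lambda>w. \<bar>T n (orbit h w (h i x)) - T n (h i x)\<bar>) (h i x) + \<bar>T n (h i x) - T n x\<bar>"
        by (simp add: expect_add)
    qed (use p_pos in \<open>auto simp: less_imp_le\<close>)
    also have "\<dots> = transfer (osc n l) x + osc n 1 x"
      by (simp add: transfer_def osc_def[of n "Suc 0"] expect_Suc distrib_left sum.distrib)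
    finally show ?thesis .
  qed
  then have "(\<integral>x. osc n (Suc l) x \<partial>\<nu>) \<le> (\<integral>x. transfer (osc n l) x + osc n 1 x \<partial>\<nu>)"
    using integrable_osc integrable_cont_bounded[OF transfer_cont[OF osc_cont] transfer_bounded[OF osc_le]]
    by (intro integral_mono) auto
  also have "\<dots> = (\<integral>x. osc n l x \<partial>\<nu>) + (\<integral>x. osc n 1 x \<partial>\<nu>)"
    using integrable_osc integrable_cont_bounded[OF transfer_cont[OF osc_cont] transfer_bounded[OF osc_le]]
      integral_transfer[OF osc_cont osc_le] by simp
  finally show ?case using Suc integral_osc_1[OF n] by (simp add: algebra_simps)
next
  case 0
  have "osc n 0 = (\<lambda>_. 0)" by (intro ext) (simp add: osc_def)
  then show ?case by simp
qed

text \<open>The path goes from x along a word, across to the image of y under the same word, and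
  back to y. The way back is averaged with the weights at x; passing to those at y costs at most 1 /
  \<delta>^l, since weights of l letters lie between \<delta>^l and 1.\<close>

lemma T_dist_le:
  "\<bar>T n x - T n y\<bar> \<le> osc n l x + real n * K * \<rho> ^ l * dist x y powr q + osc n l y / \<delta> ^ l"
proof -
  have "\<bar>T n x - T n y\<bar> = expect l (\<lambda>_. \<bar>T n x - T n y\<bar>) x" by simp
  also have "\<dots> \<le> expect l (\<lambda>w. \<bar>T n (orbit h w x) - T n x\<bar>
      + (real n * K * dist (orbit h w x) (orbit h w y) powr q + \<bar>T n (orbit h w y) - T n y\<bar>)) x"
  proof (intro expect_mono)
    fix w
    show "\<bar>T n x - T n y\<bar> \<le> \<bar>T n (orbit h w x) - T n x\<bar>
      + (real n * K * dist (orbit h w x) (orbit h w y) powr q + \<bar>T n (orbit h w y) - T n y\<bar>)"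
      using T_holder[of n "orbit h w x" "orbit h w y"] by linarith
  qed
  also have "\<dots> = osc n l x + real n * K * expect l (\<lambda>w. dist (orbit h w x) (orbit h w y) powr q) x
      + expect l (\<lambda>w. \<bar>T n (orbit h w y) - T n y\<bar>) x"
    unfolding expect_add expect_cmult osc_def by simp
  also have "expect l (\<lambda>w. \<bar>T n (orbit h w y) - T n y\<bar>) x \<le> osc n l y / \<delta> ^ l"
  proof -
    have "weight h p w x * \<bar>T n (orbit h w y) - T n y\<bar>
        \<le> weight h p w y * \<bar>T n (orbit h w y) - T n y\<bar> / \<delta> ^ l" if w: "w \<in> words k l" for w
    proof -
      have "weight h p w x * \<delta> ^ l \<le> weight h p w y"
        using weight_bounds[OF w, of x] weight_bounds[OF w, of y] \<delta>
          mult_right_mono[of "weight h p w x" 1 "\<delta> ^ l"] zero_le_power[of \<delta> l] by linarith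
      then have "weight h p w x * \<bar>T n (orbit h w y) - T n y\<bar> * \<delta> ^ l
          \<le> weight h p w y * \<bar>T n (orbit h w y) - T n y\<bar>"
        using mult_right_mono[of "weight h p w x * \<delta> ^ l" "weight h p w y" "\<bar>T n (orbit h w y) - T n y\<bar>"]
        by (simp add: ac_simps)
      then show ?thesis using \<delta> by (simp add: pos_le_divide_eq)
    qed
    then show ?thesis by (auto simp: expect_def osc_def sum_divide_distrib intro!: sum_mono)
  qed
  also have "real n * K * expect l (\<lambda>w. dist (orbit h w x) (orbit h w y) powr q) x
      \<le> real n * K * (\<rho> ^ l * dist x y powr q)"
    using contraction_words K by (intro mult_left_mono) auto
  finally show ?thesis by (simp add: ac_simps)
qed

definition m where "m = (\<integral>x. norm x powr q \<partial>\<nu>)"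

lemma m: "0 \<le> m" unfolding m_def by (intro integral_nonneg_AE) auto

text \<open>As \<open>T n\<close> has mean zero, its value at x is the average of T n x - T n y over
  y. Integrating the comparison of x and y in both variables leaves the integrals of
  \<open>osc\<close> and the moment \<open>m\<close>.\<close>

lemma integral_abs_T:
  assumes n: "n \<ge> 1"
  shows "(\<integral>x. \<bar>T n x\<bar> \<partial>\<nu>) \<le> (1 + 1 / \<delta> ^ l) * (real l * (2 * B * sqrt n)) + 2 * real n * K * \<rho> ^ l * m"
proof -
  let ?c = "real n * K * \<rho> ^ l" and ?e = "real l * (2 * B * sqrt n)"
  have c: "0 \<le> ?c" using K \<rho> by simp
  have iT: "integrable \<nu> (T n)" using T_cont T_le by (rule integrable_cont_bounded)
  have pw: "\<bar>T n x\<bar> \<le> osc n l x + ?c * norm x powr q + (?c * m + ?e / \<delta> ^ l)" for x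
  proof -
    have "T n x = (\<integral>y. T n x - T n y \<partial>\<nu>)" using iT integral_T prob_space by simp
    then have "\<bar>T n x\<bar> \<le> (\<integral>y. \<bar>T n x - T n y\<bar> \<partial>\<nu>)" using integral_abs_bound by metis
    also have "\<dots> \<le> (\<integral>y. (osc n l x + ?c * norm x powr q) + ?c * norm y powr q + osc n l y / \<delta> ^ l \<partial>\<nu>)"
    proof (rule integral_mono)
      fix y
      have "dist x y powr q \<le> (norm x + norm y) powr q"
        using q norm_triangle_ineq4[of x y] by (intro powr_mono2) (auto simp: dist_norm)
      also have "\<dots> \<le> norm x powr q + norm y powr q" using q by (intro powr_add_le) auto
      finally have "?c * dist x y powr q \<le> ?c * (norm x powr q + norm y powr q)"
        using c by (intro mult_left_mono)
      then show "\<bar>T n x - T n y\<bar> \<le> (osc n l x + ?c * norm x powr q) + ?c * norm y powr q + osc n l y / \<delta> ^ l"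
        using T_dist_le[of n x y l] by (simp add: distrib_left)
    qed (use iT integrable_osc integrable_norm_powr in auto)
    also have "\<dots> = (osc n l x + ?c * norm x powr q) + ?c * m + (\<integral>y. osc n l y \<partial>\<nu>) / \<delta> ^ l"
      using integrable_osc integrable_norm_powr prob_space by (simp add: m_def)
    also have "\<dots> \<le> (osc n l x + ?c * norm x powr q) + ?c * m + ?e / \<delta> ^ l"
      using integral_osc[OF n] \<delta> by (intro add_left_mono divide_right_mono) auto
    finally show ?thesis by simp
  qed
  have "(\<integral>x. \<bar>T n x\<bar> \<partial>\<nu>) \<le> (\<integral>x. osc n l x + ?c * norm x powr q + (?c * m + ?e / \<delta> ^ l) \<partial>\<nu>)"
    using pw iT integrable_osc integrable_norm_powr by (intro integral_mono) auto
  also have "\<dots> = (\<integral>x. osc n l x \<partial>\<nu>) + ?c * m + (?c * m + ?e / \<delta> ^ l)"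
    using integrable_osc integrable_norm_powr prob_space by (simp add: m_def)
  also have "\<dots> \<le> ?e + ?c * m + (?c * m + ?e / \<delta> ^ l)"
    using integral_osc[OF n] by simp
  finally show ?thesis by (simp add: algebra_simps)
qed

end

context centered_observable
begin

lemma integral_abs_T_rate:
  "\<exists>C \<gamma>. 0 < \<gamma> \<and> \<gamma> \<le> 1 \<and> 0 \<le> C \<and> (\<forall>n\<ge>1. (\<integral>x. \<bar>T n x\<bar> \<partial>\<nu>) \<le> C * real n powr (1 - \<gamma>))"
proof -
  define \<Delta> where "\<Delta> = - ln \<delta>"
  have \<Delta>: "0 < \<Delta>" using \<delta> by (simp add: \<Delta>_def ln_less_zero)
  define \<gamma>1 where "\<gamma>1 = - ln \<rho> / (4 * \<Delta>)"
  have \<gamma>1: "0 < \<gamma>1" using \<rho> \<Delta> by (simp add: \<gamma>1_def ln_less_zero divide_neg_pos)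
  \<comment> \<open>\<open>\<gamma>1\<close> is the rate of decay of \<rho>^l for the l chosen
    below; 1/8 is what 1/2 from the oscillation, 1/4 from the weights and 1/8 for the logarithm
    leave of 1.\<close>
  define \<gamma> where "\<gamma> = min (1/8) \<gamma>1"
  define C where "C = 8 * B / \<Delta> + 2 * K * m / \<rho>"
  have C: "0 \<le> 8 * B / \<Delta>" "0 \<le> 2 * K * m / \<rho>" using B \<Delta> K m \<rho> by auto
  have "(\<integral>x. \<bar>T n x\<bar> \<partial>\<nu>) \<le> C * real n powr (1 - \<gamma>)" if n: "n \<ge> 1" for n
  proof -
    define N where "N = real n"
    have N: "1 \<le> N" using n by (simp add: N_def)
    \<comment> \<open>This length keeps the ratio of weights \<delta>^(-l) below n^(1/4), while
      \<rho>^l is already a negative power of n.\<close>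
    define l where "l = nat \<lfloor>ln N / (4 * \<Delta>)\<rfloor>"
    have pos: "0 \<le> ln N / (4 * \<Delta>)" using N \<Delta> by simp
    have l_le: "real l \<le> ln N / (4 * \<Delta>)"
      using pos by (simp add: l_def)
    have l_ge: "ln N / (4 * \<Delta>) - 1 \<le> real l"
      unfolding l_def by linarith
    have "\<delta> = exp (- \<Delta>)" using \<delta> by (simp add: \<Delta>_def)
    then have "1 / \<delta> ^ l = exp (real l * \<Delta>)"
      by (simp add: exp_of_nat_mult exp_minus power_inverse divide_inverse)
    also have "\<dots> \<le> exp (ln N / 4)"
      using mult_right_mono[OF l_le, of \<Delta>] \<Delta> by (simp add: field_simps)
    also have "\<dots> = N powr (1/4)" using N by (simp add: powr_def)
    finally have d: "1 + 1 / \<delta> ^ l \<le> 2 * N powr (1/4)"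
      using ge_one_powr_ge_zero[of N "1/4"] N by simp
    have "ln N \<le> N powr (1/8) / (1/8)" using N by (intro ln_powr_bound) auto
    then have "ln N / (4 * \<Delta>) \<le> (N powr (1/8) / (1/8)) / (4 * \<Delta>)"
      using \<Delta> by (intro divide_right_mono) auto
    then have l: "real l \<le> 2 / \<Delta> * N powr (1/8)" using l_le by simp
    have "\<rho> ^ l = exp (real l * ln \<rho>)"
      using \<rho> by (metis exp_ln exp_of_nat_mult)
    also have "\<dots> \<le> exp ((ln N / (4 * \<Delta>) - 1) * ln \<rho>)"
      using mult_right_mono_neg[OF l_ge, of "ln \<rho>"] \<rho> by simp
    also have "(ln N / (4 * \<Delta>) - 1) * ln \<rho> = - ln \<rho> + (- \<gamma>1 * ln N)"
      using \<Delta> by (simp add: \<gamma>1_def field_simps)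
    also have "exp (- ln \<rho> + (- \<gamma>1 * ln N)) = 1 / \<rho> * N powr (- \<gamma>1)"
      using N \<rho> unfolding exp_add by (simp add: powr_def exp_minus field_simps)
    finally have r: "\<rho> ^ l \<le> 1 / \<rho> * N powr (- \<gamma>1)" .
    have "(1 + 1 / \<delta> ^ l) * (real l * (2 * B * sqrt n))
        \<le> (2 * N powr (1/4)) * ((2 / \<Delta> * N powr (1/8)) * (2 * B * sqrt n))"
      using d l B \<delta> by (intro mult_mono) auto
    also have "\<dots> = 8 * B / \<Delta> * (N powr (1/4) * (N powr (1/8) * N powr (1/2)))"
      using N by (simp add: powr_half_sqrt N_def)
    also have "\<dots> = 8 * B / \<Delta> * N powr (7/8)"
      by (simp add: powr_add[symmetric])
    also have "\<dots> \<le> 8 * B / \<Delta> * N powr (1 - \<gamma>)"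
      using N C by (intro mult_left_mono powr_mono) (auto simp: \<gamma>_def)
    finally have 1: "(1 + 1 / \<delta> ^ l) * (real l * (2 * B * sqrt n)) \<le> 8 * B / \<Delta> * N powr (1 - \<gamma>)" .
    have "2 * real n * K * \<rho> ^ l * m = (2 * N * K * m) * \<rho> ^ l" by (simp add: N_def)
    also have "\<dots> \<le> (2 * N * K * m) * (1 / \<rho> * N powr (- \<gamma>1))"
      using r N K m by (intro mult_left_mono) auto
    also have "\<dots> = 2 * K * m / \<rho> * (N powr 1 * N powr (- \<gamma>1))" using N by simp
    also have "\<dots> = 2 * K * m / \<rho> * N powr (1 - \<gamma>1)" by (simp only: powr_add[symmetric]) simp
    also have "\<dots> \<le> 2 * K * m / \<rho> * N powr (1 - \<gamma>)"
      using N C by (intro mult_left_mono powr_mono) (auto simp: \<gamma>_def)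
    finally show ?thesis
      using integral_abs_T[OF n, of l] 1 by (simp add: C_def N_def distrib_right)
  qed
  then show ?thesis
    using C \<gamma>1 by (intro exI[of _ C] exI[of _ \<gamma>]) (auto simp: C_def \<gamma>_def)
qed

section \<open>Variances of Birkhoff sums\<close>

definition S2 where "S2 n x = expect n (\<lambda>w. (birkhoff h f w x)\<^sup>2) x"

lemma S2_0 [simp]: "S2 0 = (\<lambda>_. 0)"
  by (intro ext) (simp add: S2_def)

lemma S2_cont: "continuous_on UNIV (S2 n)"
  unfolding S2_def using h_cont f_cont
  by (intro expect_cont continuous_on_power continuous_on_birkhoff)

lemma S2_le: "\<bar>S2 n x\<bar> \<le> (real n * B)\<^sup>2"
  unfolding S2_def
proof (rule expect_abs_le)
  fix w assume "w \<in> words k n"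
  then have "\<bar>birkhoff h f w x\<bar> \<le> \<bar>real n * B\<bar>"
    using birkhoff_abs_le[of k f B w n h x] f_le B by auto
  then show "\<bar>(birkhoff h f w x)\<^sup>2\<bar> \<le> (real n * B)\<^sup>2"
    by (simp only: abs_le_square_iff abs_power2)
qed

text \<open>Condition on the first letter: the cross term pairs f with the conditional expectation
  of the remaining sum, which is \<open>T n\<close>. So sublinear growth of \<open>T n\<close> in
  the mean is all that is needed for a variance below n^2.\<close>

lemma S2_Suc_le: "S2 (Suc n) x \<le> B\<^sup>2 + 2 * B * transfer (\<lambda>y. \<bar>T n y\<bar>) x + transfer (S2 n) x"
proof -
  have "S2 (Suc n) x
      = (\<Sum>i<k. p i x * ((f i x)\<^sup>2 + (2 * f i x * T n (h i x) + S2 n (h i x))))"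
  proof -
    have "expect n (\<lambda>w. (birkhoff h f (i # w) x)\<^sup>2) (h i x)
        = (f i x)\<^sup>2 + (2 * f i x * T n (h i x) + S2 n (h i x))" for i
    proof -
      have "expect n (\<lambda>w. (birkhoff h f (i # w) x)\<^sup>2) (h i x)
          = expect n (\<lambda>w. (f i x)\<^sup>2 + (2 * f i x * birkhoff h f w (h i x) + (birkhoff h f w (h i x))\<^sup>2)) (h i x)"
        by (simp add: power2_sum add_ac)
      then show ?thesis
        unfolding expect_add expect_cmult by (simp add: S2_def T_def)
    qed
    then show ?thesis by (simp add: S2_def expect_Suc)
  qed
  also have "\<dots> \<le> (\<Sum>i<k. p i x * (B\<^sup>2 + (2 * B * \<bar>T n (h i x)\<bar> + S2 n (h i x))))"
  proof (intro sum_mono mult_left_mono add_mono order_refl)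
    fix i assume i: "i \<in> {..<k}"
    have "\<bar>f i x\<bar> \<le> \<bar>B\<bar>" using f_le[of i x] i B by simp
    then show "(f i x)\<^sup>2 \<le> B\<^sup>2" by (simp only: abs_le_square_iff)
    have "f i x * T n (h i x) \<le> B * \<bar>T n (h i x)\<bar>"
    proof -
      have "f i x * T n (h i x) \<le> \<bar>f i x\<bar> * \<bar>T n (h i x)\<bar>" by (simp add: abs_mult[symmetric])
      also have "\<dots> \<le> B * \<bar>T n (h i x)\<bar>" using f_le i by (intro mult_right_mono) auto
      finally show ?thesis .
    qed
    then show "2 * f i x * T n (h i x) \<le> 2 * B * \<bar>T n (h i x)\<bar>" by simp
  qed (use p_pos in \<open>auto simp: less_imp_le\<close>)
  also have "\<dots> = B\<^sup>2 + 2 * B * transfer (\<lambda>y. \<bar>T n y\<bar>) x + transfer (S2 n) x"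
  proof -
    have "p i x * (B\<^sup>2 + (2 * B * \<bar>T n (h i x)\<bar> + S2 n (h i x)))
        = p i x * B\<^sup>2 + (2 * B * (p i x * \<bar>T n (h i x)\<bar>) + p i x * S2 n (h i x))" for i
      by (simp add: algebra_simps)
    then show ?thesis
      unfolding transfer_def
      by (simp only: sum.distrib sum_distrib_left[symmetric] sum_distrib_right[symmetric] p_sum mult_1 add.assoc)
  qed
  finally show ?thesis .
qed

lemma integral_S2_Suc_le:
  "(\<integral>x. S2 (Suc n) x \<partial>\<nu>) \<le> B\<^sup>2 + 2 * B * (\<integral>x. \<bar>T n x\<bar> \<partial>\<nu>) + (\<integral>x. S2 n x \<partial>\<nu>)"
proof -
  have cT: "continuous_on UNIV (\<lambda>x. \<bar>T n x\<bar>)" using T_cont by (intro continuous_intros)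
  have bT: "\<bar>\<bar>T n x\<bar>\<bar> \<le> real n * B" for x using T_le by simp
  note int = integrable_cont_bounded[OF transfer_cont[OF cT] transfer_bounded[OF bT]]
    integrable_cont_bounded[OF transfer_cont[OF S2_cont] transfer_bounded[OF S2_le]]
  have "(\<integral>x. S2 (Suc n) x \<partial>\<nu>)
      \<le> (\<integral>x. B\<^sup>2 + 2 * B * transfer (\<lambda>y. \<bar>T n y\<bar>) x + transfer (S2 n) x \<partial>\<nu>)"
    using int integrable_cont_bounded[OF S2_cont S2_le] S2_Suc_le by (intro integral_mono) auto
  also have "\<dots> = B\<^sup>2 + 2 * B * (\<integral>x. transfer (\<lambda>y. \<bar>T n y\<bar>) x \<partial>\<nu>) + (\<integral>x. transfer (S2 n) x \<partial>\<nu>)"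
    using int prob_space by simp
  finally show ?thesis
    by (simp add: integral_transfer[OF cT bT] integral_transfer[OF S2_cont S2_le])
qed

lemma variance_bound:
  "\<exists>C \<gamma>. 0 < \<gamma> \<and> \<gamma> \<le> 1 \<and> 0 \<le> C \<and> (\<forall>n\<ge>1. (\<integral>x. S2 n x \<partial>\<nu>) \<le> C * real n powr (2 - \<gamma>))"
proof -
  obtain C \<gamma> where C: "0 < \<gamma>" "\<gamma> \<le> 1" "0 \<le> C"
    and rate: "\<And>n. n \<ge> 1 \<Longrightarrow> (\<integral>x. \<bar>T n x\<bar> \<partial>\<nu>) \<le> C * real n powr (1 - \<gamma>)"
    using integral_abs_T_rate by blast
  have "(\<integral>x. S2 n x \<partial>\<nu>) \<le> (B\<^sup>2 + 2 * B * C) * real n powr (2 - \<gamma>)" if n: "n \<ge> 1" for n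
  proof -
    have T: "(\<integral>x. \<bar>T j x\<bar> \<partial>\<nu>) \<le> C * real n powr (1 - \<gamma>)" if "j \<le> n" for j
    proof (cases "j = 0")
      case False
      then have "(\<integral>x. \<bar>T j x\<bar> \<partial>\<nu>) \<le> C * real j powr (1 - \<gamma>)" by (intro rate) auto
      also have "\<dots> \<le> C * real n powr (1 - \<gamma>)"
        using C that by (intro mult_left_mono powr_mono2) auto
      finally show ?thesis .
    qed (use C in simp)
    have V: "(\<integral>x. S2 j x \<partial>\<nu>) \<le> real j * (B\<^sup>2 + 2 * B * (C * real n powr (1 - \<gamma>)))" if "j \<le> n" for j
      using that
    proof (induction j)
      case (Suc j)
      have "2 * B * (\<integral>x. \<bar>T j x\<bar> \<partial>\<nu>) \<le> 2 * B * (C * real n powr (1 - \<gamma>))"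
        using T[of j] Suc B by (intro mult_left_mono) auto
      then show ?case using Suc integral_S2_Suc_le[of j] by (simp add: algebra_simps)
    qed simp
    have "1 \<le> real n powr (1 - \<gamma>)" using n C by (intro ge_one_powr_ge_zero) auto
    then have "B\<^sup>2 + 2 * B * (C * real n powr (1 - \<gamma>)) \<le> (B\<^sup>2 + 2 * B * C) * real n powr (1 - \<gamma>)"
      using mult_left_mono[of 1 "real n powr (1 - \<gamma>)" "B\<^sup>2"] by (simp add: algebra_simps)
    then have "real n * (B\<^sup>2 + 2 * B * (C * real n powr (1 - \<gamma>)))
        \<le> real n * ((B\<^sup>2 + 2 * B * C) * real n powr (1 - \<gamma>))"
      by (intro mult_left_mono) auto
    also have "\<dots> = (B\<^sup>2 + 2 * B * C) * (real n powr 1 * real n powr (1 - \<gamma>))" using n by simp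
    also have "\<dots> = (B\<^sup>2 + 2 * B * C) * real n powr (2 - \<gamma>)"
      by (simp only: powr_add[symmetric]) simp
    finally show ?thesis using V[of n] by simp
  qed
  then show ?thesis using C B by (intro exI[of _ "B\<^sup>2 + 2 * B * C"] exI[of _ \<gamma>]) auto
qed

end

section \<open>Laws of finite words and deviation estimates\<close>

context average_contraction
begin

text \<open>The law of a random pair: a point drawn from \<nu> and n letters drawn with the weights
  at this point. An event is encoded by its set of points for each word, so finite sums replace a
  measure on sequences.\<close>

definition path_prob :: "nat \<Rightarrow> (nat list \<Rightarrow> 'a set) \<Rightarrow> ennreal" where
  "path_prob n A = (\<integral>\<^sup>+x. (\<Sum>w\<in>words k n. ennreal (weight h p w x) * indicator (A w) x) \<partial>\<nu>)"

lemma path_prob_mono: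
  "(\<And>w. w \<in> words k n \<Longrightarrow> A w \<subseteq> A' w) \<Longrightarrow> path_prob n A \<le> path_prob n A'"
  unfolding path_prob_def
  by (intro nn_integral_mono sum_mono mult_left_mono) (auto simp: indicator_def)

lemma path_prob_mono_AE:
  assumes "AE x in \<nu>. \<forall>w\<in>words k n. x \<in> A w \<longrightarrow> x \<in> A' w"
  shows "path_prob n A \<le> path_prob n A'"
  unfolding path_prob_def
proof (rule nn_integral_mono_AE)
  show "AE x in \<nu>. (\<Sum>w\<in>words k n. ennreal (weight h p w x) * indicator (A w) x)
      \<le> (\<Sum>w\<in>words k n. ennreal (weight h p w x) * indicator (A' w) x)"
    using assms
    by eventually_elim (intro sum_mono mult_left_mono, auto simp: indicator_def)
qed

lemma measurable_weight_indicator: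
  assumes [measurable]: "w \<in> words k n" "A \<in> sets borel"
  shows "(\<lambda>x. ennreal (weight h p w x) * indicator A x) \<in> borel_measurable borel"
  by measurable

lemma path_prob_UN_le:
  assumes J: "finite J" and A: "\<And>j w. j \<in> J \<Longrightarrow> w \<in> words k n \<Longrightarrow> A j w \<in> sets borel"
  shows "path_prob n (\<lambda>w. \<Union>j\<in>J. A j w) \<le> (\<Sum>j\<in>J. path_prob n (A j))"
proof -
  have "path_prob n (\<lambda>w. \<Union>j\<in>J. A j w)
      \<le> (\<integral>\<^sup>+x. (\<Sum>j\<in>J. \<Sum>w\<in>words k n. ennreal (weight h p w x) * indicator (A j w) x) \<partial>\<nu>)"
    unfolding path_prob_def
  proof (rule nn_integral_mono)
    fix x
    have "indicator (\<Union>j\<in>J. A j w) x \<le> (\<Sum>j\<in>J. indicator (A j w) x :: ennreal)" for w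
    proof (cases "x \<in> (\<Union>j\<in>J. A j w)")
      case True
      then obtain j where j: "j \<in> J" "x \<in> A j w" by auto
      have "indicator (A j w) x \<le> (\<Sum>j\<in>J. indicator (A j w) x :: ennreal)"
        using J j(1) by (intro member_le_sum) auto
      then show ?thesis using True j by simp
    qed simp
    then have "(\<Sum>w\<in>words k n. ennreal (weight h p w x) * indicator (\<Union>j\<in>J. A j w) x)
        \<le> (\<Sum>w\<in>words k n. ennreal (weight h p w x) * (\<Sum>j\<in>J. indicator (A j w) x))"
      by (intro sum_mono mult_left_mono) auto
    also have "\<dots> = (\<Sum>j\<in>J. \<Sum>w\<in>words k n. ennreal (weight h p w x) * indicator (A j w) x)"
      unfolding sum_distrib_left by (rule sum.swap)
    finally show "(\<Sum>w\<in>words k n. ennreal (weight h p w x) * indicator (\<Union>j\<in>J. A j w) x)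
        \<le> (\<Sum>j\<in>J. \<Sum>w\<in>words k n. ennreal (weight h p w x) * indicator (A j w) x)" .
  qed
  also have "\<dots> = (\<Sum>j\<in>J. path_prob n (A j))"
    unfolding path_prob_def
  proof (rule nn_integral_sum)
    fix j assume "j \<in> J"
    then have "(\<lambda>x. \<Sum>w\<in>words k n. ennreal (weight h p w x) * indicator (A j w) x) \<in> borel_measurable borel"
      using A by (intro borel_measurable_sum measurable_weight_indicator) auto
    then show "(\<lambda>x. \<Sum>w\<in>words k n. ennreal (weight h p w x) * indicator (A j w) x) \<in> borel_measurable \<nu>"
      by (simp cong: measurable_cong_sets)
  qed
  finally show ?thesis .
qed

lemma path_prob_Un_le:
  assumes "\<And>w. w \<in> words k n \<Longrightarrow> A w \<in> sets borel" "\<And>w. w \<in> words k n \<Longrightarrow> A' w \<in> sets borel"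
  shows "path_prob n (\<lambda>w. A w \<union> A' w) \<le> path_prob n A + path_prob n A'"
proof -
  have "path_prob n (\<lambda>w. \<Union>b\<in>{True, False}. if b then A w else A' w)
      \<le> (\<Sum>b\<in>{True, False}. path_prob n (\<lambda>w. if b then A w else A' w))"
    using assms by (intro path_prob_UN_le) auto
  then show ?thesis by (simp add: Un_commute)
qed

lemma stationary_nn_words:
  assumes [measurable]: "g \<in> borel_measurable borel"
  shows "(\<integral>\<^sup>+x. (\<Sum>w\<in>words k n. ennreal (weight h p w x) * g (orbit h w x)) \<partial>\<nu>) = (\<integral>\<^sup>+x. g x \<partial>\<nu>)"
proof (induction n)
  case (Suc n)
  let ?G = "\<lambda>x. \<Sum>w\<in>words k n. ennreal (weight h p w x) * g (orbit h w x)"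
  have "(\<Sum>w\<in>words k (Suc n). ennreal (weight h p w x) * g (orbit h w x))
      = (\<Sum>i<k. ennreal (p i x) * ?G (h i x))" for x
    unfolding sum_words_Suc sum_distrib_left
    using p_pos weight_nonneg by (auto intro!: sum.cong simp: ennreal_mult less_imp_le mult.assoc)
  then have "(\<integral>\<^sup>+x. (\<Sum>w\<in>words k (Suc n). ennreal (weight h p w x) * g (orbit h w x)) \<partial>\<nu>)
      = (\<integral>\<^sup>+x. (\<Sum>i<k. ennreal (p i x) * ?G (h i x)) \<partial>\<nu>)" by simp
  also have "\<dots> = (\<integral>\<^sup>+x. ?G x \<partial>\<nu>)"
    by (intro stationary_nn[symmetric] borel_measurable_sum) measurable
  finally show ?case using Suc by simp
qed simp

lemma path_prob_orbit:
  "Z \<in> sets borel \<Longrightarrow> path_prob n (\<lambda>w. orbit h w -` Z) = emeasure \<nu> Z"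
proof -
  assume Z: "Z \<in> sets borel"
  have "path_prob n (\<lambda>w. orbit h w -` Z)
      = (\<integral>\<^sup>+x. (\<Sum>w\<in>words k n. ennreal (weight h p w x) * indicator Z (orbit h w x)) \<partial>\<nu>)"
    unfolding path_prob_def indicator_vimage ..
  also have "\<dots> = (\<integral>\<^sup>+x. indicator Z x \<partial>\<nu>)"
    using Z by (intro stationary_nn_words) simp
  finally show ?thesis using Z by simp
qed

text \<open>The point reached after m steps has the law \<nu> again, and the remaining letters are
  drawn with the weights at this point.\<close>

lemma path_prob_suffix:
  assumes A: "\<And>v. v \<in> words k n \<Longrightarrow> A v \<in> sets borel"
  shows "path_prob (m + n) (\<lambda>w. orbit h (take m w) -` A (drop m w)) = path_prob n A"
proof -
  let ?g = "\<lambda>x. \<Sum>v\<in>words k n. ennreal (weight h p v x) * indicator (A v) x"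
  have "(\<Sum>w\<in>words k (m + n). ennreal (weight h p w x) * indicator (orbit h (take m w) -` A (drop m w)) x)
      = (\<Sum>u\<in>words k m. ennreal (weight h p u x) * ?g (orbit h u x))" for x
    unfolding sum_words_add sum_distrib_left
    using weight_nonneg
    by (auto intro!: sum.cong simp: weight_append length_words ennreal_mult mult.assoc indicator_def)
  then have "path_prob (m + n) (\<lambda>w. orbit h (take m w) -` A (drop m w))
      = (\<integral>\<^sup>+x. (\<Sum>u\<in>words k m. ennreal (weight h p u x) * ?g (orbit h u x)) \<partial>\<nu>)"
    by (simp add: path_prob_def)
  also have "\<dots> = (\<integral>\<^sup>+x. ?g x \<partial>\<nu>)"
    using A by (intro stationary_nn_words borel_measurable_sum measurable_weight_indicator) auto
  finally show ?thesis by (simp add: path_prob_def)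
qed

lemma sum_weight_ennreal: "(\<Sum>v\<in>words k n. ennreal (weight h p v x)) = 1"
  using weight_nonneg sum_weight[where n = n and x = x] by (subst sum_ennreal) auto

text \<open>Forgetting the last n letters is harmless because their weights sum to 1 wherever the
  prefix leads.\<close>

lemma path_prob_prefix: "path_prob (m + n) (\<lambda>w. A (take m w)) = path_prob m A"
proof -
  have "(\<Sum>w\<in>words k (m + n). ennreal (weight h p w x) * indicator (A (take m w)) x)
      = (\<Sum>u\<in>words k m. ennreal (weight h p u x) * indicator (A u) x)" for x
  proof -
    have "(\<Sum>v\<in>words k n. ennreal (weight h p (u @ v) x) * indicator (A (take m (u @ v))) x)
        = ennreal (weight h p u x) * indicator (A u) x" if u: "u \<in> words k m" for u
    proof -
      have "(\<Sum>v\<in>words k n. ennreal (weight h p (u @ v) x) * indicator (A (take m (u @ v))) x)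
        = (\<Sum>v\<in>words k n. ennreal (weight h p u x) * indicator (A u) x * ennreal (weight h p v (orbit h u x)))"
        using u weight_nonneg[OF u] weight_nonneg
        by (intro sum.cong) (auto simp: weight_append length_words ennreal_mult ac_simps)
      then show ?thesis by (simp add: sum_distrib_left[symmetric] sum_weight_ennreal)
    qed
    then show ?thesis unfolding sum_words_add by (intro sum.cong) auto
  qed
  then show ?thesis by (simp add: path_prob_def)
qed

end

context centered_observable
begin

lemma chebyshev:
  assumes a: "0 < a"
  shows "path_prob n (\<lambda>w. {x. a < \<bar>birkhoff h f w x\<bar>}) \<le> ennreal ((\<integral>x. S2 n x \<partial>\<nu>) / a\<^sup>2)"
proof -
  have i: "integrable \<nu> (\<lambda>x. S2 n x / a\<^sup>2)"
    using integrable_cont_bounded[OF S2_cont S2_le] by simp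
  have nn: "0 \<le> S2 n x" for x
    unfolding S2_def expect_def using weight_nonneg by (intro sum_nonneg mult_nonneg_nonneg) auto
  have "path_prob n (\<lambda>w. {x. a < \<bar>birkhoff h f w x\<bar>}) \<le> (\<integral>\<^sup>+x. ennreal (S2 n x / a\<^sup>2) \<partial>\<nu>)"
    unfolding path_prob_def
  proof (rule nn_integral_mono)
    fix x
    have "(\<Sum>w\<in>words k n. ennreal (weight h p w x) * indicator {x. a < \<bar>birkhoff h f w x\<bar>} x)
        \<le> (\<Sum>w\<in>words k n. ennreal (weight h p w x * ((birkhoff h f w x)\<^sup>2 / a\<^sup>2)))"
    proof (intro sum_mono)
      fix w assume w: "w \<in> words k n"
      have "1 \<le> (birkhoff h f w x)\<^sup>2 / a\<^sup>2" if "a < \<bar>birkhoff h f w x\<bar>"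
        using that a abs_le_square_iff[of a "birkhoff h f w x"] by (simp add: divide_simps)
      then have "weight h p w x * indicator {x. a < \<bar>birkhoff h f w x\<bar>} x
          \<le> weight h p w x * ((birkhoff h f w x)\<^sup>2 / a\<^sup>2)"
        using weight_nonneg[OF w] by (intro mult_left_mono) (auto simp: indicator_def)
      then show "ennreal (weight h p w x) * indicator {x. a < \<bar>birkhoff h f w x\<bar>} x
          \<le> ennreal (weight h p w x * ((birkhoff h f w x)\<^sup>2 / a\<^sup>2))"
        using weight_nonneg[OF w] by (auto simp: indicator_def intro!: ennreal_leI split: if_splits)
    qed
    also have "\<dots> = ennreal (S2 n x / a\<^sup>2)"
      using weight_nonneg by (subst sum_ennreal) (auto simp: S2_def expect_def sum_divide_distrib)
    finally show "(\<Sum>w\<in>words k n. ennreal (weight h p w x) * indicator {x. a < \<bar>birkhoff h f w x\<bar>} x)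
        \<le> ennreal (S2 n x / a\<^sup>2)" .
  qed
  also have "\<dots> = ennreal ((\<integral>x. S2 n x \<partial>\<nu>) / a\<^sup>2)"
    using i nn by (subst nn_integral_eq_integral) auto
  finally show ?thesis .
qed

text \<open>The deviation of a sum of j letters is measured against a larger n: later, sums at
  intermediate times of one word of length n are to be controlled with a single tolerance.\<close>

lemma deviation_bound:
  "\<exists>C \<gamma>. 0 < \<gamma> \<and> 0 \<le> C \<and> (\<forall>n j. \<forall>\<eta>>0. j \<le> n \<longrightarrow> n \<ge> 1 \<longrightarrow>
     path_prob j (\<lambda>w. {x. \<eta> * real n < \<bar>birkhoff h f w x\<bar>}) \<le> ennreal (C / \<eta>\<^sup>2 * real n powr (- \<gamma>)))"
proof -
  obtain C \<gamma> where C: "0 < \<gamma>" "\<gamma> \<le> 1" "0 \<le> C"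
    and V: "\<And>n. n \<ge> 1 \<Longrightarrow> (\<integral>x. S2 n x \<partial>\<nu>) \<le> C * real n powr (2 - \<gamma>)"
    using variance_bound by blast
  have "path_prob j (\<lambda>w. {x. \<eta> * real n < \<bar>birkhoff h f w x\<bar>}) \<le> ennreal (C / \<eta>\<^sup>2 * real n powr (- \<gamma>))"
    if "0 < \<eta>" "j \<le> n" "n \<ge> 1" for n j \<eta>
  proof -
    have "(\<integral>x. S2 j x \<partial>\<nu>) \<le> C * real n powr (2 - \<gamma>)"
    proof (cases "j = 0")
      case False
      then have "(\<integral>x. S2 j x \<partial>\<nu>) \<le> C * real j powr (2 - \<gamma>)" by (intro V) auto
      also have "\<dots> \<le> C * real n powr (2 - \<gamma>)"
        using C that by (intro mult_left_mono powr_mono2) auto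
      finally show ?thesis .
    qed (use C in simp)
    then have "(\<integral>x. S2 j x \<partial>\<nu>) / (\<eta> * real n)\<^sup>2 \<le> C * real n powr (2 - \<gamma>) / (\<eta> * real n)\<^sup>2"
      by (intro divide_right_mono) auto
    moreover have "real n powr (2 - \<gamma>) = real n powr (- \<gamma>) * (real n)\<^sup>2"
      using that powr_add[of "real n" "- \<gamma>" 2] by (simp add: powr_numeral)
    ultimately have "(\<integral>x. S2 j x \<partial>\<nu>) / (\<eta> * real n)\<^sup>2 \<le> C / \<eta>\<^sup>2 * real n powr (- \<gamma>)"
      using that by (simp add: power_mult_distrib)
    then show ?thesis
      using that by (intro order.trans[OF chebyshev ennreal_leI]) auto
  qed
  then show ?thesis using C by blast
qed

end

section \<open>Conformal maps\<close>

locale conformal_map =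
  fixes h :: "'a::euclidean_space \<Rightarrow> 'a" and Dh :: "'a \<Rightarrow> ('a \<Rightarrow>\<^sub>L 'a)"
  assumes deriv: "\<And>x. (h has_derivative blinfun_apply (Dh x)) (at x)"
    and conformal: "\<And>x v. norm (Dh x v) = norm (Dh x) * norm v"
begin

lemma continuous_h: "continuous_on S h"
  by (intro continuous_at_imp_continuous_on ballI has_derivative_continuous[OF deriv])

lemma dist_le_of_derivative_le:
  assumes "convex S" "\<And>x. x \<in> S \<Longrightarrow> norm (Dh x) \<le> K" "u \<in> S" "v \<in> S"
  shows "dist (h u) (h v) \<le> K * dist u v"
proof -
  have "norm (h u - h v) \<le> K * norm (u - v)"
    using assms deriv
    by (intro differentiable_bound[of S h "\<lambda>x. blinfun_apply (Dh x)"])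
      (auto simp: norm_blinfun.rep_eq[symmetric] intro: has_derivative_at_withinI)
  then show ?thesis by (simp add: dist_norm)
qed

lemma surj_derivative:
  assumes "0 < norm (Dh x)" shows "\<exists>v. Dh x v = w"
proof -
  have "linear (blinfun_apply (Dh x))"
    using blinfun.bounded_linear_right bounded_linear.linear by blast
  moreover have "inj (blinfun_apply (Dh x))"
  proof (rule injI)
    fix u v assume "Dh x u = Dh x v"
    then have "norm (Dh x (u - v)) = 0" by (simp add: blinfun.diff_right)
    then show "u = v" using assms by (simp add: conformal)
  qed
  ultimately show ?thesis using linear_inj_imp_surj by (metis surjD)
qed

text \<open>A minimiser of \<^term>\<open>\<lambda>x. dist (h x) z + c * dist x u\<close> over the ball is mapped to \<^term>\<open>z\<close>:
  elsewhere, moving along \<^term>\<open>v\<close> with \<^term>\<open>Dh x v = z - h x\<close> decreases the first summand faster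
  than the second one can grow.\<close>

lemma cball_subset_image:
  assumes c: "0 \<le> c" "0 \<le> r" "\<And>x. x \<in> cball u r \<Longrightarrow> c < norm (Dh x)"
  shows "cball (h u) (c * r) \<subseteq> h ` cball u r"
proof
  fix z assume z: "z \<in> cball (h u) (c * r)"
  define G where "G x = dist (h x) z + c * dist x u" for x
  have "continuous_on (cball u r) G"
    unfolding G_def by (intro continuous_intros continuous_h)
  then obtain x where x: "x \<in> cball u r" and min: "\<And>y. y \<in> cball u r \<Longrightarrow> G x \<le> G y"
    using continuous_attains_inf[of "cball u r" G] c by auto
  have "h x = z"
  proof (rule ccontr)
    assume "h x \<noteq> z"
    then have F: "0 < dist (h x) z" by simp
    \<comment> \<open>Comparison with the centre: a minimiser that does not solve the equation lies
      in the interior, hence can be moved in every direction.\<close>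
    have "G x \<le> G u" using min[of u] c by simp
    also have "\<dots> \<le> c * r" using z by (simp add: G_def)
    finally have "c * dist x u < c * r" using F unfolding G_def by linarith
    then have xr: "dist x u < r" using c(1) by (simp add: mult_less_cancel_left)
    define N where "N = norm (Dh x)"
    have N: "c < N" using c(3)[OF x] by (simp add: N_def)
    then have N0: "0 < N" using c(1) by linarith
    note N = N N0
    obtain v where v: "Dh x v = z - h x" using surj_derivative N by (auto simp: N_def)
    have Fv: "dist (h x) z = N * norm v"
      using conformal[of x v] v by (simp add: N_def dist_norm norm_minus_commute)
    then have v0: "0 < norm v" using F N by (metis mult_zero_right norm_eq_zero norm_not_less_zero not_less_iff_gr_or_eq)
    \<comment> \<open>Half of the margin between the two rates is given to the error of the
      linearisation; the other half makes the decrease strict.\<close>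
    define e where "e = (N - c) / 2"
    have e: "0 < e" using N by (simp add: e_def)
    obtain d where d: "0 < d" and D: "\<And>y. norm (y - x) < d \<Longrightarrow>
        norm (h y - h x - Dh x (y - x)) \<le> e * norm (y - x)"
      using deriv[of x] e unfolding has_derivative_at_alt by blast
    \<comment> \<open>The three bounds keep 1 - t nonnegative, the new point where the linearisation
      is valid, and the new point in the ball.\<close>
    define t where "t = min 1 (min (d / (2 * norm v)) ((r - dist x u) / norm v))"
    have t: "0 < t" "t \<le> 1" using d v0 xr by (auto simp: t_def)
    have tv: "t * norm v \<le> d / 2" "t * norm v \<le> r - dist x u"
    proof -
      have "t \<le> d / (2 * norm v)" "t \<le> (r - dist x u) / norm v" by (auto simp: t_def)
      then show "t * norm v \<le> d / 2" "t * norm v \<le> r - dist x u"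
        using v0 by (auto simp: field_simps)
    qed
    define y where "y = x + t *\<^sub>R v"
    have yx: "y - x = t *\<^sub>R v" "norm (y - x) = t * norm v" using t by (auto simp: y_def)
    have "dist y u \<le> dist y x + dist x u" by (rule dist_triangle)
    then have dyu: "dist y u \<le> t * norm v + dist x u" using yx(2) dist_norm[of y x] by linarith
    then have "y \<in> cball u r" using tv by (simp add: dist_commute)
    then have "G x \<le> G y" by (rule min)
    have "norm (h y - z) \<le> norm (h y - h x - Dh x (y - x)) + norm ((h x - z) + Dh x (y - x))"
      using norm_triangle_ineq[of "h y - h x - Dh x (y - x)" "(h x - z) + Dh x (y - x)"] by simp
    also have "(h x - z) + Dh x (y - x) = (1 - t) *\<^sub>R (h x - z)"
      by (simp add: yx v blinfun.scaleR_right algebra_simps)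
    also have "norm ((1 - t) *\<^sub>R (h x - z)) = (1 - t) * (N * norm v)"
      using t Fv by (simp add: dist_norm)
    also have "norm (h y - h x - Dh x (y - x)) \<le> e * (t * norm v)"
    proof -
      have "norm (y - x) < d" using yx(2) tv(1) d by linarith
      from D[OF this] show ?thesis by (simp only: yx(2))
    qed
    finally have "dist (h y) z \<le> e * (t * norm v) + (1 - t) * (N * norm v)"
      by (simp add: dist_norm)
    then have "G y \<le> e * (t * norm v) + (1 - t) * (N * norm v) + c * (t * norm v + dist x u)"
      unfolding G_def using dyu c by (intro add_mono mult_left_mono) auto
    also have "\<dots> = G x - (N - c - e) * (t * norm v)"
      by (simp add: G_def Fv algebra_simps)
    also have "\<dots> < G x" using t v0 N by (simp add: e_def)
    finally show False using \<open>G x \<le> G y\<close> by simp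
  qed
  then show "z \<in> h ` cball u r" using x by auto
qed

text \<open>Hadamard's global inversion theorem, with the homotopy lifting of its usual proof replaced by
  lifts of discrete chains: from every point \<^term>\<open>x\<close> of the segment joining two points of a fibre,
  lift the straight path from \<^term>\<open>h x\<close> to the common value in small steps. The end point of the
  lift is locally constant in \<^term>\<open>x\<close>.\<close>

lemma injective_of_derivative_bounds:
  assumes C1: "continuous_on UNIV Dh" and c: "0 < c" "\<And>x. c < norm (Dh x)"
    and M: "\<And>x. norm (Dh x) \<le> M"
  shows "inj h"
proof (rule injI)
  fix x0 x1 assume eq: "h x0 = h x1"
  define z where "z = h x0"
  have M0: "0 < M" using c(1) c(2)[of 0] M[of 0] by linarith
  have lip: "dist (h u) (h v) \<le> M * dist u v" for u v
    using dist_le_of_derivative_le[of UNIV M u v] M by auto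
  define L where "L = M * dist x0 x1"
  define \<gamma> where "\<gamma> t = x0 + t *\<^sub>R (x1 - x0)" for t
  have \<gamma>: "dist (\<gamma> s) (\<gamma> t) = \<bar>s - t\<bar> * dist x0 x1" for s t
    by (simp add: \<gamma>_def dist_norm scaleR_left_diff_distrib[symmetric] norm_minus_commute)
  have \<gamma>_seg: "norm (\<gamma> t) \<le> norm x0 + dist x0 x1" "dist (h (\<gamma> t)) z \<le> L" if "0 \<le> t" "t \<le> 1" for t
  proof -
    have "norm (\<gamma> t) \<le> norm x0 + norm (t *\<^sub>R (x1 - x0))" unfolding \<gamma>_def by (rule norm_triangle_ineq)
    also have "norm (t *\<^sub>R (x1 - x0)) \<le> 1 * dist x0 x1"
      using that unfolding norm_scaleR dist_norm norm_minus_commute[of x0]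
      by (intro mult_right_mono) auto
    finally show "norm (\<gamma> t) \<le> norm x0 + dist x0 x1" by simp
    have "dist (h (\<gamma> t)) z \<le> M * dist (\<gamma> t) (\<gamma> 0)" unfolding z_def using lip[of "\<gamma> t" x0] by (simp add: \<gamma>_def)
    also have "\<dots> \<le> M * dist x0 x1" using that M0 unfolding \<gamma> by (intro mult_left_mono mult_left_le_one_le) auto
    finally show "dist (h (\<gamma> t)) z \<le> L" by (simp add: L_def)
  qed
  \<comment> \<open>All lifts stay in this ball: the segment lies within the first two summands, and
    a lift has total length at most L / c.\<close>
  define R where "R = norm x0 + dist x0 x1 + L / c + 1"
  have L: "0 \<le> L" using M0 by (simp add: L_def)
  have "uniformly_continuous_on (cball 0 (R + 1)) Dh"
    by (intro compact_uniformly_continuous continuous_on_subset[OF C1]) auto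
  then obtain d where d: "0 < d" and unif: "\<And>x y. x \<in> cball 0 (R + 1) \<Longrightarrow> y \<in> cball 0 (R + 1) \<Longrightarrow>
      dist y x < d \<Longrightarrow> dist (Dh y) (Dh x) < c / 2"
    by (rule uniformly_continuous_onE[of _ _ "c / 2"]) (use c in auto)
  define \<xi> where "\<xi> = min d 1"
  have \<xi>: "0 < \<xi>" "\<xi> \<le> 1" using d by (auto simp: \<xi>_def)
  \<comment> \<open>Uniform continuity of the derivative on the compact ball: at the scale \<xi> the
    map is injective there with a uniform constant.\<close>
  have expand: "c / 2 * dist u v \<le> dist (h u) (h v)" if "norm u \<le> R" "dist u v < \<xi>" for u v
  proof -
    let ?S = "ball u \<xi>"
    have "norm (h v - h u - Dh u (v - u)) \<le> norm (v - u) * (c / 2)"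
    proof (rule differentiable_bound_linearization[where S = ?S and f' = "\<lambda>x. blinfun_apply (Dh x)"])
      show "u + t *\<^sub>R (v - u) \<in> ?S" if "t \<in> {0..1}" for t
      proof -
        have "norm (t *\<^sub>R (v - u)) \<le> 1 * norm (v - u)"
          unfolding norm_scaleR using that by (intro mult_right_mono) auto
        then show ?thesis using \<open>dist u v < \<xi>\<close> by (simp add: dist_norm norm_minus_commute)
      qed
      show "(h has_derivative blinfun_apply (Dh x)) (at x within ?S)" if "x \<in> ?S" for x
        using deriv by (rule has_derivative_at_withinI)
      show "onorm (blinfun_apply (Dh x) - blinfun_apply (Dh u)) \<le> c / 2" if x: "x \<in> ?S" for x
      proof -
        have "norm x \<le> norm u + dist u x"
          using norm_triangle_ineq[of u "x - u"] by (simp add: dist_norm norm_minus_commute)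
        then have "x \<in> cball 0 (R + 1)" using x \<xi> \<open>norm u \<le> R\<close> by simp
        moreover have "u \<in> cball 0 (R + 1)" using \<open>norm u \<le> R\<close> by simp
        ultimately have "dist (Dh x) (Dh u) < c / 2"
          using x by (intro unif) (auto simp: \<xi>_def dist_commute)
        moreover have "blinfun_apply (Dh x) - blinfun_apply (Dh u) = blinfun_apply (Dh x - Dh u)"
          by (auto simp: blinfun.diff_left)
        ultimately show ?thesis by (simp add: dist_norm norm_blinfun.rep_eq)
      qed
    qed (use \<xi> in auto)
    moreover have "c * norm (v - u) \<le> norm (Dh u (v - u))"
      unfolding conformal using c by (intro mult_right_mono) (auto intro: less_imp_le)
    moreover have "norm (Dh u (v - u)) \<le> norm (h v - h u) + norm (h v - h u - Dh u (v - u))"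
      using norm_triangle_sub[of "Dh u (v - u)" "h v - h u"] by (simp add: norm_minus_commute)
    ultimately show ?thesis by (simp add: dist_norm norm_minus_commute algebra_simps)
  qed
  have "\<forall>x y. \<exists>x'. h x' = y \<and> dist x x' \<le> dist (h x) y / c"
  proof (intro allI)
    fix x y
    have "y \<in> cball (h x) (c * (dist (h x) y / c))" using c by simp
    also have "\<dots> \<subseteq> h ` cball x (dist (h x) y / c)"
      using c by (intro cball_subset_image) auto
    finally show "\<exists>x'. h x' = y \<and> dist x x' \<le> dist (h x) y / c" by auto
  qed
  then have ex: "\<exists>x'. h x' = y \<and> dist x x' \<le> dist (h x) y / c" for x y by simp
  \<comment> \<open>One lifting step takes any preimage close to x. Continuity of this choice is not
    known; uniqueness at the scale \<xi> replaces it.\<close>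
  define s where "s x y = (SOME x'. h x' = y \<and> dist x x' \<le> dist (h x) y / c)" for x y
  have s: "h (s x y) = y" "dist x (s x y) \<le> dist (h x) y / c" for x y
    using someI_ex[OF ex[of y x]] by (simp_all add: s_def)
  obtain N where N: "L / (c * \<xi> / 8) < real N" using reals_Archimedean2 by blast
  moreover have "0 \<le> L / (c * \<xi> / 8)" using L c \<xi> by simp
  ultimately have N0: "0 < N" by linarith
  have N\<xi>: "L / (real N * c) < \<xi> / 8"
    using N N0 c \<xi> by (simp add: field_simps)
  \<comment> \<open>The lift of the segment from h x to z: the i-th point lies above the fraction i
    / N of the way, so the N-th one is in the fibre of z.\<close>
  define g where "g x = rec_nat x (\<lambda>i y. s y (z + (1 - real (Suc i) / N) *\<^sub>R (h x - z)))" for x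
  have g0: "g x 0 = x" and gS: "g x (Suc i) = s (g x i) (z + (1 - real (Suc i) / N) *\<^sub>R (h x - z))" for x i
    by (simp_all add: g_def)
  have hg: "h (g x i) = z + (1 - real i / N) *\<^sub>R (h x - z)" for x i
    by (cases i) (simp_all add: g0 gS s)
  have step: "dist (g x i) (g x (Suc i)) \<le> L / (real N * c)" if "dist (h x) z \<le> L" for x i
  proof -
    have "dist (g x i) (g x (Suc i)) \<le> dist (h (g x i)) (z + (1 - real (Suc i) / N) *\<^sub>R (h x - z)) / c"
      unfolding gS by (rule s)
    also have "dist (h (g x i)) (z + (1 - real (Suc i) / N) *\<^sub>R (h x - z)) = norm ((1 / N) *\<^sub>R (h x - z))"
      unfolding hg dist_norm add_diff_add diff_self add_0 scaleR_left_diff_distrib[symmetric]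
      using N0 by (simp add: field_simps)
    also have "\<dots> / c \<le> L / (real N * c)"
      using that c by (simp add: dist_norm divide_right_mono)
    finally show ?thesis .
  qed
  have norm_g: "norm (g x i) \<le> norm x + real i * (L / (real N * c))" if "dist (h x) z \<le> L" for x i
  proof (induction i)
    case (Suc i)
    have "norm (g x (Suc i)) \<le> norm (g x i) + dist (g x i) (g x (Suc i))"
      using norm_triangle_ineq[of "g x i" "g x (Suc i) - g x i"] by (simp add: dist_norm norm_minus_commute)
    then show ?case using Suc step[OF that, of i] unfolding of_nat_Suc distrib_right by linarith
  qed (simp add: g0)
  have g_R: "norm (g (\<gamma> t) i) \<le> R" if "0 \<le> t" "t \<le> 1" "i \<le> N" for t i
  proof -
    have "real i * (L / (real N * c)) \<le> real N * (L / (real N * c))"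
      using that L c by (intro mult_right_mono) auto
    also have "\<dots> = L / c" using N0 by simp
    finally show ?thesis
      using norm_g[OF \<gamma>_seg(2)[OF that(1,2)], of i] \<gamma>_seg(1)[OF that(1,2)] unfolding R_def by linarith
  qed
  \<comment> \<open>Two lifts that are close remain so: after one more step they are still within
    \<xi>, and then \<open>expand\<close> brings their distance back to 2 M dist x x' / c, a bound
    that does not accumulate with i.\<close>
  have close: "dist (g x i) (g x' i) < \<xi> / 2"
    if x: "x = \<gamma> t" "0 \<le> t" "t \<le> 1" and x': "x' = \<gamma> t'" "0 \<le> t'" "t' \<le> 1"
      and xx: "dist x x' < \<xi> / 2" "2 * M * dist x x' / c < \<xi> / 2" and i: "i \<le> N" for x x' t t' i
    using i
  proof (induction i)
    case (Suc i)
    have bx: "dist (h x) z \<le> L" "dist (h x') z \<le> L" using x x' \<gamma>_seg(2) by auto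
    have "dist (g x (Suc i)) (g x' (Suc i))
        \<le> dist (g x i) (g x (Suc i)) + dist (g x i) (g x' i) + dist (g x' i) (g x' (Suc i))"
      using dist_triangle[of "g x (Suc i)" "g x' (Suc i)" "g x i"]
        dist_triangle[of "g x i" "g x' (Suc i)" "g x' i"] by (simp add: dist_commute)
    also have "\<dots> < \<xi>"
      using le_less_trans[OF step[OF bx(1)] N\<xi>, of i] le_less_trans[OF step[OF bx(2)] N\<xi>, of i]
        Suc.IH[OF Suc_leD[OF Suc.prems]] \<xi>(1) by linarith
    finally have "dist (g x (Suc i)) (g x' (Suc i)) < \<xi>" .
    then have "c / 2 * dist (g x (Suc i)) (g x' (Suc i)) \<le> dist (h (g x (Suc i))) (h (g x' (Suc i)))"
      using g_R x Suc by (intro expand) auto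
    also have "\<dots> = norm ((1 - real (Suc i) / N) *\<^sub>R (h x - h x'))"
      unfolding hg dist_norm by (simp add: algebra_simps)
    also have "\<dots> \<le> 1 * norm (h x - h x')"
      unfolding norm_scaleR using Suc N0 by (intro mult_right_mono) (auto simp: field_simps)
    also have "\<dots> \<le> M * dist x x'" using lip by (simp add: dist_norm)
    finally have "dist (g x (Suc i)) (g x' (Suc i)) \<le> 2 * M * dist x x' / c"
      using c by (simp add: field_simps)
    then show ?case using xx by linarith
  qed (use xx in \<open>simp add: g0\<close>)
  \<comment> \<open>Over the fibre itself the path to be lifted is constant, and so is its
    lift.\<close>
  have ends: "g x i = x" if hx: "h x = z" and xR: "norm x \<le> R" for x i
  proof (induction i)
    case (Suc i)
    have "dist x (g x (Suc i)) < \<xi>"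
      using le_less_trans[OF step N\<xi>, of x i] Suc.IH hx L \<xi>(1) by simp
    then have "c / 2 * dist x (g x (Suc i)) \<le> dist (h x) (h (g x (Suc i)))"
      by (rule expand[OF xR])
    also have "\<dots> = 0" unfolding hg by (simp add: hx)
    finally have "dist x (g x (Suc i)) \<le> 0" using c(1) by (simp add: mult_le_0_iff)
    then show ?case by simp
  qed (simp add: g0)
  obtain J where J: "max (dist x0 x1 / (\<xi> / 2)) (2 * M * dist x0 x1 / c / (\<xi> / 2)) < real J"
    using reals_Archimedean2 by blast
  have J0: "0 < real J"
  proof -
    have "0 \<le> dist x0 x1 / (\<xi> / 2)" using \<xi> by simp
    then show ?thesis using J by linarith
  qed
  \<comment> \<open>The end points of two neighbouring lifts lie in the same fibre and closer than
    \<xi>, hence coincide.\<close>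
  have const: "g (\<gamma> (real j / J)) N = g (\<gamma> 0) N" if "j \<le> J" for j
    using that
  proof (induction j)
    case (Suc j)
    let ?x = "\<gamma> (real j / J)" and ?x' = "\<gamma> (real (Suc j) / J)"
    have dd: "dist ?x ?x' = dist x0 x1 / J"
      using J0 unfolding \<gamma> by (simp add: diff_divide_distrib[symmetric])
    have "dist (g ?x N) (g ?x' N) < \<xi> / 2"
    proof (rule close[where t = "real j / J" and t' = "real (Suc j) / J"])
      show "dist ?x ?x' < \<xi> / 2" "2 * M * dist ?x ?x' / c < \<xi> / 2"
        using J J0 \<xi> c unfolding dd by (auto simp: field_simps)
      show "real j / J \<le> 1" "real (Suc j) / J \<le> 1" using Suc.prems J0 by simp_all
    qed simp_all
    then have "c / 2 * dist (g ?x N) (g ?x' N) \<le> dist (h (g ?x N)) (h (g ?x' N))"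
      using Suc.prems J0 \<xi> \<open>dist (g ?x N) (g ?x' N) < \<xi> / 2\<close> by (intro expand g_R) auto
    also have "\<dots> = 0" using N0 by (simp add: hg)
    finally have "g ?x N = g ?x' N" using c by (simp add: mult_le_0_iff)
    then show ?case using Suc by simp
  qed simp
  have "g (\<gamma> 1) N = g (\<gamma> 0) N" using const[of J] J0 by simp
  moreover have "\<gamma> 0 = x0" "\<gamma> 1 = x1" by (simp_all add: \<gamma>_def)
  ultimately show "x0 = x1"
    using ends[of x0 N] ends[of x1 N] g_R[of 0 0] g_R[of 1 0] eq by (simp add: z_def g0)
qed

end

section \<open>Packing by volume and distortion along words\<close>

lemma card_disjoint_cballs:
  fixes c :: "'b \<Rightarrow> 'a::euclidean_space"
  assumes V: "finite V" and s: "0 \<le> s" and sub: "\<And>v. v \<in> V \<Longrightarrow> cball (c v) s \<subseteq> cball x0 R"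
    and disj: "\<And>v v'. v \<in> V \<Longrightarrow> v' \<in> V \<Longrightarrow> v \<noteq> v' \<Longrightarrow> cball (c v) s \<inter> cball (c v') s = {}"
    and R: "0 \<le> R"
  shows "real (card V) * s ^ DIM('a) \<le> R ^ DIM('a)"
proof -
  let ?u = "unit_ball_vol (real DIM('a))"
  have fin: "emeasure lborel (cball (c v) s) \<noteq> \<infinity>" for v
    using emeasure_lborel_cball_finite[of "c v" s] by simp
  have "(\<Sum>v\<in>V. measure lborel (cball (c v) s)) = measure lborel (\<Union>v\<in>V. cball (c v) s)"
    using V disj fin by (intro measure_finite_Union[symmetric]) (auto simp: disjoint_family_on_def)
  also have "\<dots> \<le> measure lborel (cball x0 R)"
    using sub V by (intro measure_mono_fmeasurable fmeasurable_compact) (auto intro!: sets.finite_UN)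
  finally have "real (card V) * (?u * s ^ DIM('a)) \<le> ?u * R ^ DIM('a)"
    using s R by (simp add: content_cball)
  then have "?u * (real (card V) * s ^ DIM('a)) \<le> ?u * R ^ DIM('a)" by (simp add: ac_simps)
  then show ?thesis using unit_ball_vol_pos[of "real DIM('a)"] by simp
qed

text \<open>What conformality gives at the scale r0: the derivative at y rules the map near y up to
  exp(\<epsilon>). The lower estimate is stated with balls instead of distances, since inner balls
  can be pushed along a word and then counted by volume.\<close>

locale distortion =
  fixes k :: nat and h :: "nat \<Rightarrow> 'a::euclidean_space \<Rightarrow> 'a" and L :: "nat \<Rightarrow> 'a \<Rightarrow> real" and \<epsilon> r0 :: real
  assumes lipschitz: "\<And>i u y. i < k \<Longrightarrow> dist u y \<le> r0 \<Longrightarrow> dist (h i u) (h i y) \<le> exp (L i y + \<epsilon>) * dist u y"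
    and expanding: "\<And>i u y \<kappa>. i < k \<Longrightarrow> 0 \<le> \<kappa> \<Longrightarrow> dist u y + \<kappa> \<le> r0 \<Longrightarrow>
      cball (h i u) (exp (L i y - \<epsilon>) * \<kappa>) \<subseteq> h i ` cball u \<kappa>"
    and \<epsilon>_nonneg: "0 \<le> \<epsilon>"
begin

text \<open>A ball of radius r around y is carried along the word; the l-th condition says that the
  bound for its radius after l letters is still within the range r0 of the distortion
  estimates.\<close>

definition controlled :: "real \<Rightarrow> nat list \<Rightarrow> 'a \<Rightarrow> bool" where
  "controlled r v y \<longleftrightarrow> (\<forall>l\<le>length v. r * exp (birkhoff h L (take l v) y + \<epsilon> * real l) \<le> r0)"

lemma controlled_le: "controlled r v y \<Longrightarrow> r \<le> r0"
  by (auto simp: controlled_def dest: spec[of _ 0])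

lemma controlled_Cons:
  assumes "controlled r (i # v) y" shows "controlled (r * exp (L i y + \<epsilon>)) v (h i y)"
  unfolding controlled_def
proof (intro allI impI)
  fix l assume "l \<le> length v"
  then have "r * exp (birkhoff h L (take (Suc l) (i # v)) y + \<epsilon> * real (Suc l)) \<le> r0"
    using assms unfolding controlled_def by (metis Suc_le_mono length_Cons)
  also have "birkhoff h L (take (Suc l) (i # v)) y + \<epsilon> * real (Suc l)
      = (L i y + \<epsilon>) + (birkhoff h L (take l v) (h i y) + \<epsilon> * real l)"
    by (simp add: algebra_simps)
  finally show "r * exp (L i y + \<epsilon>) * exp (birkhoff h L (take l v) (h i y) + \<epsilon> * real l) \<le> r0"
    by (simp only: exp_add mult.assoc)
qed

lemma dist_step:
  assumes "i < k" "dist u y \<le> r" "r \<le> r0"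
  shows "dist (h i u) (h i y) \<le> r * exp (L i y + \<epsilon>)"
proof -
  have "dist (h i u) (h i y) \<le> exp (L i y + \<epsilon>) * dist u y"
    using assms by (intro lipschitz) auto
  also have "\<dots> \<le> exp (L i y + \<epsilon>) * r" using assms by (intro mult_left_mono) auto
  finally show ?thesis by (simp add: mult.commute)
qed

lemma dist_orbit_le:
  assumes "v \<in> words k n" "controlled r v y" "dist u y \<le> r"
  shows "dist (orbit h v u) (orbit h v y) \<le> r * exp (birkhoff h L v y + \<epsilon> * real n)"
  using assms
proof (induction n arbitrary: v r u y)
  case (Suc n)
  from Suc.prems(1) obtain i w where w: "v = i # w" "i < k" "w \<in> words k n"
    by (rule words_SucE)
  have c: "controlled r (i # w) y" using Suc.prems w by simp
  have "dist (orbit h w (h i u)) (orbit h w (h i y))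
      \<le> (r * exp (L i y + \<epsilon>)) * exp (birkhoff h L w (h i y) + \<epsilon> * real n)"
    using Suc.prems w controlled_le[OF c] controlled_Cons[OF c]
    by (intro Suc.IH dist_step) auto
  also have "\<dots> = r * exp ((L i y + \<epsilon>) + (birkhoff h L w (h i y) + \<epsilon> * real n))"
    by (simp only: exp_add mult.assoc)
  also have "(L i y + \<epsilon>) + (birkhoff h L w (h i y) + \<epsilon> * real n) = birkhoff h L v y + \<epsilon> * real (Suc n)"
    by (simp add: w algebra_simps)
  finally show ?case by (simp add: w)
qed simp

lemma birkhoff_diff_le:
  assumes "\<And>i u y. i < k \<Longrightarrow> dist u y \<le> r0 \<Longrightarrow> \<bar>f i u - f i y\<bar> \<le> e"
    and "v \<in> words k n" "controlled r v y" "dist u y \<le> r"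
  shows "\<bar>birkhoff h f v u - birkhoff h f v y\<bar> \<le> real n * e"
  using assms(2-)
proof (induction n arbitrary: v r u y)
  case (Suc n)
  from Suc.prems(1) obtain i w where w: "v = i # w" "i < k" "w \<in> words k n"
    by (rule words_SucE)
  have c: "controlled r (i # w) y" using Suc.prems w by simp
  have "\<bar>birkhoff h f w (h i u) - birkhoff h f w (h i y)\<bar> \<le> real n * e"
    using Suc.prems w controlled_le[OF c] controlled_Cons[OF c]
    by (intro Suc.IH[where r = "r * exp (L i y + \<epsilon>)"] dist_step) auto
  moreover have "\<bar>f i u - f i y\<bar> \<le> e"
    using Suc.prems w controlled_le[OF c] by (intro assms(1)) auto
  ultimately show ?case by (simp add: w algebra_simps)
qed simp

text \<open>The reference ball grows by exp(L + \<epsilon>) and the inner ball only by exp(L -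
  \<epsilon>), so the inner ball never leaves the reference ball.\<close>

lemma cball_subset_orbit:
  assumes "v \<in> words k n" "controlled r v y" "0 \<le> \<kappa>" "dist u y + \<kappa> \<le> r"
  shows "cball (orbit h v u) (\<kappa> * exp (birkhoff h L v y - \<epsilon> * real n)) \<subseteq> orbit h v ` cball u \<kappa>"
  using assms
proof (induction n arbitrary: v r u y \<kappa>)
  case (Suc n)
  from Suc.prems(1) obtain i w where w: "v = i # w" "i < k" "w \<in> words k n"
    by (rule words_SucE)
  have c: "controlled r (i # w) y" using Suc.prems w by simp
  let ?\<kappa> = "exp (L i y - \<epsilon>) * \<kappa>"
  have "dist (h i u) (h i y) \<le> exp (L i y + \<epsilon>) * dist u y"
    using Suc.prems w controlled_le[OF c] by (intro lipschitz) auto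
  moreover have "?\<kappa> \<le> exp (L i y + \<epsilon>) * \<kappa>"
    using Suc.prems \<epsilon>_nonneg by (intro mult_right_mono) auto
  moreover have "exp (L i y + \<epsilon>) * (dist u y + \<kappa>) \<le> exp (L i y + \<epsilon>) * r"
    using Suc.prems by (intro mult_left_mono) auto
  ultimately have "dist (h i u) (h i y) + ?\<kappa> \<le> r * exp (L i y + \<epsilon>)"
    unfolding distrib_left by (simp add: mult.commute)
  then have "cball (orbit h w (h i u)) (?\<kappa> * exp (birkhoff h L w (h i y) - \<epsilon> * real n))
      \<subseteq> orbit h w ` cball (h i u) ?\<kappa>"
    using Suc.prems w controlled_Cons[OF c] by (intro Suc.IH[where r = "r * exp (L i y + \<epsilon>)"]) auto
  also have "\<dots> \<subseteq> orbit h w ` h i ` cball u \<kappa>"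
    using Suc.prems w controlled_le[OF c] by (intro image_mono expanding) auto
  finally have "cball (orbit h w (h i u)) (?\<kappa> * exp (birkhoff h L w (h i y) - \<epsilon> * real n))
      \<subseteq> orbit h v ` cball u \<kappa>" by (simp add: w image_image)
  moreover have "?\<kappa> * exp (birkhoff h L w (h i y) - \<epsilon> * real n)
      = \<kappa> * exp (birkhoff h L v y - \<epsilon> * real (Suc n))"
    by (simp add: w mult.assoc exp_add[symmetric] algebra_simps)
  ultimately show ?case by (simp add: w)
qed simp

end

section \<open>Hausdorff measure and dimension\<close>

lemma hausdorff_pre_le:
  assumes "Y \<subseteq> (\<Union>n. U n)" "\<And>n. bounded (U n)" "\<And>n. diameter (U n) \<le> \<delta>"
  shows "hausdorff_pre s \<delta> Y \<le> (\<Sum>n. ennreal (diameter (U n) powr s))"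
  unfolding hausdorff_pre_def using assms by (intro INF_lower) auto

lemma hausdorff_pre_mono: "Y \<subseteq> Y' \<Longrightarrow> hausdorff_pre s \<delta> Y \<le> hausdorff_pre s \<delta> Y'"
  unfolding hausdorff_pre_def by (intro INF_superset_mono) auto

lemma hausdorff_pre_le_diameter:
  assumes "bounded E" "diameter E \<le> \<delta>" "0 \<le> \<delta>"
  shows "hausdorff_pre s \<delta> E \<le> ennreal (diameter E powr s)"
proof -
  \<comment> \<open>Covers are sequences. The empty sets that fill this one up have diameter 0 and
    contribute nothing, as \<open>0 powr s = 0\<close> for every s.\<close>
  let ?U = "\<lambda>n::nat. if n = 0 then E else {}"
  have "hausdorff_pre s \<delta> E \<le> (\<Sum>n. ennreal (diameter (?U n) powr s))"
    using assms by (intro hausdorff_pre_le) (auto split: if_splits)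
  also have "\<dots> = (\<Sum>n\<in>{0}. ennreal (diameter (?U n) powr s))"
    by (intro suminf_finite) auto
  finally show ?thesis by simp
qed

lemma hausdorff_pre_empty [simp]: "0 \<le> \<delta> \<Longrightarrow> hausdorff_pre s \<delta> {} = 0"
  using hausdorff_pre_le_diameter[of "{}" \<delta> s] by simp

lemma hausdorff_pre_UN_le:
  "hausdorff_pre s \<delta> (\<Union>n. Y n) \<le> (\<Sum>n. hausdorff_pre s \<delta> (Y n))"
proof (rule ennreal_le_epsilon)
  fix e :: real assume fin: "(\<Sum>n. hausdorff_pre s \<delta> (Y n)) < top" and e: "0 < e"
  have "\<exists>U. Y n \<subseteq> (\<Union>m. U m) \<and> (\<forall>m. bounded (U m) \<and> diameter (U m) \<le> \<delta>) \<and>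
      (\<Sum>m. ennreal (diameter (U m) powr s)) \<le> hausdorff_pre s \<delta> (Y n) + ennreal (e * (1 / 2) ^ Suc n)" for n
  proof -
    have "hausdorff_pre s \<delta> (Y n) \<noteq> top"
      using ennreal_suminf_lessD[OF fin, of n] by simp
    moreover have "0 < e * (1 / 2) ^ Suc n" using e by simp
    then have "0 < ennreal (e * (1 / 2) ^ Suc n)" by (simp only: ennreal_less_zero_iff)
    ultimately have "hausdorff_pre s \<delta> (Y n) + 0 < hausdorff_pre s \<delta> (Y n) + ennreal (e * (1 / 2) ^ Suc n)"
      unfolding ennreal_add_left_cancel_less infinity_ennreal_def by (rule conjI)
    then have lt: "hausdorff_pre s \<delta> (Y n) < hausdorff_pre s \<delta> (Y n) + ennreal (e * (1 / 2) ^ Suc n)"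
      by (simp only: add_0_right)
    obtain U where 1: "U \<in> {U. Y n \<subseteq> (\<Union>m. U m) \<and> (\<forall>m. bounded (U m) \<and> diameter (U m) \<le> \<delta>)}"
      and 2: "(\<Sum>m. ennreal (diameter (U m) powr s)) < hausdorff_pre s \<delta> (Y n) + ennreal (e * (1 / 2) ^ Suc n)"
      using INF_less_iff[THEN iffD1, OF ord_eq_less_trans[OF hausdorff_pre_def[symmetric] lt]]
      by (rule bexE)
    from CollectD[OF 1] less_imp_le[OF 2] show ?thesis
      by (intro exI[of _ U]) (simp only: simp_thms)
  qed
  then have "\<exists>U. \<forall>n. Y n \<subseteq> (\<Union>m. U n m) \<and> (\<forall>m. bounded (U n m) \<and> diameter (U n m) \<le> \<delta>) \<and>
      (\<Sum>m. ennreal (diameter (U n m) powr s)) \<le> hausdorff_pre s \<delta> (Y n) + ennreal (e * (1 / 2) ^ Suc n)"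
    by (intro choice allI)
  then obtain U where UU: "\<forall>n. Y n \<subseteq> (\<Union>m. U n m) \<and> (\<forall>m. bounded (U n m) \<and> diameter (U n m) \<le> \<delta>) \<and>
      (\<Sum>m. ennreal (diameter (U n m) powr s)) \<le> hausdorff_pre s \<delta> (Y n) + ennreal (e * (1 / 2) ^ Suc n)"
    by (rule exE)
  have U: "Y n \<subseteq> (\<Union>m. U n m)" "bounded (U n m)" "diameter (U n m) \<le> \<delta>" for n m
  proof -
    show "Y n \<subseteq> (\<Union>m. U n m)" by (rule UU[THEN spec, THEN conjunct1])
    have "\<forall>m. bounded (U n m) \<and> diameter (U n m) \<le> \<delta>"
      by (rule UU[THEN spec, THEN conjunct2, THEN conjunct1])
    then show "bounded (U n m)" "diameter (U n m) \<le> \<delta>" by simp_all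
  qed
  have sum: "(\<Sum>m. ennreal (diameter (U n m) powr s))
      \<le> hausdorff_pre s \<delta> (Y n) + ennreal (e * (1 / 2) ^ Suc n)" for n
    by (rule UU[THEN spec, THEN conjunct2, THEN conjunct2])
  let ?V = "\<lambda>i. case prod_decode i of (n, m) \<Rightarrow> U n m"
  have "hausdorff_pre s \<delta> (\<Union>n. Y n) \<le> (\<Sum>i. ennreal (diameter (?V i) powr s))"
  proof (intro hausdorff_pre_le)
    show "(\<Union>n. Y n) \<subseteq> (\<Union>i. ?V i)"
    proof
      fix x assume "x \<in> (\<Union>n. Y n)"
      then obtain n m where "x \<in> U n m" using U(1) by blast
      then have "x \<in> ?V (prod_encode (n, m))" by simp
      then show "x \<in> (\<Union>i. ?V i)" by (rule UN_I[OF UNIV_I])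
    qed
  qed (use U(2,3) in \<open>auto split: prod.split\<close>)
  also have "\<dots> = (\<Sum>i. (\<lambda>(n, m). ennreal (diameter (U n m) powr s)) (prod_decode i))"
    by (intro suminf_cong) (simp split: prod.split)
  also have "\<dots> = (\<Sum>n. \<Sum>m. ennreal (diameter (U n m) powr s))"
    by (intro suminf_ennreal_2dimen) simp
  also have "\<dots> \<le> (\<Sum>n. hausdorff_pre s \<delta> (Y n) + ennreal (e * (1 / 2) ^ Suc n))"
    by (rule suminf_le[OF sum summableI summableI])
  also have "\<dots> = (\<Sum>n. hausdorff_pre s \<delta> (Y n)) + (\<Sum>n. ennreal (e * (1 / 2) ^ Suc n))"
    by (rule suminf_add[OF summableI summableI, symmetric])
  also have "(\<Sum>n. ennreal (e * (1 / 2) ^ Suc n)) = ennreal (e * 1)"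
    using e by (intro suminf_ennreal_eq sums_mult power_half_series) simp
  also have "e * 1 = e" by (rule mult_1_right)
  finally show "hausdorff_pre s \<delta> (\<Union>n. Y n) \<le> (\<Sum>n. hausdorff_pre s \<delta> (Y n)) + ennreal e" .
qed

lemma hausdorff_pre_Un_le:
  assumes "0 \<le> \<delta>"
  shows "hausdorff_pre s \<delta> (A \<union> B) \<le> hausdorff_pre s \<delta> A + hausdorff_pre s \<delta> B"
proof -
  let ?Y = "\<lambda>n::nat. if n = 0 then A else if n = 1 then B else {}"
  have "A \<union> B \<subseteq> (\<Union>n. ?Y n)"
  proof
    fix x assume "x \<in> A \<union> B"
    then have "x \<in> ?Y 0 \<or> x \<in> ?Y 1" by auto
    then show "x \<in> (\<Union>n. ?Y n)" by blast
  qed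
  then have "hausdorff_pre s \<delta> (A \<union> B) \<le> hausdorff_pre s \<delta> (\<Union>n. ?Y n)"
    by (rule hausdorff_pre_mono)
  also have "\<dots> \<le> (\<Sum>n. hausdorff_pre s \<delta> (?Y n))" by (rule hausdorff_pre_UN_le)
  also have "\<dots> = (\<Sum>n\<in>{0, 1}. hausdorff_pre s \<delta> (?Y n))"
    using assms by (intro suminf_finite) auto
  finally show ?thesis by simp
qed

lemma hausdorff_pre_finite_UN_le:
  assumes "finite I" "0 \<le> \<delta>" "\<And>i. i \<in> I \<Longrightarrow> bounded (U i)" "\<And>i. i \<in> I \<Longrightarrow> diameter (U i) \<le> \<delta>"
  shows "hausdorff_pre s \<delta> (\<Union>i\<in>I. U i) \<le> (\<Sum>i\<in>I. ennreal (diameter (U i) powr s))"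
  using assms
proof (induction I rule: finite_induct)
  case (insert i I)
  have "hausdorff_pre s \<delta> (\<Union>i\<in>insert i I. U i) \<le> hausdorff_pre s \<delta> (U i) + hausdorff_pre s \<delta> (\<Union>i\<in>I. U i)"
    using hausdorff_pre_Un_le[of \<delta> s "U i" "\<Union>i\<in>I. U i"] insert by simp
  also have "\<dots> \<le> ennreal (diameter (U i) powr s) + (\<Sum>i\<in>I. ennreal (diameter (U i) powr s))"
    using insert by (intro add_mono hausdorff_pre_le_diameter insert.IH) auto
  finally show ?case using insert.hyps by (simp del: sum_ennreal)
qed simp

lemma hausdorff_measure_0_iff:
  "hausdorff_measure s Y = 0 \<longleftrightarrow> (\<forall>\<delta>>0. hausdorff_pre s \<delta> Y = 0)"
proof
  assume 0: "hausdorff_measure s Y = 0"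
  show "\<forall>\<delta>>0. hausdorff_pre s \<delta> Y = 0"
  proof (intro allI impI)
    fix \<delta> :: real assume "0 < \<delta>"
    then have "hausdorff_pre s \<delta> Y \<le> hausdorff_measure s Y"
      unfolding hausdorff_measure_def by (intro SUP_upper) simp
    then show "hausdorff_pre s \<delta> Y = 0" using 0 by simp
  qed
next
  assume "\<forall>\<delta>>0. hausdorff_pre s \<delta> Y = 0"
  then have "hausdorff_measure s Y \<le> 0"
    unfolding hausdorff_measure_def by (intro SUP_least) simp
  then show "hausdorff_measure s Y = 0" by simp
qed

lemma hausdorff_measure_0_mono:
  assumes "Y \<subseteq> Y'" "hausdorff_measure s Y' = 0" shows "hausdorff_measure s Y = 0"
  unfolding hausdorff_measure_0_iff
proof (intro allI impI)
  fix \<delta> :: real assume "0 < \<delta>"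
  then have "hausdorff_pre s \<delta> Y \<le> 0"
    using hausdorff_pre_mono[OF assms(1), of s \<delta>] assms(2) by (simp add: hausdorff_measure_0_iff)
  then show "hausdorff_pre s \<delta> Y = 0" by simp
qed

lemma hausdorff_measure_UN_0:
  assumes "\<And>n::nat. hausdorff_measure s (Y n) = 0"
  shows "hausdorff_measure s (\<Union>n. Y n) = 0"
  unfolding hausdorff_measure_0_iff
proof (intro allI impI)
  fix \<delta> :: real assume "0 < \<delta>"
  then have "hausdorff_pre s \<delta> (Y n) = 0" for n
    using assms by (simp add: hausdorff_measure_0_iff)
  then show "hausdorff_pre s \<delta> (\<Union>n. Y n) = 0"
    using hausdorff_pre_UN_le[of s \<delta> Y] by simp
qed

text \<open>A maximal \<eta>-separated set is a net. The balls of half the radius are disjoint, so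
  volume bounds its cardinality and also shows that a maximal one exists.\<close>

lemma finite_cball_net:
  assumes R: "0 \<le> R" and \<eta>: "0 < \<eta>" "\<eta> \<le> 1"
  shows "\<exists>S::'a::euclidean_space set. finite S \<and> cball 0 R \<subseteq> (\<Union>x\<in>S. cball x \<eta>) \<and>
    real (card S) * (\<eta> / 2) ^ DIM('a) \<le> (R + 1) ^ DIM('a)"
proof -
  define P where "P S \<longleftrightarrow> finite S \<and> S \<subseteq> cball 0 R \<and> (\<forall>x\<in>S. \<forall>y\<in>S. x \<noteq> y \<longrightarrow> \<eta> < dist x y)" for S :: "'a set"
  have card: "real (card S) * (\<eta> / 2) ^ DIM('a) \<le> (R + 1) ^ DIM('a)" if "P S" for S
  proof (rule card_disjoint_cballs[where c = "\<lambda>x. x" and ?x0.0 = 0])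
    show "cball v (\<eta> / 2) \<subseteq> cball 0 (R + 1)" if v: "v \<in> S" for v
    proof
      fix x assume "x \<in> cball v (\<eta> / 2)"
      moreover have "norm v \<le> R" using \<open>P S\<close> v by (auto simp: P_def)
      ultimately show "x \<in> cball 0 (R + 1)"
        using \<eta> norm_triangle_ineq[of v "x - v"] by (simp add: dist_norm norm_minus_commute)
    qed
    show "cball v (\<eta> / 2) \<inter> cball v' (\<eta> / 2) = {}" if "v \<in> S" "v' \<in> S" "v \<noteq> v'" for v v'
    proof -
      have "\<eta> < dist v v'" using that \<open>P S\<close> by (auto simp: P_def)
      then have False if "z \<in> cball v (\<eta> / 2)" "z \<in> cball v' (\<eta> / 2)" for z
        using that dist_triangle2[of v v' z] by simp
      then show ?thesis by blast
    qed
  qed (use R \<eta> \<open>P S\<close> in \<open>auto simp: P_def\<close>)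
  have "card S \<le> nat \<lfloor>(R + 1) ^ DIM('a) / (\<eta> / 2) ^ DIM('a)\<rfloor>" if "P S" for S
    using card[OF that] \<eta> by (intro le_nat_floor) (simp add: pos_le_divide_eq)
  then have "\<forall>S. P S \<longrightarrow> card S < Suc (nat \<lfloor>(R + 1) ^ DIM('a) / (\<eta> / 2) ^ DIM('a)\<rfloor>)"
    by (simp add: less_Suc_eq_le)
  moreover have "P {}" by (simp add: P_def)
  ultimately obtain S where S: "P S" and max: "\<And>T. P T \<Longrightarrow> card T \<le> card S"
    using ex_has_greatest_nat[of P "{}" card] by blast
  have "cball 0 R \<subseteq> (\<Union>x\<in>S. cball x \<eta>)"
  proof
    fix z :: 'a assume z: "z \<in> cball 0 R"
    show "z \<in> (\<Union>x\<in>S. cball x \<eta>)"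
    proof (rule ccontr)
      assume "z \<notin> (\<Union>x\<in>S. cball x \<eta>)"
      then have far: "\<forall>x\<in>S. \<eta> < dist x z" by auto
      then have "P (insert z S)" using S z by (auto simp: P_def dist_commute)
      moreover have "z \<notin> S" using far \<eta> by auto
      ultimately show False using max[of "insert z S"] S by (simp add: P_def)
    qed
  qed
  then show ?thesis using S card[OF S] by (intro exI[of _ S]) (auto simp: P_def)
qed

text \<open>The dimension is an infimum of real numbers and so needs a nonempty set of exponents.
  With DIM + 1 one factor \<eta> is left over after the covering number of a ball.\<close>

lemma hausdorff_measure_UNIV:
  "hausdorff_measure (real DIM('a) + 1) (UNIV :: 'a::euclidean_space set) = 0"
proof -
  let ?d = "DIM('a)"
  have "hausdorff_measure (real ?d + 1) (cball 0 (real R) :: 'a set) = 0" for R :: nat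
    unfolding hausdorff_measure_0_iff
  proof (intro allI impI)
    fix \<delta> :: real assume \<delta>: "0 < \<delta>"
    let ?c = "(real R + 1) ^ ?d * 4 ^ ?d * 2"
    have le: "hausdorff_pre (real ?d + 1) \<delta> (cball 0 (real R) :: 'a set) \<le> ennreal (?c * \<eta>)"
      if \<eta>: "0 < \<eta>" "\<eta> \<le> 1" "2 * \<eta> \<le> \<delta>" for \<eta>
    proof -
      obtain S :: "'a set" where S: "finite S" "cball 0 (real R) \<subseteq> (\<Union>x\<in>S. cball x \<eta>)"
        "real (card S) * (\<eta> / 2) ^ ?d \<le> (real R + 1) ^ ?d"
        using finite_cball_net[of "real R" \<eta>] \<eta> by auto
      have "hausdorff_pre (real ?d + 1) \<delta> (cball 0 (real R) :: 'a set)
          \<le> hausdorff_pre (real ?d + 1) \<delta> (\<Union>x\<in>S. cball x \<eta>)"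
        using S by (intro hausdorff_pre_mono)
      also have "\<dots> \<le> (\<Sum>x\<in>S. ennreal (diameter (cball x \<eta>) powr (real ?d + 1)))"
        using S \<eta> by (intro hausdorff_pre_finite_UN_le) auto
      also have "\<dots> = ennreal (real (card S) * (2 * \<eta>) ^ (?d + 1))"
        using \<eta> powr_realpow[of "2 * \<eta>" "?d + 1"]
        by (simp add: ennreal_of_nat_eq_real_of_nat ennreal_mult[symmetric] add.commute)
      also have "real (card S) * (2 * \<eta>) ^ (?d + 1)
          = (real (card S) * (\<eta> / 2) ^ ?d) * (4 ^ ?d * (2 * \<eta>))"
      proof -
        have "(2 * \<eta>) ^ ?d = (\<eta> / 2) ^ ?d * 4 ^ ?d"
          unfolding power_mult_distrib[symmetric] by simp
        then show ?thesis by (simp add: ac_simps)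
      qed
      also have "\<dots> \<le> (real R + 1) ^ ?d * (4 ^ ?d * (2 * \<eta>))"
        using S \<eta> by (intro mult_right_mono) auto
      finally show ?thesis by (simp add: ac_simps ennreal_leI)
    qed
    have "hausdorff_pre (real ?d + 1) \<delta> (cball 0 (real R) :: 'a set) \<le> 0 + ennreal e" if e: "0 < e" for e
    proof -
      define \<eta> where "\<eta> = min (min 1 (\<delta> / 2)) (e / ?c)"
      have c: "0 < ?c" by simp
      have \<eta>: "0 < \<eta>" "\<eta> \<le> 1" "2 * \<eta> \<le> \<delta>" using \<delta> e c by (auto simp: \<eta>_def)
      have "\<eta> \<le> e / ?c" by (simp add: \<eta>_def)
      then have "?c * \<eta> \<le> e" using c by (simp only: pos_le_divide_eq mult.commute)
      then show ?thesis using le[OF \<eta>] by (simp add: ennreal_leI order.trans)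
    qed
    then have "hausdorff_pre (real ?d + 1) \<delta> (cball 0 (real R) :: 'a set) \<le> 0"
      by (rule ennreal_le_epsilon)
    then show "hausdorff_pre (real ?d + 1) \<delta> (cball 0 (real R) :: 'a set) = 0" by simp
  qed
  then have "hausdorff_measure (real ?d + 1) (\<Union>R::nat. cball 0 (real R) :: 'a set) = 0"
    by (rule hausdorff_measure_UN_0)
  moreover have "(\<Union>R::nat. cball 0 (real R) :: 'a set) = UNIV"
    using real_arch_simple by auto
  ultimately show ?thesis by simp
qed

lemma hausdorff_dim_ge:
  fixes Y :: "'a::euclidean_space set"
  assumes "\<And>s. 0 < s \<Longrightarrow> s < t \<Longrightarrow> hausdorff_measure s Y \<noteq> 0"
  shows "t \<le> hausdorff_dim Y"
  unfolding hausdorff_dim_def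
proof (rule cInf_greatest)
  have "hausdorff_measure (real DIM('a) + 1) Y = 0"
    using hausdorff_measure_UNIV by (rule hausdorff_measure_0_mono[rotated]) simp
  then show "{s. 0 < s \<and> hausdorff_measure s Y = 0} \<noteq> {}"
    by (auto intro!: exI[of _ "real DIM('a) + 1"])
qed (use assms in \<open>force simp: not_less[symmetric]\<close>)

lemma hausdorff_dim_nonneg: "0 \<le> hausdorff_dim Y"
  by (rule hausdorff_dim_ge) auto

lemma hausdorff_dim_le: "0 < s \<Longrightarrow> hausdorff_measure s Y = 0 \<Longrightarrow> hausdorff_dim Y \<le> s"
  unfolding hausdorff_dim_def by (intro cInf_lower bdd_belowI[of _ 0]) auto

section \<open>Regular times\<close>

lemma birkhoff_mono:
  assumes "\<And>i x. i < k \<Longrightarrow> f i x \<le> g i x" "w \<in> words k n"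
  shows "birkhoff h f w x \<le> birkhoff h g w x"
  using assms(2)
proof (induction n arbitrary: w x)
  case (Suc n)
  from Suc.prems(1) obtain i v where w: "w = i # v" "i < k" "v \<in> words k n"
    by (rule words_SucE)
  show ?case
    using Suc.IH[OF w(3), of "h i x"] assms(1)[OF w(2), of x] by (simp add: w(1))
qed simp

context average_contraction
begin

definition mean :: "(nat \<Rightarrow> 'a \<Rightarrow> real) \<Rightarrow> real" where
  "mean f = (\<integral>x. (\<Sum>i<k. p i x * f i x) \<partial>\<nu>)"

lemma integrable_weighted_sum:
  assumes "\<And>i x. i < k \<Longrightarrow> \<bar>f i x\<bar> \<le> B" "\<And>i. i < k \<Longrightarrow> continuous_on UNIV (f i)"
  shows "integrable \<nu> (\<lambda>x. \<Sum>i<k. p i x * f i x)"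
proof (rule integrable_cont_bounded)
  show "continuous_on UNIV (\<lambda>x. \<Sum>i<k. p i x * f i x)"
    using assms p_cont by (intro continuous_on_sum continuous_on_mult) auto
  show "\<bar>\<Sum>i<k. p i x * f i x\<bar> \<le> B" for x
    using assms(1) by (rule weighted_sum_abs_le)
qed

lemma mean_le:
  assumes "\<And>i x. i < k \<Longrightarrow> \<bar>f i x\<bar> \<le> B" "\<And>i. i < k \<Longrightarrow> continuous_on UNIV (f i)"
    and "\<And>x. (\<Sum>i<k. p i x * f i x) \<le> c"
  shows "mean f \<le> c"
proof -
  have "mean f \<le> (\<integral>x. c \<partial>\<nu>)"
    unfolding mean_def using assms by (intro integral_mono integrable_weighted_sum) auto
  then show ?thesis using prob_space by simp
qed

lemma deviation:
  assumes f: "\<And>i x. i < k \<Longrightarrow> \<bar>f i x\<bar> \<le> B" "0 \<le> B"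
    and D: "\<And>i x y. i < k \<Longrightarrow> \<bar>f i x - f i y\<bar> \<le> D * dist x y powr q" "0 \<le> D"
  shows "\<exists>C \<gamma>. 0 < \<gamma> \<and> 0 \<le> C \<and> (\<forall>n j. \<forall>\<eta>>0. j \<le> n \<longrightarrow> n \<ge> 1 \<longrightarrow>
     path_prob j (\<lambda>w. {x. \<eta> * real n < \<bar>birkhoff h f w x - real j * mean f\<bar>})
       \<le> ennreal (C / \<eta>\<^sup>2 * real n powr (- \<gamma>)))"
proof -
  have cont: "continuous_on UNIV (f i)" if "i < k" for i
    using D(1)[OF that] q by (intro continuous_on_of_holder)
  have wb: "- B \<le> (\<Sum>i<k. p i x * f i x) \<and> (\<Sum>i<k. p i x * f i x) \<le> B" for x
  proof -
    have "\<bar>\<Sum>i<k. p i x * f i x\<bar> \<le> B" using f(1) by (rule weighted_sum_abs_le)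
    then show ?thesis by (simp add: abs_le_iff minus_le_iff)
  qed
  have mf: "\<bar>mean f\<bar> \<le> B"
  proof -
    have "\<bar>\<integral>x. (\<Sum>i<k. p i x * f i x) \<partial>\<nu>\<bar> \<le> (\<integral>x. \<bar>\<Sum>i<k. p i x * f i x\<bar> \<partial>\<nu>)"
      by (rule integral_abs_bound)
    also have "\<dots> \<le> (\<integral>x. B \<partial>\<nu>)"
      using wb integrable_weighted_sum[OF f(1) cont]
      by (intro integral_mono integrable_abs) (auto simp: abs_le_iff minus_le_iff)
    finally show ?thesis using prob_space by (simp add: mean_def)
  qed
  \<comment> \<open>The locale asks for a strictly positive bound while B may be 0, hence 2 B + 1
    instead of 2 B.\<close>
  interpret centered_observable k h p \<nu> \<delta> q \<rho> Cp "\<lambda>i x. f i x - mean f" "2 * B + 1" D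
  proof unfold_locales
    show "\<bar>f i x - mean f\<bar> \<le> 2 * B + 1" if "i < k" for i x
      using f(1)[OF that, of x] mf by linarith
    show "\<bar>f i x - mean f - (f i y - mean f)\<bar> \<le> D * dist x y powr q" if "i < k" for i x y
      using D(1)[OF that] by simp
    have "(\<Sum>i<k. p i x * (f i x - mean f)) = (\<Sum>i<k. p i x * f i x) - mean f" for x
      by (simp add: right_diff_distrib sum_subtractf sum_distrib_right[symmetric] p_sum)
    then show "(\<integral>x. (\<Sum>i<k. p i x * (f i x - mean f)) \<partial>\<nu>) = 0"
      using integrable_weighted_sum[OF f(1) cont] prob_space by (simp add: mean_def)
  qed (use f D in auto)
  obtain C \<gamma> where C: "0 < \<gamma>" "0 \<le> C" and dev: "\<And>n j \<eta>. 0 < \<eta> \<Longrightarrow> j \<le> n \<Longrightarrow> n \<ge> 1 \<Longrightarrow>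
     path_prob j (\<lambda>w. {x. \<eta> * real n < \<bar>birkhoff h (\<lambda>i x. f i x - mean f) w x\<bar>})
       \<le> ennreal (C / \<eta>\<^sup>2 * real n powr (- \<gamma>))"
    using deviation_bound by blast
  have "path_prob j (\<lambda>w. {x. \<eta> * real n < \<bar>birkhoff h f w x - real j * mean f\<bar>})
      \<le> ennreal (C / \<eta>\<^sup>2 * real n powr (- \<gamma>))" if "0 < \<eta>" "j \<le> n" "n \<ge> 1" for n j \<eta>
    by (rule order.trans[OF path_prob_mono dev[OF that]])
      (auto simp: birkhoff_diff_const length_words)
  then show ?thesis using C by blast
qed

lemma sets_deviation:
  assumes "\<And>i. i < k \<Longrightarrow> continuous_on UNIV (f i)" "w \<in> words k n"
  shows "{x. e < \<bar>birkhoff h f w x - c\<bar>} \<in> sets borel"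
proof -
  have [measurable]: "birkhoff h f w \<in> borel_measurable borel"
    using assms h_cont by (intro borel_measurable_continuous_onI continuous_on_birkhoff)
  show ?thesis by measurable
qed

text \<open>A penalty that is 0 on the ball of radius R and 1 beyond R + 1; it is bounded and
  Lipschitz so that the deviation estimates apply to it.\<close>

definition far :: "real \<Rightarrow> 'a \<Rightarrow> real" where
  "far R x = min 1 (max 0 (norm x - R))"

lemma far_bounds: "0 \<le> far R x" "far R x \<le> 1"
  by (auto simp: far_def)

lemma far_holder: "\<bar>far R x - far R y\<bar> \<le> 3 * dist x y powr q"
proof -
  have "\<bar>far R x - far R y\<bar> \<le> 1 * dist x y powr 1" for x y
    using norm_triangle_ineq3[of x y] by (auto simp: far_def dist_norm min_def max_def abs_le_iff)
  then have "\<bar>far R x - far R y\<bar> \<le> (2 * 1 + 1) * dist x y powr q"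
    using q far_bounds by (intro holder_of_bounded[where \<alpha> = 1]) (auto simp: abs_le_iff intro: order.trans[of _ 0])
  then show ?thesis by simp
qed

lemma far_cont: "continuous_on UNIV (far R)"
  using far_holder q by (intro continuous_on_of_holder)

lemma integral_far_small:
  assumes "0 < e" shows "\<exists>R>0. (\<integral>x. far R x \<partial>\<nu>) < e"
proof -
  have "(\<lambda>n. \<integral>x. far (real n) x \<partial>\<nu>) \<longlonglongrightarrow> (\<integral>x. 0 \<partial>\<nu>)"
  proof (rule integral_dominated_convergence[where w = "\<lambda>_. 1"])
    show "AE x in \<nu>. (\<lambda>n. far (real n) x) \<longlonglongrightarrow> 0"
    proof (intro AE_I2 tendsto_eventually)
      fix x
      show "\<forall>\<^sub>F n in sequentially. far (real n) x = 0"
        using eventually_ge_at_top[of "nat \<lceil>norm x\<rceil>"]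
        by eventually_elim (auto simp: far_def nat_ceiling_le_eq)
    qed
    show "AE x in \<nu>. norm (far (real n) x) \<le> 1" for n
      using far_bounds by (intro AE_I2) auto
    show "far (real n) \<in> borel_measurable \<nu>" for n
      using borel_measurable_continuous_onI[OF far_cont] by (simp cong: measurable_cong_sets)
  qed auto
  then have "(\<lambda>n. \<integral>x. far (real n) x \<partial>\<nu>) \<longlonglongrightarrow> 0" by simp
  then have "\<forall>\<^sub>F n in sequentially. (\<integral>x. far (real n) x \<partial>\<nu>) < e"
    using assms by (rule order_tendstoD)
  then have "\<forall>\<^sub>F n in sequentially. (\<integral>x. far (real n) x \<partial>\<nu>) < e \<and> 0 < n"
    using eventually_gt_at_top by (rule eventually_conj)
  then obtain n where "(\<integral>x. far (real n) x \<partial>\<nu>) < e" "0 < n"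
    using eventually_happens by fastforce
  then show ?thesis by (intro exI[of _ "real n"]) auto
qed

end

text \<open>\<open>L\<close> stands for the logarithm of the derivative, of which only its bounds
  and its negative mean matter in the search for regular times.\<close>

locale lyapunov_ifs = average_contraction k h p \<nu> \<delta> q \<rho> Cp
  for k and h :: "nat \<Rightarrow> 'a::euclidean_space \<Rightarrow> 'a" and p \<nu> \<delta> q \<rho> Cp +
  fixes L :: "nat \<Rightarrow> 'a \<Rightarrow> real" and BL DL :: real
  assumes BL: "0 \<le> BL" "\<And>i x. i < k \<Longrightarrow> \<bar>L i x\<bar> \<le> BL"
    and DL: "0 \<le> DL" "\<And>i x y. i < k \<Longrightarrow> \<bar>L i x - L i y\<bar> \<le> DL * dist x y powr q"
    and mean_neg: "mean L < 0"
begin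

definition lp :: "nat \<Rightarrow> 'a \<Rightarrow> real" where "lp i x = ln (p i x)"

definition Bp where "Bp = - ln \<delta>"

lemma Bp: "0 \<le> Bp" using \<delta> by (simp add: Bp_def)

lemma lp_le: "i < k \<Longrightarrow> \<bar>lp i x\<bar> \<le> Bp"
  using p_ge[of i x] p_le[of i x] p_pos[of i x] \<delta> by (simp add: lp_def Bp_def abs_if)

lemma lp_holder: "i < k \<Longrightarrow> \<bar>lp i x - lp i y\<bar> \<le> Cp / \<delta> * dist x y powr q"
proof -
  assume i: "i < k"
  have *: "ln (p i x) - ln (p i y) \<le> Cp / \<delta> * dist x y powr q" for x y
  proof -
    have "ln (p i x) - ln (p i y) \<le> (p i x - p i y) / p i y"
      using p_pos[OF i] ln_diff_le by blast
    also have "\<dots> \<le> \<bar>p i x - p i y\<bar> / p i y"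
      using p_pos[OF i] by (intro divide_right_mono) (auto simp: less_imp_le)
    also have "\<dots> \<le> (Cp * dist x y powr q) / \<delta>"
      using p_ge[OF i] \<delta> p_holder[OF i] Cp by (intro frac_le mult_nonneg_nonneg) auto
    finally show ?thesis by simp
  qed
  show ?thesis using *[of x y] *[of y x] by (simp add: lp_def dist_commute abs_le_iff)
qed

lemma L_cont: "i < k \<Longrightarrow> continuous_on UNIV (L i)"
  using DL(2) q by (intro continuous_on_of_holder)

lemma lp_cont: "i < k \<Longrightarrow> continuous_on UNIV (lp i)"
  using lp_holder q by (intro continuous_on_of_holder)

text \<open>Here n is the length of the whole word, whereas v is only what follows the regular time;
  the missing prefix is short enough to be absorbed by \<epsilon> n. The first condition is the one
  that makes a ball of radius r0 \<open>controlled\<close> along v; the other two fix contraction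
  and weight up to exp(\<epsilon> n).\<close>

definition regular :: "real \<Rightarrow> nat \<Rightarrow> nat list \<Rightarrow> 'a \<Rightarrow> bool" where
  "regular \<epsilon> n v y \<longleftrightarrow> (\<forall>l\<le>length v. birkhoff h L (take l v) y + \<epsilon> * real l \<le> 0) \<and>
     \<bar>birkhoff h L v y - real n * mean L\<bar> \<le> \<epsilon> * real n \<and>
     \<bar>birkhoff h lp v y - real n * mean lp\<bar> \<le> \<epsilon> * real n"

text \<open>The regular time \<^term>\<open>\<tau>\<close> maximises the partial Birkhoff sums of the penalised observable
  \<^term>\<open>\<lambda>i x. L i x + \<epsilon> + (BL + 1) * far R x\<close>: since all sums starting at \<^term>\<open>\<tau>\<close> are nonpositive, so is
  the summand at time \<^term>\<open>\<tau>\<close>, and the penalty forces the orbit to be near the origin.\<close>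

lemma regular_time:
  assumes \<epsilon>: "0 < \<epsilon>" and R: "0 < R"
    and neg: "mean (\<lambda>i x. L i x + \<epsilon> + (BL + 1) * far R x) = - c" "0 < c"
    and \<theta>: "0 < \<theta>" "\<theta> \<le> 1" "\<eta> + \<theta> * BL \<le> \<epsilon>" "\<eta> + \<theta> * Bp \<le> \<epsilon>"
    and g: "0 < g" "\<eta> + (c + (2 * BL + \<epsilon> + 1)) / real g < \<theta> * c"
    and n: "g \<le> n" and w: "w \<in> words k n"
    and dev: "\<And>j. j \<le> 2 * g \<Longrightarrow> j * (n div g) \<le> n \<Longrightarrow>
      \<bar>birkhoff h (\<lambda>i x. L i x + \<epsilon> + (BL + 1) * far R x) (take (j * (n div g)) w) x
        + real (j * (n div g)) * c\<bar> \<le> \<eta> * real n"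
    and devL: "\<bar>birkhoff h L w x - real n * mean L\<bar> \<le> \<eta> * real n"
    and devp: "\<bar>birkhoff h lp w x - real n * mean lp\<bar> \<le> \<eta> * real n"
  shows "\<exists>\<tau>\<le>n. real \<tau> \<le> \<theta> * real n \<and> norm (orbit h (take \<tau> w) x) \<le> R + 1 \<and>
    regular \<epsilon> n (drop \<tau> w) (orbit h (take \<tau> w) x)"
proof -
  define a where "a i x = L i x + \<epsilon> + (BL + 1) * far R x" for i x
  define Ba where "Ba = 2 * BL + \<epsilon> + 1"
  define A where "A t = birkhoff h a (take t w) x" for t
  have a_le: "\<bar>a i y\<bar> \<le> Ba" if "i < k" for i y
  proof -
    have "0 \<le> (BL + 1) * far R y" "(BL + 1) * far R y \<le> (BL + 1) * 1"
      using far_bounds[of R y] BL by (auto intro!: mult_left_mono)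
    then show ?thesis
      using BL(2)[OF that, of y] BL(1) \<epsilon> unfolding a_def Ba_def abs_le_iff mult_1_right by linarith
  qed
  have n0: "0 < n" using g n by simp
  define s where "s = n div g"
  have s: "0 < s" using g n by (simp add: s_def div_greater_zero_iff)
  have sn: "real s \<le> real n / real g" unfolding s_def by (rule of_nat_div_le_of_nat)
  \<comment> \<open>Deviations are controlled only at multiples of s = n div g. Going back from t to
    the last multiple costs at most s Ba, and g is so large that the drift c accumulated by the time
    \<theta> n outweighs it.\<close>
  have late: "A t < 0" if t: "\<theta> * real n \<le> real t" "t \<le> n" for t
  proof -
    define j where "j = t div s"
    have jt: "j * s \<le> t" "t < j * s + s"
      using s by (simp_all add: j_def div_times_less_eq_dividend dividend_less_div_times add.commute)
    \<comment> \<open>Since s >= 1, n < (s + 1) g <= 2 g s, so the multiples in question have index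
      at most 2 g.\<close>
    have "n < Suc s * g" unfolding s_def using g by (simp add: dividend_less_div_times)
    also have "\<dots> \<le> (2 * g) * s" using s by (cases s) (auto simp: algebra_simps)
    finally have "j \<le> 2 * g"
      using t(2) s unfolding j_def by (metis div_le_mono div_mult_self_is_m le_trans less_imp_le_nat)
    then have "\<bar>A (j * s) + real (j * s) * c\<bar> \<le> \<eta> * real n"
      using dev[of j] jt t by (simp add: A_def a_def[abs_def] s_def)
    then have "A (j * s) \<le> \<eta> * real n - real (j * s) * c" by linarith
    moreover have "\<bar>A t - A (j * s)\<bar> \<le> real (t - j * s) * Ba"
      unfolding A_def using a_le w jt t by (intro birkhoff_step_le) auto
    moreover have "real (t - j * s) * Ba \<le> real s * Ba"
    proof (rule mult_right_mono)
      have "t - j * s \<le> s" using jt by simp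
      then show "real (t - j * s) \<le> real s" by (simp only: of_nat_le_iff)
    qed (use BL \<epsilon> in \<open>simp add: Ba_def\<close>)
    moreover have "(real t - real s) * c \<le> real (j * s) * c"
    proof (rule mult_right_mono)
      have "real t \<le> real (j * s + s)" using jt(2) by (simp only: of_nat_le_iff less_imp_le)
      then show "real t - real s \<le> real (j * s)" unfolding of_nat_add by linarith
    qed (use neg in simp)
    ultimately have "A t \<le> \<eta> * real n - real t * c + real s * (c + Ba)"
      by (simp add: algebra_simps)
    also have "\<dots> \<le> \<eta> * real n - \<theta> * real n * c + real n / real g * (c + Ba)"
      using t sn neg BL \<epsilon>
      by (intro add_mono diff_mono mult_right_mono order_refl) (auto simp: Ba_def)
    also have "\<dots> = real n * (\<eta> + (c + Ba) / real g - \<theta> * c)" by (simp add: algebra_simps)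
    also have "\<dots> < 0" using n0 g by (intro mult_pos_neg) (auto simp: Ba_def)
    finally show ?thesis .
  qed
  obtain \<tau> where \<tau>: "\<tau> \<le> n" and max: "\<And>t. t \<le> n \<Longrightarrow> A t \<le> A \<tau>"
  proof -
    have "Max (A ` {..n}) \<in> A ` {..n}" by (intro Max_in) auto
    then obtain t where t: "t \<le> n" "A t = Max (A ` {..n})"
      by (metis (no_types, lifting) atMost_iff imageE)
    then show ?thesis by (intro that[of t]) auto
  qed
  \<comment> \<open>The empty prefix has sum 0; the maximum is therefore nonnegative and cannot be
    attained after the time \<theta> n.\<close>
  have "0 \<le> A \<tau>" using max[of 0] by (simp add: A_def)
  then have \<tau>\<theta>: "real \<tau> < \<theta> * real n" using late[OF _ \<tau>] by linarith
  then have \<tau>n: "\<tau> < n"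
    using mult_right_mono[OF \<theta>(2) of_nat_0_le_iff[of n]] by simp
  let ?y = "orbit h (take \<tau> w) x" and ?v = "drop \<tau> w"
  have v: "?v \<in> words k (n - \<tau>)" and u: "take \<tau> w \<in> words k \<tau>"
    using w \<tau> by (auto intro: drop_words take_words)
  have sums: "birkhoff h a (take l ?v) ?y \<le> 0" if "l \<le> length ?v" for l
  proof -
    have "take (\<tau> + l) w = take \<tau> w @ take l ?v" by (simp add: take_add)
    then have "A (\<tau> + l) = A \<tau> + birkhoff h a (take l ?v) ?y"
      by (simp add: A_def birkhoff_append)
    moreover have "\<tau> + l \<le> n" using that \<tau> length_words[OF w] by simp
    ultimately show ?thesis using max[of "\<tau> + l"] by simp
  qed
  have ctrl: "birkhoff h L (take l ?v) ?y + \<epsilon> * real l \<le> 0" if l: "l \<le> length ?v" for l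
  proof -
    have lw: "take l ?v \<in> words k l"
      using v l length_words[OF v] by (auto intro: take_words)
    have "birkhoff h (\<lambda>i x. L i x - (- \<epsilon>)) (take l ?v) ?y \<le> birkhoff h a (take l ?v) ?y"
      using lw far_bounds BL by (intro birkhoff_mono) (auto simp: a_def)
    then show ?thesis
      using sums[OF l] length_words[OF lw] unfolding birkhoff_diff_const by (simp add: mult.commute)
  qed
  have "norm ?y \<le> R + 1"
  proof (rule ccontr)
    assume "\<not> norm ?y \<le> R + 1"
    then have "far R ?y = 1" by (simp add: far_def)
    moreover have "take 1 ?v = [w ! \<tau>]"
      using \<tau>n length_words[OF w] by (simp add: take_Suc hd_drop_conv_nth)
    then have "a (w ! \<tau>) ?y \<le> 0" using sums[of 1] \<tau>n length_words[OF w] by simp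
    ultimately show False
      using BL(2)[OF nth_words[OF w \<tau>n], of ?y] \<epsilon> by (auto simp: a_def)
  qed
  \<comment> \<open>Cutting off at most \<theta> n letters changes a sum by at most \<theta> B' n,
    which turns the tolerance \<eta> into \<epsilon>.\<close>
  moreover have tail: "\<bar>birkhoff h f ?v ?y - real n * m\<bar> \<le> \<epsilon> * real n"
    if f: "\<And>i x. i < k \<Longrightarrow> \<bar>f i x\<bar> \<le> B'" and B': "\<eta> + \<theta> * B' \<le> \<epsilon>" "0 \<le> B'"
      and d: "\<bar>birkhoff h f w x - real n * m\<bar> \<le> \<eta> * real n" for f B' m
  proof -
    have "birkhoff h f w x = birkhoff h f (take \<tau> w) x + birkhoff h f ?v ?y"
      by (metis append_take_drop_id birkhoff_append)
    moreover have "\<bar>birkhoff h f (take \<tau> w) x\<bar> \<le> real \<tau> * B'"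
      by (rule birkhoff_abs_le[OF f u])
    moreover have "real \<tau> * B' \<le> (\<theta> * real n) * B'"
      using \<tau>\<theta> B' by (intro mult_right_mono) auto
    moreover have "(\<eta> + \<theta> * B') * real n \<le> \<epsilon> * real n"
      using B' by (intro mult_right_mono) auto
    ultimately show ?thesis using d by (simp add: algebra_simps)
  qed
  ultimately show ?thesis
    using \<tau> \<tau>\<theta> ctrl tail[OF BL(2) \<theta>(3) BL(1) devL] tail[OF lp_le \<theta>(4) Bp devp]
    unfolding regular_def by (intro exI[of _ \<tau>]) auto
qed

end

context average_contraction
begin

lemma deviationE:
  assumes "\<And>i x. i < k \<Longrightarrow> \<bar>f i x\<bar> \<le> B" "0 \<le> B"
    and "\<And>i x y. i < k \<Longrightarrow> \<bar>f i x - f i y\<bar> \<le> D * dist x y powr q" "0 \<le> D" and \<eta>: "0 < \<eta>"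
  obtains C \<gamma> where "0 < \<gamma>" "0 \<le> C" "\<And>n j. j \<le> n \<Longrightarrow> n \<ge> 1 \<Longrightarrow>
     path_prob j (\<lambda>w. {x. \<eta> * real n < \<bar>birkhoff h f w x - real j * mean f\<bar>})
       \<le> ennreal (C * real n powr (- \<gamma>))"
proof -
  have "\<exists>C \<gamma>. 0 < \<gamma> \<and> 0 \<le> C \<and> (\<forall>n j. \<forall>\<eta>>0. j \<le> n \<longrightarrow> n \<ge> 1 \<longrightarrow>
     path_prob j (\<lambda>w. {x. \<eta> * real n < \<bar>birkhoff h f w x - real j * mean f\<bar>})
       \<le> ennreal (C / \<eta>\<^sup>2 * real n powr (- \<gamma>)))"
    using assms by (intro deviation)
  then obtain C \<gamma> where C: "0 < \<gamma>" "0 \<le> C"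
    and dev: "\<forall>n j. \<forall>\<eta>>0. j \<le> n \<longrightarrow> n \<ge> 1 \<longrightarrow>
     path_prob j (\<lambda>w. {x. \<eta> * real n < \<bar>birkhoff h f w x - real j * mean f\<bar>})
       \<le> ennreal (C / \<eta>\<^sup>2 * real n powr (- \<gamma>))" by (elim exE conjE)
  show thesis
  proof (rule that[of \<gamma> "C / \<eta>\<^sup>2"])
    show "0 \<le> C / \<eta>\<^sup>2" using C by simp
    fix n j :: nat assume "j \<le> n" "n \<ge> 1"
    then show "path_prob j (\<lambda>w. {x. \<eta> * real n < \<bar>birkhoff h f w x - real j * mean f\<bar>})
       \<le> ennreal (C / \<eta>\<^sup>2 * real n powr (- \<gamma>))"
      by (intro dev[rule_format] \<eta>)
  qed (rule C)
qed

end

context lyapunov_ifs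
begin

lemma lp_mean_nonpos: "mean lp \<le> 0"
proof (rule mean_le[OF lp_le lp_cont])
  show "(\<Sum>i<k. p i x * lp i x) \<le> 0" for x
    using p_pos p_le by (intro sum_nonpos mult_nonneg_nonpos) (auto simp: lp_def less_imp_le)
qed

lemma mult_powr_neg_mono:
  fixes \<eta> \<gamma> C :: real
  assumes "0 < \<gamma>" "0 \<le> C" "\<gamma>' \<le> \<gamma>" "C \<le> C'" "n \<ge> (1::nat)"
  shows "C * real n powr (- \<gamma>) \<le> C' * real n powr (- \<gamma>')"
  using assms by (intro mult_mono powr_mono) auto

text \<open>The parameters are chosen in the order R, c, \<theta>, \<eta>, g, and none depends on n.
  At most 2 g + 3 deviation events are excluded, however long the word is, so the polynomial rate
  survives.\<close>

lemma regular_times: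
  assumes \<epsilon>: "0 < \<epsilon>" "4 * \<epsilon> \<le> - mean L"
  shows "\<exists>R C \<gamma> N Bad. 0 < R \<and> 0 \<le> C \<and> 0 < \<gamma> \<and> 1 \<le> N \<and>
    (\<forall>n w. w \<in> words k n \<longrightarrow> Bad n w \<in> sets borel) \<and>
    (\<forall>n\<ge>N. path_prob n (Bad n) \<le> ennreal (C * real n powr (- \<gamma>))) \<and>
    (\<forall>n\<ge>N. \<forall>w\<in>words k n. \<forall>x. x \<notin> Bad n w \<longrightarrow>
      (\<exists>\<tau>\<le>n. norm (orbit h (take \<tau> w) x) \<le> R \<and> regular \<epsilon> n (drop \<tau> w) (orbit h (take \<tau> w) x)))"
proof -
  have BLp: "0 < BL + 1" using BL by simp
  \<comment> \<open>The penalty carries the factor BL + 1, so this R makes it cost less than a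
    quarter of - mean L; \<epsilon> costs at most another quarter, and the penalised mean is still
    negative.\<close>
  have "0 < - mean L / (4 * (BL + 1))" using BLp mean_neg by (intro divide_pos_pos) auto
  then obtain R where R: "0 < R" and far: "(\<integral>x. far R x \<partial>\<nu>) < - mean L / (4 * (BL + 1))"
    using integral_far_small by blast
  define a where "a i x = L i x + \<epsilon> + (BL + 1) * far R x" for i x
  define c where "c = - mean a"
  have i_far: "integrable \<nu> (far R)"
    using far_cont far_bounds by (intro integrable_cont_bounded[where B = 1]) auto
  have "mean a = mean L + \<epsilon> + (BL + 1) * (\<integral>x. far R x \<partial>\<nu>)"
  proof -
    have "(\<Sum>i<k. p i x * a i x) = (\<Sum>i<k. p i x * L i x) + \<epsilon> + (BL + 1) * far R x" for x
    proof -
      have "(\<Sum>i<k. p i x * a i x) = (\<Sum>i<k. p i x * L i x) + (\<Sum>i<k. p i x) * (\<epsilon> + (BL + 1) * far R x)"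
        unfolding a_def sum_distrib_right sum.distrib[symmetric]
        by (intro sum.cong) (simp_all add: algebra_simps)
      then show ?thesis by (simp add: p_sum)
    qed
    then show ?thesis
      using i_far integrable_weighted_sum[OF BL(2) L_cont] prob_space by (simp add: mean_def)
  qed
  moreover have "(BL + 1) * (\<integral>x. far R x \<partial>\<nu>) < - mean L / 4"
    using far BLp by (simp add: field_simps)
  ultimately have c: "0 < c" using \<epsilon> mean_neg by (simp add: c_def)
  have neg: "mean a = - c" by (simp add: c_def)
  define \<theta> where "\<theta> = min 1 (\<epsilon> / (2 * (BL + Bp + 1)))"
  have BB: "0 < BL + Bp + 1" using BL Bp by simp
  have \<theta>: "0 < \<theta>" "\<theta> \<le> 1" using \<epsilon> BB by (auto simp: \<theta>_def)
  have "\<theta> \<le> \<epsilon> / (2 * (BL + Bp + 1))" by (simp add: \<theta>_def)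
  moreover have "0 < 2 * (BL + Bp + 1)" using BB by simp
  ultimately have "\<theta> * (2 * (BL + Bp + 1)) \<le> \<epsilon>" by (simp only: pos_le_divide_eq)
  then have \<theta>B: "\<theta> * (BL + Bp + 1) \<le> \<epsilon> / 2" by (simp add: algebra_simps)
  have "\<theta> * BL \<le> \<theta> * (BL + Bp + 1)" "\<theta> * Bp \<le> \<theta> * (BL + Bp + 1)"
    using \<theta> BL Bp by (intro mult_left_mono; simp)+
  then have \<theta>1: "\<theta> * BL \<le> \<epsilon> / 2" "\<theta> * Bp \<le> \<epsilon> / 2" using \<theta>B by linarith+
  define \<eta> where "\<eta> = min (\<epsilon> / 2) (\<theta> * c / 4)"
  have \<eta>: "0 < \<eta>" "\<eta> \<le> \<epsilon> / 2" "\<eta> \<le> \<theta> * c / 4" using \<epsilon> \<theta> c by (auto simp: \<eta>_def)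
  obtain g :: nat where g: "(c + (2 * BL + \<epsilon> + 1)) / (\<theta> * c / 4) < real g"
    using reals_Archimedean2 by blast
  have tc: "0 < \<theta> * c / 4" using \<theta> c by simp
  have g0: "0 < g"
  proof -
    have "0 \<le> (c + (2 * BL + \<epsilon> + 1)) / (\<theta> * c / 4)" using tc c BL \<epsilon> by simp
    then show ?thesis using g by linarith
  qed
  have "(c + (2 * BL + \<epsilon> + 1)) / real g < \<theta> * c / 4"
    using g g0 tc by (simp only: pos_divide_less_eq of_nat_0_less_iff mult.commute)
  then have g1: "\<eta> + (c + (2 * BL + \<epsilon> + 1)) / real g < \<theta> * c" using \<eta> tc by linarith
  have a_le: "\<bar>a i y\<bar> \<le> 2 * BL + \<epsilon> + 1" if "i < k" for i y
  proof -
    have "0 \<le> (BL + 1) * far R y" "(BL + 1) * far R y \<le> (BL + 1) * 1"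
      using far_bounds[of R y] BL by (auto intro!: mult_left_mono)
    then show ?thesis
      using BL(2)[OF that, of y] BL(1) \<epsilon> unfolding a_def abs_le_iff mult_1_right by linarith
  qed
  have a_holder: "\<bar>a i x - a i y\<bar> \<le> (DL + (BL + 1) * 3) * dist x y powr q" if "i < k" for i x y
  proof -
    have "\<bar>(BL + 1) * far R x - (BL + 1) * far R y\<bar> \<le> (BL + 1) * (3 * dist x y powr q)"
      unfolding right_diff_distrib[symmetric] abs_mult using BL far_holder[of R x y]
      by (intro mult_mono) auto
    then show ?thesis
      using DL(2)[OF that, of x y] unfolding a_def distrib_right mult.assoc abs_le_iff by linarith
  qed
  have nn: "0 \<le> 2 * BL + \<epsilon> + 1" "0 \<le> DL + (BL + 1) * 3" "0 \<le> Cp / \<delta>"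
    using BL DL \<epsilon> Cp \<delta> by auto
  obtain C1 \<gamma>1 where 1: "0 < \<gamma>1" "0 \<le> C1" "\<And>n j. j \<le> n \<Longrightarrow> n \<ge> 1 \<Longrightarrow>
     path_prob j (\<lambda>w. {x. \<eta> * real n < \<bar>birkhoff h a w x - real j * mean a\<bar>})
       \<le> ennreal (C1 * real n powr (- \<gamma>1))"
    by (rule deviationE[where f = a and \<eta> = \<eta>, OF a_le nn(1) a_holder nn(2) \<eta>(1)]) (assumption | rule that)+
  obtain C2 \<gamma>2 where 2: "0 < \<gamma>2" "0 \<le> C2" "\<And>n j. j \<le> n \<Longrightarrow> n \<ge> 1 \<Longrightarrow>
     path_prob j (\<lambda>w. {x. \<eta> * real n < \<bar>birkhoff h L w x - real j * mean L\<bar>})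
       \<le> ennreal (C2 * real n powr (- \<gamma>2))"
    by (rule deviationE[where f = L and \<eta> = \<eta>, OF BL(2) BL(1) DL(2) DL(1) \<eta>(1)]) (assumption | rule that)+
  obtain C3 \<gamma>3 where 3: "0 < \<gamma>3" "0 \<le> C3" "\<And>n j. j \<le> n \<Longrightarrow> n \<ge> 1 \<Longrightarrow>
     path_prob j (\<lambda>w. {x. \<eta> * real n < \<bar>birkhoff h lp w x - real j * mean lp\<bar>})
       \<le> ennreal (C3 * real n powr (- \<gamma>3))"
    by (rule deviationE[where f = lp and \<eta> = \<eta>, OF lp_le Bp lp_holder nn(3) \<eta>(1)]) (assumption | rule that)+
  define \<gamma> where "\<gamma> = min \<gamma>1 (min \<gamma>2 \<gamma>3)"
  have \<gamma>: "0 < \<gamma>" using 1 2 3 by (simp add: \<gamma>_def)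
  define C where "C = real (2 * g + 1) * C1 + C2 + C3"
  have C0: "0 \<le> C1" "0 \<le> C2" "0 \<le> C3" using 1 2 3 by auto
  have C: "0 \<le> C" unfolding C_def using C0 by (intro add_nonneg_nonneg mult_nonneg_nonneg) auto
  define B1 where "B1 n j w = {x. \<eta> * real n < \<bar>birkhoff h a (take (j * (n div g)) w) x
      - real (j * (n div g)) * mean a\<bar>}" for n j w
  define Jn where "Jn n = {j. j \<le> 2 * g \<and> j * (n div g) \<le> n}" for n
  define B2 where "B2 n w = {x. \<eta> * real n < \<bar>birkhoff h L w x - real n * mean L\<bar>}" for n w
  define B3 where "B3 n w = {x. \<eta> * real n < \<bar>birkhoff h lp w x - real n * mean lp\<bar>}" for n w
  define Bad where "Bad n w = (\<Union>j\<in>Jn n. B1 n j w) \<union> (B2 n w \<union> B3 n w)" for n w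
  have finJ: "finite (Jn n)" and cardJ: "card (Jn n) \<le> 2 * g + 1" for n
  proof -
    have sub: "Jn n \<subseteq> {..2 * g}" by (auto simp: Jn_def)
    show "finite (Jn n)" using finite_subset[OF sub] by simp
    show "card (Jn n) \<le> 2 * g + 1" using card_mono[OF _ sub] by simp
  qed
  have a_cont: "continuous_on UNIV (a i)" if "i < k" for i
    using a_holder[OF that] q by (intro continuous_on_of_holder)
  have m1: "B1 n j w \<in> sets borel" if "w \<in> words k n" "j \<in> Jn n" for n j w
    unfolding B1_def using that a_cont take_words[OF that(1)]
    by (intro sets_deviation[where n = "j * (n div g)"]) (auto simp: Jn_def)
  have m2: "B2 n w \<in> sets borel" "B3 n w \<in> sets borel" if "w \<in> words k n" for n w
    unfolding B2_def B3_def using that L_cont lp_cont by (auto intro!: sets_deviation)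
  have mU: "(\<Union>j\<in>Jn n. B1 n j w) \<in> sets borel" if "w \<in> words k n" for n w
    using m1[OF that] finJ by (intro sets.finite_UN) auto
  have meas: "Bad n w \<in> sets borel" if "w \<in> words k n" for n w
    unfolding Bad_def using mU[OF that] m2[OF that] by (intro sets.Un)
  have prob: "path_prob n (Bad n) \<le> ennreal (C * real n powr (- \<gamma>))" if n: "n \<ge> g" for n
  proof -
    have n1: "n \<ge> 1" using n g0 by simp
    have p1: "path_prob n (B1 n j) \<le> ennreal (C1 * real n powr (- \<gamma>))" if j: "j \<in> Jn n" for j
    proof -
      let ?m = "j * (n div g)"
      have mn: "?m \<le> n" using j by (simp add: Jn_def)
      then have "path_prob n (B1 n j) = path_prob ?m (\<lambda>w. {x. \<eta> * real n < \<bar>birkhoff h a w x - real ?m * mean a\<bar>})"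
        using path_prob_prefix[of ?m "n - ?m" "\<lambda>w. {x. \<eta> * real n < \<bar>birkhoff h a w x - real ?m * mean a\<bar>}"]
        by (simp add: B1_def[abs_def])
      also have "\<dots> \<le> ennreal (C1 * real n powr (- \<gamma>1))" by (rule 1(3)[OF mn n1])
      also have "\<dots> \<le> ennreal (C1 * real n powr (- \<gamma>))"
        using 1 C0 n1 by (intro ennreal_leI mult_powr_neg_mono) (auto simp: \<gamma>_def)
      finally show ?thesis .
    qed
    have p2: "path_prob n (B2 n) \<le> ennreal (C2 * real n powr (- \<gamma>))"
    proof -
      have "path_prob n (B2 n) \<le> ennreal (C2 * real n powr (- \<gamma>2))"
        unfolding B2_def by (rule 2(3)) (use n1 in auto)
      also have "\<dots> \<le> ennreal (C2 * real n powr (- \<gamma>))"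
        using 2 C0 n1 by (intro ennreal_leI mult_powr_neg_mono) (auto simp: \<gamma>_def)
      finally show ?thesis .
    qed
    have p3: "path_prob n (B3 n) \<le> ennreal (C3 * real n powr (- \<gamma>))"
    proof -
      have "path_prob n (B3 n) \<le> ennreal (C3 * real n powr (- \<gamma>3))"
        unfolding B3_def by (rule 3(3)) (use n1 in auto)
      also have "\<dots> \<le> ennreal (C3 * real n powr (- \<gamma>))"
        using 3 C0 n1 by (intro ennreal_leI mult_powr_neg_mono) (auto simp: \<gamma>_def)
      finally show ?thesis .
    qed
    have "path_prob n (\<lambda>w. \<Union>j\<in>Jn n. B1 n j w) \<le> (\<Sum>j\<in>Jn n. path_prob n (B1 n j))"
      using finJ m1 by (intro path_prob_UN_le)
    also have "\<dots> \<le> (\<Sum>j\<in>Jn n. ennreal (C1 * real n powr (- \<gamma>)))"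
      using p1 by (rule sum_mono)
    also have "\<dots> = ennreal (real (card (Jn n)) * (C1 * real n powr (- \<gamma>)))"
      using C0 by (simp add: ennreal_of_nat_eq_real_of_nat ennreal_mult[symmetric])
    also have "\<dots> \<le> ennreal (real (2 * g + 1) * (C1 * real n powr (- \<gamma>)))"
      using cardJ C0 by (intro ennreal_leI mult_right_mono) (auto simp only: of_nat_le_iff powr_ge_zero intro!: mult_nonneg_nonneg)
    finally have pU: "path_prob n (\<lambda>w. \<Union>j\<in>Jn n. B1 n j w) \<le> ennreal (real (2 * g + 1) * (C1 * real n powr (- \<gamma>)))" .
    have "path_prob n (Bad n) \<le> path_prob n (\<lambda>w. \<Union>j\<in>Jn n. B1 n j w) + path_prob n (\<lambda>w. B2 n w \<union> B3 n w)"
      unfolding Bad_def using mU m2 by (intro path_prob_Un_le sets.Un)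
    also have "path_prob n (\<lambda>w. B2 n w \<union> B3 n w) \<le> path_prob n (B2 n) + path_prob n (B3 n)"
      using m2 by (intro path_prob_Un_le)
    finally have "path_prob n (Bad n) \<le> ennreal (real (2 * g + 1) * (C1 * real n powr (- \<gamma>)))
        + (ennreal (C2 * real n powr (- \<gamma>)) + ennreal (C3 * real n powr (- \<gamma>)))"
      using add_mono[OF pU add_mono[OF p2 p3]] by (meson add_left_mono order.trans)
    also have "\<dots> = ennreal (C * real n powr (- \<gamma>))"
      unfolding C_def distrib_right using C0
      by (subst ennreal_plus[symmetric] | simp add: mult.assoc)+
    finally show ?thesis .
  qed
  have good: "\<exists>\<tau>\<le>n. norm (orbit h (take \<tau> w) x) \<le> R + 1 \<and> regular \<epsilon> n (drop \<tau> w) (orbit h (take \<tau> w) x)"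
    if n: "n \<ge> g" and w: "w \<in> words k n" and x: "x \<notin> Bad n w" for n w x
  proof -
    have "\<exists>\<tau>\<le>n. real \<tau> \<le> \<theta> * real n \<and> norm (orbit h (take \<tau> w) x) \<le> R + 1 \<and>
        regular \<epsilon> n (drop \<tau> w) (orbit h (take \<tau> w) x)"
    proof (rule regular_time[OF \<epsilon>(1) R _ c \<theta> _ _ g0 g1 n w])
      show "mean (\<lambda>i x. L i x + \<epsilon> + (BL + 1) * far R x) = - c" using neg by (simp only: a_def[abs_def])
      show "\<eta> + \<theta> * BL \<le> \<epsilon>" "\<eta> + \<theta> * Bp \<le> \<epsilon>" using \<theta>1 \<eta> by linarith+
      show "\<bar>birkhoff h L w x - real n * mean L\<bar> \<le> \<eta> * real n"
        "\<bar>birkhoff h lp w x - real n * mean lp\<bar> \<le> \<eta> * real n"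
        using x by (simp_all add: Bad_def B2_def B3_def not_less)
      fix j assume "j \<le> 2 * g" "j * (n div g) \<le> n"
      then have "x \<notin> B1 n j w" using x by (simp add: Bad_def Jn_def)
      then have "\<bar>birkhoff h a (take (j * (n div g)) w) x + real (j * (n div g)) * c\<bar> \<le> \<eta> * real n"
        by (simp add: B1_def neg not_less)
      then show "\<bar>birkhoff h (\<lambda>i x. L i x + \<epsilon> + (BL + 1) * far R x) (take (j * (n div g)) w) x
          + real (j * (n div g)) * c\<bar> \<le> \<eta> * real n" by (simp only: a_def[abs_def])
    qed
    then show ?thesis by blast
  qed
  show ?thesis
    using R C \<gamma> g0 meas prob good
    by (intro exI[of _ "R + 1"] exI[of _ C] exI[of _ \<gamma>] exI[of _ g] exI[of _ Bad]) auto
qed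

end

section \<open>The upper bound\<close>

locale conformal_ifs = lyapunov_ifs k h p \<nu> \<delta> q \<rho> Cp L BL DL
  for k and h :: "nat \<Rightarrow> 'a::euclidean_space \<Rightarrow> 'a" and p \<nu> \<delta> q \<rho> Cp L BL DL +
  assumes distortion: "\<And>\<epsilon>. 0 < \<epsilon> \<Longrightarrow> \<exists>r0>0. distortion k h L \<epsilon> r0"
begin

lemma distortion_scale:
  assumes \<epsilon>: "0 < \<epsilon>"
  obtains r0 where "0 < r0" "distortion k h L \<epsilon> r0"
    "\<And>i u y. i < k \<Longrightarrow> dist u y \<le> r0 \<Longrightarrow> \<bar>lp i u - lp i y\<bar> \<le> \<epsilon>"
proof -
  obtain r1 where r1: "0 < r1" "distortion k h L \<epsilon> r1" using distortion[OF \<epsilon>] by auto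
  define c where "c = Cp / \<delta> + 1"
  have c: "0 < c" "Cp / \<delta> \<le> c" using Cp \<delta> by (auto simp: c_def add_nonneg_pos)
  define r2 where "r2 = (\<epsilon> / c) powr (1 / q)"
  have r2: "0 < r2" "r2 powr q = \<epsilon> / c" using \<epsilon> c q by (auto simp: r2_def powr_powr)
  show thesis
  proof (rule that[of "min r1 r2"])
    show "0 < min r1 r2" using r1 r2 by simp
    show "distortion k h L \<epsilon> (min r1 r2)"
      using r1(2) unfolding distortion_def by auto
    fix i and u y :: 'a assume i: "i < k" and d: "dist u y \<le> min r1 r2"
    have "\<bar>lp i u - lp i y\<bar> \<le> Cp / \<delta> * dist u y powr q" using lp_holder[OF i] .
    also have "\<dots> \<le> c * r2 powr q"
      using c Cp \<delta> d q by (intro mult_mono powr_mono2) auto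
    also have "\<dots> = \<epsilon>" using r2 c by simp
    finally show "\<bar>lp i u - lp i y\<bar> \<le> \<epsilon>" .
  qed
qed

lemma controlled_of_regular:
  assumes "distortion k h L \<epsilon> r0" "0 < r0" "regular \<epsilon> n v y"
  shows "distortion.controlled h L \<epsilon> r0 r0 v y"
proof -
  interpret distortion k h L \<epsilon> r0 by fact
  have "r0 * exp (birkhoff h L (take l v) y + \<epsilon> * real l) \<le> r0" if "l \<le> length v" for l
    using assms that by (simp add: regular_def)
  then show ?thesis by (simp add: controlled_def)
qed

lemma dist_orbit_regular:
  assumes "distortion k h L \<epsilon> r0" "0 < r0" "0 \<le> \<epsilon>" "regular \<epsilon> n v y" "v \<in> words k m" "m \<le> n"
    and "dist u y \<le> r0"
  shows "dist (orbit h v u) (orbit h v y) \<le> r0 * exp (real n * (mean L + 2 * \<epsilon>))"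
proof -
  interpret distortion k h L \<epsilon> r0 by fact
  have "dist (orbit h v u) (orbit h v y) \<le> r0 * exp (birkhoff h L v y + \<epsilon> * real m)"
    using assms controlled_of_regular[of \<epsilon> r0 n v y] by (intro dist_orbit_le) auto
  also have "birkhoff h L v y + \<epsilon> * real m \<le> real n * (mean L + 2 * \<epsilon>)"
  proof -
    have "\<epsilon> * real m \<le> \<epsilon> * real n" using assms by (intro mult_left_mono) auto
    then show ?thesis using assms(4) by (auto simp: regular_def abs_le_iff algebra_simps)
  qed
  finally show ?thesis using assms by simp
qed

lemma weight_eq_exp_lp: "v \<in> words k n \<Longrightarrow> weight h p v x = exp (birkhoff h lp v x)"
  unfolding lp_def[abs_def] using p_pos by (rule weight_eq_exp)

text \<open>The words are regular from different points, but all of these are near c. Distortion of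
  the weights shows that each word has weight at least exp(n (mean lp - 2 \<epsilon>)) at c, where
  the weights of all words sum to 1.\<close>

lemma card_regular_words:
  assumes dist: "distortion k h L \<epsilon> r0" "0 < r0" "0 \<le> \<epsilon>"
    and lpr: "\<And>i u y. i < k \<Longrightarrow> dist u y \<le> r0 \<Longrightarrow> \<bar>lp i u - lp i y\<bar> \<le> \<epsilon>"
    and m: "m \<le> n" and V: "V \<subseteq> words k m"
    and reg: "\<And>v. v \<in> V \<Longrightarrow> \<exists>y. dist c y \<le> r0 \<and> regular \<epsilon> n v y"
  shows "real (card V) \<le> exp (real n * (2 * \<epsilon> - mean lp))"
proof -
  interpret distortion k h L \<epsilon> r0 by fact
  have "exp (- (real n * (2 * \<epsilon> - mean lp))) \<le> weight h p v c" if v: "v \<in> V" for v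
  proof -
    obtain y where y: "dist c y \<le> r0" "regular \<epsilon> n v y" using reg[OF v] by auto
    have vm: "v \<in> words k m" using v V by auto
    have "\<bar>birkhoff h lp v c - birkhoff h lp v y\<bar> \<le> real m * \<epsilon>"
      using lpr vm controlled_of_regular[OF dist(1,2) y(2)] y(1) by (rule birkhoff_diff_le)
    moreover have "real m * \<epsilon> \<le> real n * \<epsilon>" using m dist by (intro mult_right_mono) auto
    ultimately have "- (real n * (2 * \<epsilon> - mean lp)) \<le> birkhoff h lp v c"
      using y(2) by (auto simp: regular_def abs_le_iff algebra_simps)
    then show ?thesis using weight_eq_exp_lp[OF vm] by simp
  qed
  then have "(\<Sum>v\<in>V. exp (- (real n * (2 * \<epsilon> - mean lp)))) \<le> (\<Sum>v\<in>V. weight h p v c)"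
    by (rule sum_mono)
  also have "\<dots> \<le> (\<Sum>v\<in>words k m. weight h p v c)"
    using V weight_nonneg by (intro sum_mono2) auto
  finally have "real (card V) * exp (- (real n * (2 * \<epsilon> - mean lp))) \<le> 1"
    by (simp add: sum_weight)
  moreover define X where "X = real n * (2 * \<epsilon> - mean lp)"
  ultimately have "real (card V) * exp (- X) \<le> 1" by simp
  then have "real (card V) \<le> exp X" by (simp add: exp_minus field_simps)
  then show ?thesis by (simp add: X_def)
qed

text \<open>Y is the limsup of the finite unions \<open>Zs n\<close> of images of net balls under
  regular words. Every union over n >= J contains each late \<open>Zs n\<close>, whose complement
  has small measure, and so has full measure; the covering sums, in turn, are summable in n.\<close>

lemma upper_bound_set:
  assumes t: "0 < t" "- mean lp < t * (- mean L)"
  shows "\<exists>Y\<in>sets borel. emeasure \<nu> Y = 1 \<and> hausdorff_measure t Y = 0"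
proof -
  define \<Lambda> where "\<Lambda> = - mean L"
  define H where "H = - mean lp"
  have \<Lambda>: "0 < \<Lambda>" using mean_neg by (simp add: \<Lambda>_def)
  have tH: "0 < t * \<Lambda> - H" using t by (simp add: \<Lambda>_def H_def)
  \<comment> \<open>Small enough for \<kappa> > 0: the t-th powers of the diameters decay faster
    than the number of words grows, with both rates worsened by 2 \<epsilon>.\<close>
  define \<epsilon> where "\<epsilon> = min (\<Lambda> / 4) ((t * \<Lambda> - H) / (4 * (1 + t)))"
  have \<epsilon>: "0 < \<epsilon>" "4 * \<epsilon> \<le> \<Lambda>" using \<Lambda> tH t by (auto simp: \<epsilon>_def)
  have "\<epsilon> \<le> (t * \<Lambda> - H) / (4 * (1 + t))" by (simp add: \<epsilon>_def)
  then have "\<epsilon> * (4 * (1 + t)) \<le> t * \<Lambda> - H" using t by (simp add: pos_le_divide_eq)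
  then have "2 * \<epsilon> + t * (2 * \<epsilon>) < t * \<Lambda> - H" using \<epsilon> t tH by (simp add: algebra_simps)
  then have \<kappa>: "0 < t * (\<Lambda> - 2 * \<epsilon>) - (H + 2 * \<epsilon>)" by (simp add: algebra_simps)
  define \<kappa> where "\<kappa> = t * (\<Lambda> - 2 * \<epsilon>) - (H + 2 * \<epsilon>)"
  have \<kappa>0: "0 < \<kappa>" using \<kappa> by (simp add: \<kappa>_def)
  obtain R C \<gamma> N Bad where R: "0 < R" and C: "0 \<le> C" "0 < \<gamma>" and N: "1 \<le> N"
    and meas: "\<forall>n w. w \<in> words k n \<longrightarrow> Bad n w \<in> sets borel"
    and prob: "\<forall>n\<ge>N. path_prob n (Bad n) \<le> ennreal (C * real n powr (- \<gamma>))"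
    and good: "\<forall>n\<ge>N. \<forall>w\<in>words k n. \<forall>x. x \<notin> Bad n w \<longrightarrow>
      (\<exists>\<tau>\<le>n. norm (orbit h (take \<tau> w) x) \<le> R \<and> regular \<epsilon> n (drop \<tau> w) (orbit h (take \<tau> w) x))"
    using regular_times[of \<epsilon>] \<epsilon> \<Lambda>_def by auto
  obtain r0 where r0: "0 < r0" and dst: "distortion k h L \<epsilon> r0"
    and lpr: "\<And>i u y. i < k \<Longrightarrow> dist u y \<le> r0 \<Longrightarrow> \<bar>lp i u - lp i y\<bar> \<le> \<epsilon>"
    using distortion_scale[OF \<epsilon>(1)] by blast
  define \<eta> where "\<eta> = min 1 (r0 / 2)"
  have \<eta>: "0 < \<eta>" "\<eta> \<le> 1" "2 * \<eta> \<le> r0" using r0 by (auto simp: \<eta>_def)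
  obtain Z :: "'a set" where Z: "finite Z" "cball 0 R \<subseteq> (\<Union>c\<in>Z. cball c \<eta>)"
    using finite_cball_net[of R \<eta>] R \<eta> by auto
  \<comment> \<open>The prefix up to the regular time is forgotten: the end point depends only on
    the point reached, which is near some c, and on the rest of the word.\<close>
  define V where "V n \<tau> c = {v \<in> words k (n - \<tau>). \<exists>y\<in>cball c \<eta>. regular \<epsilon> n v y}" for n \<tau> c
  define I where "I n = (SIGMA \<tau>:{..n}. SIGMA c:Z. V n \<tau> c)" for n
  define W where "W i = (case i of (\<tau>, c, v) \<Rightarrow> orbit h v ` cball c \<eta>)" for i :: "nat \<times> 'a \<times> nat list"
  define e where "e n = 2 * r0 * exp (- (real n * (\<Lambda> - 2 * \<epsilon>)))" for n
  have Vw: "V n \<tau> c \<subseteq> words k (n - \<tau>)" and finV: "finite (V n \<tau> c)" for n \<tau> c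
    by (auto simp: V_def)
  have finI: "finite (I n)" for n
    unfolding I_def using Z finV by (intro finite_SigmaI) auto
  have compactW: "compact (W i)" if i: "i \<in> I n" for i n
  proof -
    obtain \<tau> c v where [simp]: "i = (\<tau>, c, v)" by (cases i) auto
    have "v \<in> words k (n - \<tau>)" using i Vw by (auto simp: I_def)
    then have "continuous_on (cball c \<eta>) (orbit h v)"
      using orbit_cont continuous_on_subset by blast
    then show ?thesis unfolding W_def by (simp add: compact_continuous_image)
  qed
  have diamW: "diameter (W i) \<le> e n" if i: "i \<in> I n" for i n
  proof -
    obtain \<tau> c v where [simp]: "i = (\<tau>, c, v)" by (cases i) auto
    have v: "v \<in> words k (n - \<tau>)" "\<tau> \<le> n" "v \<in> V n \<tau> c" using i Vw by (auto simp: I_def)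
    then obtain y where y: "y \<in> cball c \<eta>" "regular \<epsilon> n v y" by (auto simp: V_def)
    have near: "dist (orbit h v u) (orbit h v y) \<le> r0 * exp (- (real n * (\<Lambda> - 2 * \<epsilon>)))" if "u \<in> cball c \<eta>" for u
    proof -
      have "dist u y \<le> dist c u + dist c y" by (rule dist_triangle3)
      then have "dist u y \<le> r0" using that y \<eta> by simp
      then have "dist (orbit h v u) (orbit h v y) \<le> r0 * exp (real n * (mean L + 2 * \<epsilon>))"
        using \<epsilon> r0 y(2) by (intro dist_orbit_regular[OF dst _ _ _ v(1)]) auto
      then show ?thesis by (simp add: \<Lambda>_def algebra_simps)
    qed
    have "dist a b \<le> e n" if "a \<in> W i" "b \<in> W i" for a b
    proof -
      have "a \<in> orbit h v ` cball c \<eta>" "b \<in> orbit h v ` cball c \<eta>"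
        using that by (simp_all add: W_def)
      then obtain u u' where u: "u \<in> cball c \<eta>" "u' \<in> cball c \<eta>" "a = orbit h v u" "b = orbit h v u'"
        by (elim imageE)
      have "dist a b \<le> dist a (orbit h v y) + dist b (orbit h v y)" by (rule dist_triangle2)
      then show ?thesis using near[OF u(1)] near[OF u(2)] unfolding u(3,4) e_def by linarith
    qed
    moreover have "0 \<le> e n" using r0 by (simp add: e_def)
    ultimately show ?thesis by (intro diameter_le) (auto simp: dist_norm)
  qed
  have cardI: "real (card (I n)) \<le> real (n + 1) * real (card Z) * exp (real n * (H + 2 * \<epsilon>))" for n
  proof -
    have V: "real (card (V n \<tau> c)) \<le> exp (real n * (H + 2 * \<epsilon>))" for \<tau> c
    proof -
      have "real (card (V n \<tau> c)) \<le> exp (real n * (2 * \<epsilon> - mean lp))"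
      proof (rule card_regular_words[OF dst r0 _ lpr, where m = "n - \<tau>" and c = c])
        fix v assume "v \<in> V n \<tau> c"
        then obtain y where "y \<in> cball c \<eta>" "regular \<epsilon> n v y" by (auto simp: V_def)
        then show "\<exists>y. dist c y \<le> r0 \<and> regular \<epsilon> n v y" using \<eta> by (intro exI[of _ y]) auto
      qed (use \<epsilon> Vw in auto)
      then show ?thesis by (simp add: H_def algebra_simps)
    qed
    have "real (card (I n)) = (\<Sum>\<tau>\<le>n. \<Sum>c\<in>Z. real (card (V n \<tau> c)))"
      unfolding I_def using Z finV by (simp add: card_SigmaI finite_SigmaI)
    also have "\<dots> \<le> (\<Sum>\<tau>\<le>n. \<Sum>c\<in>Z. exp (real n * (H + 2 * \<epsilon>)))"
      using V by (intro sum_mono)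
    finally show ?thesis by (simp add: algebra_simps)
  qed
  define Zs where "Zs n = (\<Union>i\<in>I n. W i)" for n
  have Zs_borel: "Zs n \<in> sets borel" for n
    unfolding Zs_def using finI compactW
    by (intro sets.finite_UN borel_closed compact_imp_closed) auto
  \<comment> \<open>The factor n + 1 counts the regular times, \<open>card Z\<close> the balls of
    the net.\<close>
  define f where "f n = real (n + 1) * (real (card Z) * (2 * r0) powr t) * exp (- \<kappa> * real n)" for n :: nat
  have f_nonneg: "0 \<le> f n" for n by (simp add: f_def)
  have content: "hausdorff_pre t d (Zs n) \<le> ennreal (f n)" if d: "e n \<le> d" for n d
  proof -
    have e0: "0 \<le> e n" using r0 by (simp add: e_def)
    have "hausdorff_pre t d (Zs n) \<le> (\<Sum>i\<in>I n. ennreal (diameter (W i) powr t))"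
      unfolding Zs_def
    proof (rule hausdorff_pre_finite_UN_le[OF finI])
      show "0 \<le> d" using e0 d by linarith
      show "bounded (W i)" if "i \<in> I n" for i using compactW[OF that] by (rule compact_imp_bounded)
      show "diameter (W i) \<le> d" if "i \<in> I n" for i using diamW[OF that] d by linarith
    qed
    also have "\<dots> \<le> (\<Sum>i\<in>I n. ennreal (e n powr t))"
    proof (intro sum_mono ennreal_leI powr_mono2)
      fix i assume i: "i \<in> I n"
      show "0 \<le> diameter (W i)" by (rule diameter_ge_0[OF compact_imp_bounded[OF compactW[OF i]]])
      show "diameter (W i) \<le> e n" by (rule diamW[OF i])
    qed (use t in simp)
    also have "\<dots> = ennreal (real (card (I n)) * e n powr t)"
      by (simp add: ennreal_of_nat_eq_real_of_nat ennreal_mult[symmetric])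
    also have "real (card (I n)) * e n powr t
        \<le> (real (n + 1) * real (card Z) * exp (real n * (H + 2 * \<epsilon>))) * e n powr t"
      using cardI by (intro mult_right_mono) auto
    also have "e n powr t = (2 * r0) powr t * exp (- (real n * (t * (\<Lambda> - 2 * \<epsilon>))))"
      using r0 by (simp add: e_def powr_mult exp_powr_real algebra_simps)
    also have "(real (n + 1) * real (card Z) * exp (real n * (H + 2 * \<epsilon>))) * ((2 * r0) powr t * exp (- (real n * (t * (\<Lambda> - 2 * \<epsilon>)))))
        = real (n + 1) * (real (card Z) * (2 * r0) powr t) * (exp (real n * (H + 2 * \<epsilon>)) * exp (- (real n * (t * (\<Lambda> - 2 * \<epsilon>)))))"
      by (simp only: ac_simps)
    also have "exp (real n * (H + 2 * \<epsilon>)) * exp (- (real n * (t * (\<Lambda> - 2 * \<epsilon>)))) = exp (- \<kappa> * real n)"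
      unfolding exp_add[symmetric] by (simp add: \<kappa>_def algebra_simps)
    finally show ?thesis by (simp add: f_def ennreal_leI)
  qed
  have summ: "summable f"
  proof -
    have "(\<lambda>n. real (n + 1) * (real (card Z) * (2 * r0) powr t) * exp (- \<kappa> * real n)) \<in> O(\<lambda>n. 1 / real n ^ 2)"
      using \<kappa>0 by real_asymp
    then show ?thesis
      unfolding f_def[abs_def] by (rule summable_comparison_test_bigo[rotated]) (use inverse_power_summable[of 2, where ?'a = real] in \<open>simp add: field_simps\<close>)
  qed
  define Y where "Y = (\<Inter>J. \<Union>n\<in>{n. J \<le> n \<and> N \<le> n}. Zs n)"
  have Y_borel: "Y \<in> sets borel"
    unfolding Y_def using Zs_borel by (intro sets.countable_INT sets.countable_UN) auto
  have null: "emeasure \<nu> (- Zs n) \<le> ennreal (C * real n powr (- \<gamma>))" if n: "n \<ge> N" for n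
  proof -
    have "emeasure \<nu> (- Zs n) = path_prob n (\<lambda>w. orbit h w -` (- Zs n))"
      using Zs_borel by (intro path_prob_orbit[symmetric]) auto
    also have "\<dots> \<le> path_prob n (Bad n)"
    proof (rule path_prob_mono, rule subsetI, rule ccontr)
      fix w x assume w: "w \<in> words k n" and x: "x \<in> orbit h w -` (- Zs n)" "x \<notin> Bad n w"
      obtain \<tau> where \<tau>: "\<tau> \<le> n" "norm (orbit h (take \<tau> w) x) \<le> R"
        "regular \<epsilon> n (drop \<tau> w) (orbit h (take \<tau> w) x)" using good n w x(2) by blast
      let ?y = "orbit h (take \<tau> w) x" and ?v = "drop \<tau> w"
      have "?y \<in> cball 0 R" using \<tau> by simp
      then obtain c where c: "c \<in> Z" "?y \<in> cball c \<eta>" using Z(2) by blast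
      have "?v \<in> V n \<tau> c" using \<tau> c drop_words[OF w, of \<tau>] by (auto simp: V_def)
      then have "(\<tau>, c, ?v) \<in> I n" using \<tau> c by (simp add: I_def)
      moreover have "orbit h w x = orbit h ?v ?y"
        using orbit_append[of h "take \<tau> w" ?v x] by simp
      then have "orbit h w x \<in> W (\<tau>, c, ?v)" using c by (simp add: W_def)
      ultimately have "orbit h w x \<in> Zs n" unfolding Zs_def by blast
      then show False using x(1) by simp
    qed
    also have "\<dots> \<le> ennreal (C * real n powr (- \<gamma>))" using prob n by blast
    finally show ?thesis .
  qed
  have lim0: "(\<lambda>n. C * real n powr (- \<gamma>)) \<longlonglongrightarrow> 0"
    using C by real_asymp
  have "emeasure \<nu> (- (\<Union>n\<in>{n. J \<le> n \<and> N \<le> n}. Zs n)) = 0" for J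
  proof -
    have "emeasure \<nu> (- (\<Union>n\<in>{n. J \<le> n \<and> N \<le> n}. Zs n)) \<le> ennreal (C * real n powr (- \<gamma>))"
      if n: "n \<ge> max J N" for n
    proof -
      have "emeasure \<nu> (- (\<Union>n\<in>{n. J \<le> n \<and> N \<le> n}. Zs n)) \<le> emeasure \<nu> (- Zs n)"
        using n Zs_borel by (intro emeasure_mono) auto
      then show ?thesis using null[of n] n by (auto intro: order.trans)
    qed
    moreover have "(\<lambda>n. ennreal (C * real n powr (- \<gamma>))) \<longlonglongrightarrow> ennreal 0"
      using lim0 by (rule tendsto_ennrealI)
    ultimately have "emeasure \<nu> (- (\<Union>n\<in>{n. J \<le> n \<and> N \<le> n}. Zs n)) \<le> ennreal 0"
      by (intro LIMSEQ_le_const[where X = "\<lambda>n. ennreal (C * real n powr (- \<gamma>))"]) blast+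
    then show ?thesis by simp
  qed
  moreover have "- (\<Union>n\<in>{n. J \<le> n \<and> N \<le> n}. Zs n) \<in> sets borel" for J
    using Zs_borel by (intro borel_comp sets.countable_UN'') auto
  ultimately have "- (\<Union>n\<in>{n. J \<le> n \<and> N \<le> n}. Zs n) \<in> null_sets \<nu>" for J
    by (intro null_setsI) (simp_all only: sets_\<nu>)
  then have "(\<Union>J. - (\<Union>n\<in>{n. J \<le> n \<and> N \<le> n}. Zs n)) \<in> null_sets \<nu>"
    by (rule null_sets_UN)
  then have "- Y \<in> null_sets \<nu>" by (simp add: Y_def Compl_INT)
  then have "AE x in \<nu>. x \<in> Y"
    by (rule AE_I') auto
  then have "emeasure \<nu> Y = 1"
    using Y_borel by (intro emeasure_eq_1_AE) simp_all
  moreover have "hausdorff_measure t Y = 0"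
    unfolding hausdorff_measure_0_iff
  proof (intro allI impI)
    fix d :: real assume d: "0 < d"
    have "hausdorff_pre t d Y \<le> 0 + ennreal s" if s: "0 < s" for s
    proof -
      have "e \<longlonglongrightarrow> 0"
      proof -
        have "0 < \<Lambda> - 2 * \<epsilon>" using \<epsilon> \<Lambda> by linarith
        then show ?thesis unfolding e_def[abs_def] by real_asymp
      qed
      then have "\<forall>\<^sub>F n in sequentially. e n < d" using d by (rule order_tendstoD)
      then obtain J1 where J1: "\<And>n. n \<ge> J1 \<Longrightarrow> e n < d" by (auto simp: eventually_sequentially)
      obtain J2 where J2: "\<And>n. n \<ge> J2 \<Longrightarrow> norm (\<Sum>i. f (i + n)) < s"
        using suminf_exist_split[OF s summ] by auto
      define J where "J = max J1 (max J2 N)"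
      have "Y \<subseteq> (\<Union>n. Zs (n + J))"
      proof
        fix x assume "x \<in> Y"
        then have "x \<in> (\<Union>n\<in>{n. J \<le> n \<and> N \<le> n}. Zs n)" unfolding Y_def by blast
        then obtain n where "J \<le> n" "x \<in> Zs n" by blast
        then have "x \<in> Zs ((n - J) + J)" by simp
        then show "x \<in> (\<Union>n. Zs (n + J))" by (rule UN_I[OF UNIV_I])
      qed
      then have "hausdorff_pre t d Y \<le> hausdorff_pre t d (\<Union>n. Zs (n + J))"
        by (rule hausdorff_pre_mono)
      also have "\<dots> \<le> (\<Sum>n. hausdorff_pre t d (Zs (n + J)))" by (rule hausdorff_pre_UN_le)
      also have "\<dots> \<le> (\<Sum>n. ennreal (f (n + J)))"
      proof (rule suminf_le[OF _ summableI summableI])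
        fix n
        show "hausdorff_pre t d (Zs (n + J)) \<le> ennreal (f (n + J))"
          using J1[of "n + J"] by (intro content less_imp_le) (simp add: J_def)
      qed
      also have "\<dots> = ennreal (\<Sum>n. f (n + J))"
        using summ f_nonneg by (intro suminf_ennreal2) (auto simp: summable_iff_shift)
      also have "(\<Sum>n. f (n + J)) \<le> s" proof -
        have "J2 \<le> J" by (simp add: J_def)
        then show ?thesis using J2[of J] by simp
      qed
      finally show ?thesis by (simp add: ennreal_leI)
    qed
    then have "hausdorff_pre t d Y \<le> 0" by (rule ennreal_le_epsilon)
    then show "hausdorff_pre t d Y = 0" by simp
  qed
  ultimately show ?thesis using Y_borel by blast
qed

end

section \<open>The lower bound\<close>

text \<open>Near each point of the closure there is some ball in U, and finitely many of these balls
  serve the compact part. One quarter of r goes to each of: centre to net point, net point to y, and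
  the radius.\<close>

lemma uniform_inner_ball:
  fixes U :: "'a::euclidean_space set"
  assumes U: "open U" and r: "0 < r"
  shows "\<exists>\<kappa>>0. \<forall>y\<in>closure U \<inter> cball 0 R. \<exists>u. cball u \<kappa> \<subseteq> U \<and> dist u y + \<kappa> \<le> r"
proof -
  let ?K = "closure U \<inter> cball 0 R"
  have "\<exists>u \<kappa>. 0 < \<kappa> \<and> \<kappa> \<le> r / 4 \<and> cball u \<kappa> \<subseteq> U \<and> dist u y < r / 4" if y: "y \<in> closure U" for y
  proof -
    obtain u where u: "u \<in> U" "dist u y < r / 4"
      using y r closure_approachable[of y U] by (metis zero_less_divide_iff zero_less_numeral)
    obtain e where e: "0 < e" "cball u e \<subseteq> U" using U u(1) open_contains_cball by metis
    have "cball u (min e (r / 4)) \<subseteq> cball u e" by (rule subset_cball) simp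
    then show ?thesis using u e r by (intro exI[of _ u] exI[of _ "min e (r / 4)"]) auto
  qed
  then have "\<exists>f g. \<forall>y\<in>closure U. 0 < g y \<and> g y \<le> r / 4 \<and> cball (f y) (g y) \<subseteq> U \<and> dist (f y) y < r / 4"
    by (metis (no_types, lifting))
  then obtain f g where fg: "\<And>y. y \<in> closure U \<Longrightarrow> 0 < g y \<and> g y \<le> r / 4 \<and> cball (f y) (g y) \<subseteq> U \<and> dist (f y) y < r / 4"
    by blast
  have "compact ?K" by (intro closed_Int_compact) auto
  moreover have "?K \<subseteq> (\<Union>y\<in>?K. ball y (r / 4))" using r by auto
  ultimately obtain D where D: "D \<subseteq> ?K" "finite D" "?K \<subseteq> (\<Union>y\<in>D. ball y (r / 4))"
    using compactE_image[of ?K ?K "\<lambda>y. ball y (r / 4)"] by (metis (no_types, lifting) open_ball)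
  define \<kappa> where "\<kappa> = Min (insert (r / 4) (g ` D))"
  have fin: "finite (insert (r / 4) (g ` D))" using D by simp
  have "0 < a" if "a \<in> insert (r / 4) (g ` D)" for a using that fg D(1) r by auto
  then have "0 < \<kappa>" unfolding \<kappa>_def using fin by (subst Min_gr_iff) auto
  moreover have "\<kappa> \<le> r / 4" unfolding \<kappa>_def by (rule Min_le[OF fin]) simp
  moreover have "\<kappa> \<le> g y" if "y \<in> D" for y unfolding \<kappa>_def using that by (intro Min_le[OF fin]) simp
  ultimately have \<kappa>: "0 < \<kappa>" "\<kappa> \<le> r / 4" "\<And>y. y \<in> D \<Longrightarrow> \<kappa> \<le> g y" by blast+
  have "\<exists>u. cball u \<kappa> \<subseteq> U \<and> dist u y + \<kappa> \<le> r" if y: "y \<in> ?K" for y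
  proof -
    obtain z where z: "z \<in> D" "dist z y < r / 4" using D(3) y by auto
    then have zc: "z \<in> closure U" using D(1) by auto
    have "cball (f z) \<kappa> \<subseteq> cball (f z) (g z)" using \<kappa>(3)[OF z(1)] by (rule subset_cball)
    then have "cball (f z) \<kappa> \<subseteq> U" using fg[OF zc] by blast
    moreover have "dist (f z) y + \<kappa> \<le> r"
      using dist_triangle[of "f z" y z] fg[OF zc] z(2) \<kappa>(2) r by linarith
    ultimately show ?thesis by blast
  qed
  then show ?thesis using \<kappa>(1) by blast
qed

lemma orbit_injective:
  assumes "\<And>i. i < k \<Longrightarrow> inj (h i)" "w \<in> words k n" shows "inj (orbit h w)"
  using assms(2)
proof (induction n arbitrary: w)
  case 0
  then show ?case by (auto intro!: injI)
next
  case (Suc n)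
  from Suc.prems(1) obtain i v where w: "w = i # v" "i < k" "v \<in> words k n"
    by (rule words_SucE)
  have "orbit h w = orbit h v \<circ> h i" by (auto simp: w)
  then show ?case using Suc.IH[OF w(3)] assms(1)[OF w(2)] by (simp only: inj_compose)
qed

lemma orbit_subset:
  assumes "\<And>i. i < k \<Longrightarrow> h i ` U \<subseteq> U" "w \<in> words k n" "x \<in> U" shows "orbit h w x \<in> U"
  using assms(2,3)
proof (induction n arbitrary: w x)
  case (Suc n)
  from Suc.prems(1) obtain i v where w: "w = i # v" "i < k" "v \<in> words k n"
    by (rule words_SucE)
  have "h i x \<in> U" using assms(1)[OF w(2)] Suc.prems by auto
  then show ?case using Suc.IH[OF w(3)] by (simp add: w)
qed simp

text \<open>If the words differ only in the first letter, the disjoint sets h_i U and h_j U are both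
  mapped by the rest of the word, and only injectivity keeps them apart. Otherwise the remaining
  words already have disjoint images of U, which contain the images in question.\<close>

lemma orbit_images_disjoint:
  assumes inj: "\<And>i. i < k \<Longrightarrow> inj (h i)" and osc: "osc_with k h U"
    and "v \<in> words k n" "v' \<in> words k n" "v \<noteq> v'"
  shows "orbit h v ` U \<inter> orbit h v' ` U = {}"
  using assms(3-5)
proof (induction n arbitrary: v v')
  case (Suc n)
  obtain i w where w: "v = i # w" "i < k" "w \<in> words k n"
    using Suc.prems(1) by (auto simp: words_Suc)
  obtain j w' where w': "v' = j # w'" "j < k" "w' \<in> words k n"
    using Suc.prems(2) by (auto simp: words_Suc)
  have sub: "h i ` U \<subseteq> U" "h j ` U \<subseteq> U" using osc w w' by (auto simp: osc_with_def)
  have im: "orbit h v ` U = orbit h w ` (h i ` U)" "orbit h v' ` U = orbit h w' ` (h j ` U)"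
    by (auto simp: w w')
  show ?case
  proof (cases "w = w'")
    case True
    then have "i \<noteq> j" using Suc.prems(3) w w' by auto
    then have "h i ` U \<inter> h j ` U = {}" using osc w w' by (auto simp: osc_with_def)
    moreover have "inj (orbit h w)" using inj w(3) by (rule orbit_injective)
    ultimately show ?thesis unfolding im True[symmetric] by (simp add: image_Int[symmetric])
  next
    case False
    then have "orbit h w ` U \<inter> orbit h w' ` U = {}" using Suc.IH[OF w(3) w'(3)] by simp
    then show ?thesis unfolding im using image_mono[OF sub(1), of "orbit h w"] image_mono[OF sub(2), of "orbit h w'"]
      by blast
  qed
qed simp

locale conformal_osc = conformal_ifs k h p \<nu> \<delta> q \<rho> Cp L BL DL
  for k and h :: "nat \<Rightarrow> 'a::euclidean_space \<Rightarrow> 'a" and p \<nu> \<delta> q \<rho> Cp L BL DL +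
  fixes U :: "'a set"
  assumes inj_h: "\<And>i. i < k \<Longrightarrow> inj (h i)" and osc_U: "osc_with k h U"
begin

lemma U: "open U" "U \<noteq> {}" "\<And>i. i < k \<Longrightarrow> h i ` U \<subseteq> U"
  using osc_U by (auto simp: osc_with_def)

lemma closure_U_invariant: "i < k \<Longrightarrow> h i ` closure U \<subseteq> closure U"
  using image_closure_subset[of U "h i" "closure U"] U(3) h_cont closure_subset continuous_on_subset
  by (metis closed_closure order.trans subset_UNIV)

text \<open>Inner balls for the volume count are available only near the closure of U, and starting
  points elsewhere have to be discarded.\<close>

lemma AE_closure_U: "AE x in \<nu>. x \<in> closure U"
  using U(2) closure_U_invariant by (intro AE_in_closed_invariant) auto

text \<open>Each word maps its inner ball over a ball of radius s; these are disjoint by the open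
  set condition and lie in one ball of radius b. Both radii are exp(n mean L) up to distortion, so b
  / s is a constant times exp(4 \<epsilon> n).\<close>

lemma card_meeting_words:
  assumes dst: "distortion k h L \<epsilon> r0" and r0: "0 < r0" and \<epsilon>: "0 \<le> \<epsilon>" and \<kappa>: "0 < \<kappa>"
    and ball: "\<And>y. y \<in> closure U \<inter> cball 0 R \<Longrightarrow> \<exists>u. cball u \<kappa> \<subseteq> U \<and> dist u y + \<kappa> \<le> r0"
    and m: "m \<le> n" and V: "V \<subseteq> words k m"
    and E: "bounded E" "diameter E \<le> exp (real n * mean L)"
    and reg: "\<And>v. v \<in> V \<Longrightarrow> \<exists>y\<in>closure U \<inter> cball 0 R. regular \<epsilon> n v y \<and> orbit h v y \<in> E"
  shows "real (card V) \<le> ((1 + r0) / \<kappa>) ^ DIM('a) * exp (real n * (4 * \<epsilon> * DIM('a)))"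
proof (cases "V = {}")
  case False
  interpret distortion k h L \<epsilon> r0 by fact
  have "\<exists>y. \<forall>v\<in>V. y v \<in> closure U \<inter> cball 0 R \<and> regular \<epsilon> n v (y v) \<and> orbit h v (y v) \<in> E"
    using reg by (intro bchoice) blast
  then obtain y where y: "\<And>v. v \<in> V \<Longrightarrow> y v \<in> closure U \<inter> cball 0 R \<and> regular \<epsilon> n v (y v) \<and> orbit h v (y v) \<in> E"
    by blast
  have "\<exists>u. \<forall>v\<in>V. cball (u v) \<kappa> \<subseteq> U \<and> dist (u v) (y v) + \<kappa> \<le> r0"
    using ball y by (intro bchoice) blast
  then obtain u where u: "\<And>v. v \<in> V \<Longrightarrow> cball (u v) \<kappa> \<subseteq> U \<and> dist (u v) (y v) + \<kappa> \<le> r0"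
    by blast
  obtain v0 where v0: "v0 \<in> V" using False by auto
  define s where "s = \<kappa> * exp (real n * (mean L - 2 * \<epsilon>))"
  define b where "b = (1 + r0) * exp (real n * (mean L + 2 * \<epsilon>))"
  have vm: "v \<in> words k m" if "v \<in> V" for v using V that by auto
  have eps_mn: "\<epsilon> * real m \<le> \<epsilon> * real n" using m \<epsilon> by (intro mult_left_mono) auto
  have sub: "cball (orbit h v (u v)) s \<subseteq> orbit h v ` cball (u v) \<kappa>" if v: "v \<in> V" for v
  proof -
    have "real n * (mean L - 2 * \<epsilon>) \<le> birkhoff h L v (y v) - \<epsilon> * real m"
      using y[OF v] eps_mn by (auto simp: regular_def abs_le_iff algebra_simps)
    then have "s \<le> \<kappa> * exp (birkhoff h L v (y v) - \<epsilon> * real m)"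
      unfolding s_def using \<kappa> by (intro mult_left_mono) auto
    then have "cball (orbit h v (u v)) s \<subseteq> cball (orbit h v (u v)) (\<kappa> * exp (birkhoff h L v (y v) - \<epsilon> * real m))"
      by (rule subset_cball)
    also have "\<dots> \<subseteq> orbit h v ` cball (u v) \<kappa>"
      using vm[OF v] controlled_of_regular[OF dst r0] y[OF v] u[OF v] \<kappa>
      by (intro cball_subset_orbit[where r = r0 and y = "y v"]) auto
    finally show ?thesis .
  qed
  define X where "X = (1 + r0) / \<kappa> * exp (real n * (4 * \<epsilon>))"
  have "real (card V) * s ^ DIM('a) \<le> b ^ DIM('a)"
  proof (rule card_disjoint_cballs[where c = "\<lambda>v. orbit h v (u v)" and ?x0.0 = "orbit h v0 (y v0)"])
    show "finite V" using V finite_subset finite_words by blast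
    show "0 \<le> s" using \<kappa> by (simp add: s_def)
    show "0 \<le> b" using r0 by (simp add: b_def)
    show "cball (orbit h v (u v)) s \<subseteq> cball (orbit h v0 (y v0)) b" if v: "v \<in> V" for v
    proof
      fix z assume "z \<in> cball (orbit h v (u v)) s"
      then have "z \<in> orbit h v ` cball (u v) \<kappa>" using sub[OF v] by blast
      then obtain a where a: "a \<in> cball (u v) \<kappa>" "z = orbit h v a" by (elim imageE)
      have "dist a (y v) \<le> dist (u v) a + dist (u v) (y v)" by (rule dist_triangle3)
      then have "dist a (y v) \<le> r0" using a(1) u[OF v] by simp
      then have "dist z (orbit h v (y v)) \<le> r0 * exp (real n * (mean L + 2 * \<epsilon>))"
        unfolding a(2) using y[OF v] vm[OF v] m \<epsilon> r0 by (intro dist_orbit_regular[OF dst]) auto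
      moreover have "dist (orbit h v (y v)) (orbit h v0 (y v0)) \<le> diameter E"
        using y[OF v] y[OF v0] by (intro diameter_bounded_bound E(1)) auto
      moreover have "exp (real n * mean L) \<le> exp (real n * (mean L + 2 * \<epsilon>))"
        using \<epsilon> by (intro exp_le_cancel_iff[THEN iffD2] mult_left_mono) auto
      moreover have "dist z (orbit h v0 (y v0)) \<le> dist z (orbit h v (y v)) + dist (orbit h v (y v)) (orbit h v0 (y v0))"
        by (rule dist_triangle)
      ultimately have "dist z (orbit h v0 (y v0)) \<le> b"
        unfolding b_def distrib_right mult_1 using E(2) by linarith
      then show "z \<in> cball (orbit h v0 (y v0)) b" by (simp add: dist_commute)
    qed
    show "cball (orbit h v (u v)) s \<inter> cball (orbit h v' (u v')) s = {}"
      if v: "v \<in> V" "v' \<in> V" "v \<noteq> v'" for v v'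
    proof -
      have "cball (orbit h v (u v)) s \<subseteq> orbit h v ` U" "cball (orbit h v' (u v')) s \<subseteq> orbit h v' ` U"
        using sub[OF v(1)] sub[OF v(2)] u[OF v(1)] u[OF v(2)] by (meson image_mono order.trans)+
      moreover have "orbit h v ` U \<inter> orbit h v' ` U = {}"
        using inj_h osc_U vm[OF v(1)] vm[OF v(2)] v(3) by (rule orbit_images_disjoint)
      ultimately show ?thesis by blast
    qed
  qed
  moreover have "b = s * X"
  proof -
    have "exp (real n * (mean L + 2 * \<epsilon>)) = exp (real n * (mean L - 2 * \<epsilon>)) * exp (real n * (4 * \<epsilon>))"
      unfolding exp_add[symmetric] by (simp add: algebra_simps)
    then show ?thesis using \<kappa> by (simp add: b_def s_def X_def)
  qed
  ultimately have "real (card V) * s ^ DIM('a) \<le> X ^ DIM('a) * s ^ DIM('a)"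
    by (simp add: power_mult_distrib mult.commute)
  moreover have "0 < s ^ DIM('a)" using \<kappa> by (simp add: s_def)
  ultimately have "real (card V) \<le> X ^ DIM('a)"
    by (rule mult_right_le_imp_le)
  also have "X ^ DIM('a) = ((1 + r0) / \<kappa>) ^ DIM('a) * exp (real n * (4 * \<epsilon> * DIM('a)))"
    unfolding X_def power_mult_distrib by (simp add: exp_of_nat_mult[symmetric] algebra_simps)
  finally show ?thesis .
qed (use r0 \<kappa> in simp)

lemma sets_regular: "v \<in> words k m \<Longrightarrow> {y. regular \<epsilon> n v y} \<in> sets borel"
proof -
  assume v: "v \<in> words k m"
  have cL: "continuous_on UNIV (birkhoff h L (take l v))" if "l \<le> m" for l
    using h_cont L_cont take_words[OF v that] by (rule continuous_on_birkhoff)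
  have cP: "continuous_on UNIV (birkhoff h lp v)"
    using h_cont lp_cont v by (rule continuous_on_birkhoff)
  have cL': "continuous_on UNIV (birkhoff h L v)"
    using h_cont L_cont v by (rule continuous_on_birkhoff)
  have "{y. regular \<epsilon> n v y} = (\<Inter>l\<in>{..m}. {y. birkhoff h L (take l v) y + \<epsilon> * real l \<le> 0}) \<inter>
      ({y. \<bar>birkhoff h L v y - real n * mean L\<bar> \<le> \<epsilon> * real n} \<inter>
       {y. \<bar>birkhoff h lp v y - real n * mean lp\<bar> \<le> \<epsilon> * real n})"
    using length_words[OF v] by (auto simp: regular_def)
  moreover have "closed \<dots>"
    using cL cP cL' by (intro closed_Int closed_INT ballI closed_Collect_le continuous_intros) auto
  ultimately show ?thesis by (simp add: borel_closed)
qed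

text \<open>The number of words that meet E, times the largest weight exp(n (mean lp + \<epsilon>))
  that a regular word can have.\<close>

lemma path_prob_regular_le:
  assumes dst: "distortion k h L \<epsilon> r0" and r0: "0 < r0" and \<epsilon>: "0 \<le> \<epsilon>" and \<kappa>: "0 < \<kappa>"
    and ball: "\<And>y. y \<in> closure U \<inter> cball 0 R \<Longrightarrow> \<exists>u. cball u \<kappa> \<subseteq> U \<and> dist u y + \<kappa> \<le> r0"
    and m: "m \<le> n" and E: "closed E" "bounded E" "diameter E \<le> exp (real n * mean L)"
  shows "path_prob m (\<lambda>v. {y \<in> closure U \<inter> cball 0 R. regular \<epsilon> n v y \<and> orbit h v y \<in> E})
    \<le> ennreal (((1 + r0) / \<kappa>) ^ DIM('a) * exp (real n * (mean lp + \<epsilon> + 4 * \<epsilon> * DIM('a))))"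
proof -
  define A where "A v = {y \<in> closure U \<inter> cball 0 R. regular \<epsilon> n v y \<and> orbit h v y \<in> E}" for v
  define V where "V = {v \<in> words k m. A v \<noteq> {}}"
  let ?e = "exp (real n * (mean lp + \<epsilon>))"
  have "path_prob m A \<le> (\<integral>\<^sup>+x. ennreal (real (card V) * ?e) \<partial>\<nu>)"
    unfolding path_prob_def
  proof (rule nn_integral_mono)
    fix x
    have "(\<Sum>v\<in>words k m. ennreal (weight h p v x) * indicator (A v) x) \<le> (\<Sum>v\<in>words k m. if v \<in> V then ennreal ?e else 0)"
    proof (intro sum_mono)
      fix v assume v: "v \<in> words k m"
      show "ennreal (weight h p v x) * indicator (A v) x \<le> (if v \<in> V then ennreal ?e else 0)"
      proof (cases "x \<in> A v")
        case True
        then have "regular \<epsilon> n v x" by (simp add: A_def)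
        then have "birkhoff h lp v x \<le> real n * (mean lp + \<epsilon>)"
          by (auto simp: regular_def abs_le_iff algebra_simps)
        then have "weight h p v x \<le> ?e" using weight_eq_exp_lp[OF v] by simp
        then show ?thesis using True v by (auto simp: V_def intro: ennreal_leI)
      qed simp
    qed
    also have "\<dots> = (\<Sum>v\<in>V. ennreal ?e)"
      by (intro sum.mono_neutral_cong_right) (auto simp: V_def)
    also have "\<dots> = ennreal (real (card V) * ?e)"
      by (simp add: ennreal_of_nat_eq_real_of_nat ennreal_mult[symmetric])
    finally show "(\<Sum>v\<in>words k m. ennreal (weight h p v x) * indicator (A v) x) \<le> ennreal (real (card V) * ?e)" .
  qed
  also have "\<dots> = ennreal (real (card V) * ?e)" using emeasure_space_1 by simp
  also have "\<dots> \<le> ennreal (((1 + r0) / \<kappa>) ^ DIM('a) * exp (real n * (4 * \<epsilon> * DIM('a))) * ?e)"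
  proof (intro ennreal_leI mult_right_mono)
    show "real (card V) \<le> ((1 + r0) / \<kappa>) ^ DIM('a) * exp (real n * (4 * \<epsilon> * DIM('a)))"
    proof (rule card_meeting_words[OF dst r0 \<epsilon> \<kappa> ball m _ E(2,3)])
      fix v assume "v \<in> V"
      then show "\<exists>y\<in>closure U \<inter> cball 0 R. regular \<epsilon> n v y \<and> orbit h v y \<in> E"
        by (auto simp: V_def A_def)
    qed (auto simp: V_def)
  qed simp
  also have "((1 + r0) / \<kappa>) ^ DIM('a) * exp (real n * (4 * \<epsilon> * DIM('a))) * ?e
      = ((1 + r0) / \<kappa>) ^ DIM('a) * exp (real n * (mean lp + \<epsilon> + 4 * \<epsilon> * DIM('a)))"
    unfolding mult.assoc exp_add[symmetric] by (simp add: algebra_simps)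
  finally show ?thesis unfolding A_def .
qed

end

section \<open>Comparison of scales and the mass of small sets\<close>

lemma scale_growth:
  fixes \<kappa> \<sigma> K :: real and Q :: nat
  assumes "0 < \<sigma>" "\<sigma> < \<kappa>" "0 \<le> K" "1 \<le> Q"
  shows "\<exists>J. \<forall>j\<ge>J. (real (j ^ Q) + 1) * K * exp (- (\<kappa> * real (j ^ Q))) \<le> exp (- (\<sigma> * real (Suc j ^ Q)))"
proof -
  \<comment> \<open>A set of a cover is located only between two consecutive lengths j^Q and (j +
    1)^Q. One half of the gap between \<kappa> and \<sigma> pays for the polynomial factor, the
    other for the ratio of the two lengths, which tends to 1.\<close>
  define m where "m = (\<kappa> + \<sigma>) / 2"
  have m: "\<sigma> < m" "m < \<kappa>" using assms by (auto simp: m_def)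
  have "(\<lambda>n. (real n + 1) * K * exp (- ((\<kappa> - m) * real n))) \<longlonglongrightarrow> 0"
    using m by real_asymp
  then have "\<forall>\<^sub>F n in sequentially. (real n + 1) * K * exp (- ((\<kappa> - m) * real n)) < 1"
    by (rule order_tendstoD) simp
  then obtain n0 where n0: "\<And>n. n \<ge> n0 \<Longrightarrow> (real n + 1) * K * exp (- ((\<kappa> - m) * real n)) < 1"
    unfolding eventually_sequentially by blast
  have "(\<lambda>j. (real (Suc j) / real j)) \<longlonglongrightarrow> 1" by real_asymp
  then have "(\<lambda>j. (real (Suc j) / real j) ^ Q) \<longlonglongrightarrow> 1 ^ Q" by (rule tendsto_power)
  then have "(\<lambda>j. (real (Suc j) / real j) ^ Q) \<longlonglongrightarrow> 1" by simp
  moreover have "1 < m / \<sigma>" using m assms by simp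
  ultimately have "\<forall>\<^sub>F j in sequentially. (real (Suc j) / real j) ^ Q < m / \<sigma>"
    by (rule order_tendstoD)
  then obtain j0 where j0: "\<And>j. j \<ge> j0 \<Longrightarrow> (real (Suc j) / real j) ^ Q < m / \<sigma>"
    unfolding eventually_sequentially by blast
  have "(real (j ^ Q) + 1) * K * exp (- (\<kappa> * real (j ^ Q))) \<le> exp (- (\<sigma> * real (Suc j ^ Q)))"
    if j: "j \<ge> max 1 (max n0 j0)" for j
  proof -
    have "j \<le> j ^ Q" using j assms by (intro self_le_power) auto
    then have "n0 \<le> j ^ Q" using j by simp
    have "(real (j ^ Q) + 1) * K * exp (- (\<kappa> * real (j ^ Q)))
        = ((real (j ^ Q) + 1) * K * exp (- ((\<kappa> - m) * real (j ^ Q)))) * exp (- (m * real (j ^ Q)))"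
      unfolding mult.assoc exp_add[symmetric] by (simp add: algebra_simps)
    also have "\<dots> \<le> 1 * exp (- (m * real (j ^ Q)))"
      using n0[OF \<open>n0 \<le> j ^ Q\<close>] by (intro mult_right_mono) auto
    also have "\<dots> \<le> exp (- (\<sigma> * real (Suc j ^ Q)))"
    proof -
      have "(real (Suc j) / real j) ^ Q < m / \<sigma>" using j0[of j] j by simp
      then have "real (Suc j ^ Q) * \<sigma> \<le> m * real (j ^ Q)"
        using j assms by (simp add: power_divide field_simps)
      then show ?thesis by (simp add: mult.commute)
    qed
    finally show ?thesis .
  qed
  then show ?thesis by blast
qed

text \<open>The level j is the one whose consecutive scales enclose D. A set of diameter 0 has no
  such level, and there a level with an error below e is taken.\<close>

lemma scale_of_diameter:
  fixes D \<Lambda> t e :: real and Q J :: nat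
  assumes D: "0 \<le> D" "D \<le> exp (- (\<Lambda> * real (J ^ Q)))" and pos: "0 < \<Lambda>" "0 < t" "0 < e" "1 \<le> Q"
  shows "\<exists>j\<ge>J. D \<le> exp (- (\<Lambda> * real (j ^ Q))) \<and> exp (- (t * \<Lambda> * real (Suc j ^ Q))) \<le> D powr t + e"
proof -
  have lim: "\<exists>j\<ge>J. exp (- (c * real (Suc j ^ Q))) < d" if "0 < c" "0 < d" for c d
  proof -
    have "(\<lambda>j. exp (- (c * real j))) \<longlonglongrightarrow> 0" using that by real_asymp
    then have "\<forall>\<^sub>F j in sequentially. exp (- (c * real j)) < d" using that(2) by (rule order_tendstoD)
    then obtain j0 where j0: "\<And>j. j \<ge> j0 \<Longrightarrow> exp (- (c * real j)) < d"
      unfolding eventually_sequentially by blast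
    define j where "j = max J j0"
    have "j \<le> Suc j ^ Q" using self_le_power[of "Suc j" Q] pos by simp
    then have "j0 \<le> Suc j ^ Q" by (simp add: j_def)
    show ?thesis
    proof (intro exI conjI)
      show "J \<le> j" by (simp add: j_def)
      show "exp (- (c * real (Suc j ^ Q))) < d" by (rule j0) fact
    qed
  qed
  show ?thesis
  proof (cases "D = 0")
    case True
    then show ?thesis using lim[of "t * \<Lambda>" e] pos by (auto intro: less_imp_le)
  next
    case False
    define P where "P j \<longleftrightarrow> exp (- (\<Lambda> * real (Suc j ^ Q))) < D" for j
    have "\<exists>j. P j" using lim[of \<Lambda> D] pos D False by (auto simp: P_def)
    then have P: "P (LEAST j. P j)" by (rule LeastI_ex)
    define j where "j = (LEAST j. P j)"
    have "J \<le> j"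
    proof (rule ccontr)
      assume "\<not> J \<le> j"
      then have "Suc j ^ Q \<le> J ^ Q" by (intro power_mono) auto
      then have "exp (- (\<Lambda> * real (J ^ Q))) \<le> exp (- (\<Lambda> * real (Suc j ^ Q)))"
        using pos by (simp only: exp_le_cancel_iff neg_le_iff_le mult_le_cancel_left_pos of_nat_le_iff)
      moreover have "exp (- (\<Lambda> * real (Suc j ^ Q))) < D" using P by (simp only: P_def j_def)
      ultimately show False using D(2) by linarith
    qed
    moreover have "D \<le> exp (- (\<Lambda> * real (j ^ Q)))"
    proof (cases j)
      case 0
      then show ?thesis using \<open>J \<le> j\<close> D by simp
    next
      case (Suc i)
      then have "\<not> P i" using not_less_Least[of i P] by (simp add: j_def)
      then show ?thesis by (simp add: P_def Suc)
    qed
    moreover have "exp (- (t * \<Lambda> * real (Suc j ^ Q))) \<le> D powr t"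
    proof -
      have "exp (- (t * \<Lambda> * real (Suc j ^ Q))) = exp (- (\<Lambda> * real (Suc j ^ Q))) powr t"
        by (simp add: exp_powr_real algebra_simps)
      also have "\<dots> \<le> D powr t" using P pos by (intro powr_mono2) (auto simp: P_def j_def)
      finally show ?thesis .
    qed
    ultimately show ?thesis using pos by (intro exI[of _ j]) auto
  qed
qed

context conformal_osc
begin

text \<open>Split by the regular time: stationarity removes the prefix, and each of the n + 1 cases
  is an event about regular words of length n - \<tau>. The point reached is in the closure of U
  because this set is invariant.\<close>

lemma path_prob_good_le:
  assumes dst: "distortion k h L \<epsilon> r0" and r0: "0 < r0" and \<epsilon>: "0 \<le> \<epsilon>" and \<kappa>: "0 < \<kappa>"
    and ball: "\<And>y. y \<in> closure U \<inter> cball 0 R \<Longrightarrow> \<exists>u. cball u \<kappa> \<subseteq> U \<and> dist u y + \<kappa> \<le> r0"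
    and E: "closed E" "bounded E" "diameter E \<le> exp (real n * mean L)"
    and good: "\<forall>w\<in>words k n. \<forall>x. x \<notin> Bad w \<longrightarrow>
      (\<exists>\<tau>\<le>n. norm (orbit h (take \<tau> w) x) \<le> R \<and> regular \<epsilon> n (drop \<tau> w) (orbit h (take \<tau> w) x))"
  shows "path_prob n (\<lambda>w. {x \<in> closure U. x \<notin> Bad w \<and> orbit h w x \<in> E})
    \<le> ennreal ((real n + 1) * ((1 + r0) / \<kappa>) ^ DIM('a) * exp (real n * (mean lp + \<epsilon> + 4 * \<epsilon> * DIM('a))))"
proof -
  define A where "A v = {y \<in> closure U \<inter> cball 0 R. regular \<epsilon> n v y \<and> orbit h v y \<in> E}" for v
  let ?b = "((1 + r0) / \<kappa>) ^ DIM('a) * exp (real n * (mean lp + \<epsilon> + 4 * \<epsilon> * DIM('a)))"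
  have A_borel: "A v \<in> sets borel" if v: "v \<in> words k m" for v m
  proof -
    have "orbit h v -` E \<inter> space borel \<in> sets borel"
      using measurable_orbit[OF v] borel_closed[OF E(1)] by (rule measurable_sets)
    moreover have "A v = (closure U \<inter> cball 0 R) \<inter> {y. regular \<epsilon> n v y} \<inter> (orbit h v -` E)"
      by (auto simp: A_def)
    ultimately show ?thesis using sets_regular[OF v, of \<epsilon> n] by auto
  qed
  have "path_prob n (\<lambda>w. {x \<in> closure U. x \<notin> Bad w \<and> orbit h w x \<in> E})
      \<le> path_prob n (\<lambda>w. \<Union>\<tau>\<in>{..n}. orbit h (take \<tau> w) -` A (drop \<tau> w))"
  proof (rule path_prob_mono, rule subsetI)
    fix w x assume w: "w \<in> words k n" and x: "x \<in> {x \<in> closure U. x \<notin> Bad w \<and> orbit h w x \<in> E}"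
    then obtain \<tau> where \<tau>: "\<tau> \<le> n" "norm (orbit h (take \<tau> w) x) \<le> R"
      "regular \<epsilon> n (drop \<tau> w) (orbit h (take \<tau> w) x)" using good by blast
    have "orbit h (take \<tau> w) x \<in> closure U"
      using closure_U_invariant take_words[OF w \<tau>(1)] x by (intro orbit_subset[where k = k and n = \<tau>]) auto
    moreover have "orbit h (drop \<tau> w) (orbit h (take \<tau> w) x) = orbit h w x"
      using orbit_append[of h "take \<tau> w" "drop \<tau> w" x] by simp
    ultimately have "orbit h (take \<tau> w) x \<in> A (drop \<tau> w)" using \<tau> x by (simp add: A_def)
    then show "x \<in> (\<Union>\<tau>\<in>{..n}. orbit h (take \<tau> w) -` A (drop \<tau> w))" using \<tau> by blast
  qed
  also have "\<dots> \<le> (\<Sum>\<tau>\<in>{..n}. path_prob n (\<lambda>w. orbit h (take \<tau> w) -` A (drop \<tau> w)))"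
  proof (rule path_prob_UN_le)
    fix \<tau> w assume \<tau>: "\<tau> \<in> {..n}" and w: "w \<in> words k n"
    have "orbit h (take \<tau> w) -` A (drop \<tau> w) \<inter> space borel \<in> sets borel"
      using measurable_orbit[OF take_words[OF w]] A_borel[OF drop_words[OF w]] \<tau>
      by (intro measurable_sets) auto
    then show "orbit h (take \<tau> w) -` A (drop \<tau> w) \<in> sets borel" by simp
  qed simp
  also have "\<dots> \<le> (\<Sum>\<tau>\<in>{..n}. ennreal ?b)"
  proof (rule sum_mono)
    fix \<tau> assume "\<tau> \<in> {..n}"
    then have "path_prob n (\<lambda>w. orbit h (take \<tau> w) -` A (drop \<tau> w)) = path_prob (n - \<tau>) A"
      using path_prob_suffix[of "n - \<tau>" A \<tau>] A_borel by simp
    also have "\<dots> \<le> ennreal ?b"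
      unfolding A_def by (rule path_prob_regular_le[OF dst r0 \<epsilon> \<kappa> ball _ E]) auto
    finally show "path_prob n (\<lambda>w. orbit h (take \<tau> w) -` A (drop \<tau> w)) \<le> ennreal ?b" .
  qed
  also have "\<dots> = ennreal ((real n + 1) * ?b)"
  proof -
    define b where "b = ?b"
    have "0 \<le> b" using r0 \<kappa> by (simp add: b_def)
    then have "(\<Sum>\<tau>\<in>{..n}. ennreal b) = ennreal (\<Sum>\<tau>\<in>{..n}. b)" by (simp only: sum_ennreal)
    then show ?thesis unfolding b_def[symmetric] by (simp add: add.commute)
  qed
  finally show ?thesis by (simp add: mult.assoc)
qed

text \<open>Frostman's argument at finite levels: for finitely many sets of a cover, all the relevant
  cylinder levels are compared inside the law of words of one common length.\<close>

lemma null_of_hausdorff_null: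
  assumes t: "0 < t" "t * (- mean L) < - mean lp"
    and Y: "Y \<in> sets borel" "hausdorff_measure t Y = 0"
  shows "emeasure \<nu> Y = 0"
proof (rule ccontr)
  assume "emeasure \<nu> Y \<noteq> 0"
  define a where "a = measure \<nu> Y"
  have aY: "emeasure \<nu> Y = ennreal a" by (simp add: a_def emeasure_eq_measure)
  have a: "0 < a"
    using \<open>emeasure \<nu> Y \<noteq> 0\<close> aY by (metis a_def ennreal_0 measure_nonneg less_eq_real_def)
  define \<Lambda> where "\<Lambda> = - mean L"
  define d where "d = real DIM('a)"
  have \<Lambda>: "0 < \<Lambda>" using mean_neg by (simp add: \<Lambda>_def)
  have d: "0 < d" by (simp add: d_def)
  define g where "g = - mean lp - t * \<Lambda>"
  have g: "0 < g" using t by (simp add: g_def \<Lambda>_def)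
  \<comment> \<open>Chosen so that the decay rate \<beta> of the mass of a set at level n still
    exceeds t \<Lambda>, the rate of the t-th power of its diameter.\<close>
  define \<epsilon> where "\<epsilon> = min (\<Lambda> / 4) (g / (2 * (1 + 4 * d)))"
  have \<epsilon>: "0 < \<epsilon>" "4 * \<epsilon> \<le> \<Lambda>" using \<Lambda> g d by (auto simp: \<epsilon>_def)
  have "\<epsilon> \<le> g / (2 * (1 + 4 * d))" by (simp add: \<epsilon>_def)
  then have "\<epsilon> * (2 * (1 + 4 * d)) \<le> g" using d by (simp add: pos_le_divide_eq)
  then have \<epsilon>g: "\<epsilon> + 4 * \<epsilon> * d < g" using g by (simp add: algebra_simps)
  obtain R C \<gamma> N Bad where R: "0 < R" and C: "0 \<le> C" "0 < \<gamma>" and N: "1 \<le> N"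
    and meas: "\<forall>n w. w \<in> words k n \<longrightarrow> Bad n w \<in> sets borel"
    and prob: "\<forall>n\<ge>N. path_prob n (Bad n) \<le> ennreal (C * real n powr (- \<gamma>))"
    and good: "\<forall>n\<ge>N. \<forall>w\<in>words k n. \<forall>x. x \<notin> Bad n w \<longrightarrow>
      (\<exists>\<tau>\<le>n. norm (orbit h (take \<tau> w) x) \<le> R \<and> regular \<epsilon> n (drop \<tau> w) (orbit h (take \<tau> w) x))"
    using regular_times[of \<epsilon>] \<epsilon> \<Lambda>_def by auto
  obtain r0 where r0: "0 < r0" and dst: "distortion k h L \<epsilon> r0"
    by (rule distortion_scale[OF \<epsilon>(1)]) (rule that)
  obtain \<kappa> where \<kappa>: "0 < \<kappa>"
    and ball: "\<forall>y\<in>closure U \<inter> cball 0 R. \<exists>u. cball u \<kappa> \<subseteq> U \<and> dist u y + \<kappa> \<le> r0"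
    using uniform_inner_ball[OF U(1) r0] by blast
  define K where "K = ((1 + r0) / \<kappa>) ^ DIM('a)"
  have K: "0 \<le> K" using r0 \<kappa> by (simp add: K_def)
  define \<beta> where "\<beta> = - mean lp - \<epsilon> - 4 * \<epsilon> * d"
  have \<beta>: "t * \<Lambda> < \<beta>" using \<epsilon>g by (simp add: \<beta>_def g_def)
  define G where "G n E w = {x \<in> closure U. x \<notin> Bad n w \<and> orbit h w x \<in> E}" for n E w
  have G_le: "path_prob n (G n E) \<le> ennreal ((real n + 1) * K * exp (- (\<beta> * real n)))"
    if "n \<ge> N" "closed E" "bounded E" "diameter E \<le> exp (- (\<Lambda> * real n))" for n E
  proof -
    have "path_prob n (G n E)
        \<le> ennreal ((real n + 1) * K * exp (real n * (mean lp + \<epsilon> + 4 * \<epsilon> * DIM('a))))"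
      unfolding G_def K_def
    proof (rule path_prob_good_le[OF dst r0 _ \<kappa> _ that(2,3)])
      show "diameter E \<le> exp (real n * mean L)" using that(4) by (simp add: \<Lambda>_def mult.commute)
      show "\<forall>w\<in>words k n. \<forall>x. x \<notin> Bad n w \<longrightarrow>
        (\<exists>\<tau>\<le>n. norm (orbit h (take \<tau> w) x) \<le> R \<and> regular \<epsilon> n (drop \<tau> w) (orbit h (take \<tau> w) x))"
        using good that(1) by blast
    qed (use \<epsilon> ball in auto)
    also have "real n * (mean lp + \<epsilon> + 4 * \<epsilon> * DIM('a)) = - (\<beta> * real n)"
      by (simp add: \<beta>_def d_def algebra_simps)
    finally show ?thesis .
  qed
  have G_borel: "G n E w \<in> sets borel" if "w \<in> words k n" "closed E" for n E w
  proof -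
    have "orbit h w -` E \<inter> space borel \<in> sets borel"
      using measurable_orbit[OF that(1)] borel_closed[OF that(2)] by (rule measurable_sets)
    moreover have "G n E w = closure U \<inter> (- Bad n w) \<inter> (orbit h w -` E)" by (auto simp: G_def)
    moreover have "Bad n w \<in> sets borel" using meas that by blast
    ultimately show ?thesis by auto
  qed
  \<comment> \<open>Q \<gamma> >= 2 bounds the exceptional probability at the length j^Q by C /
    j^2.\<close>
  obtain Q where Q: "2 / \<gamma> < real Q" using reals_Archimedean2 by blast
  have Q1: "1 \<le> Q"
  proof -
    have "0 < 2 / \<gamma>" using C by simp
    then show ?thesis using Q by linarith
  qed
  have Q\<gamma>: "2 \<le> real Q * \<gamma>" using Q C by (simp add: field_simps)
  define ns where "ns j = j ^ Q" for j :: nat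
  define f where "f j = C * real j powr (- 2)" for j :: nat
  have f0: "0 \<le> f j" for j using C by (simp add: f_def)
  have summ: "summable f"
    unfolding f_def[abs_def] by (intro summable_mult) (simp add: summable_real_powr_iff)
  obtain J0 where J0: "\<And>j. j \<ge> J0 \<Longrightarrow>
      (real (ns j) + 1) * K * exp (- (\<beta> * real (ns j))) \<le> exp (- (t * \<Lambda> * real (ns (Suc j))))"
    using scale_growth[of "t * \<Lambda>" \<beta> K Q] t \<Lambda> \<beta> K Q1 unfolding ns_def by auto
  obtain J1 where J1: "\<And>n. n \<ge> J1 \<Longrightarrow> norm (\<Sum>i. f (i + n)) < a / 4"
    using suminf_exist_split[OF _ summ, of "a / 4"] a by auto
  define J where "J = max (max 1 N) (max J0 J1)"
  have J: "1 \<le> J" "N \<le> J" "J0 \<le> J" "J1 \<le> J" by (auto simp: J_def)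
  have ns_ge: "j \<le> ns j" if "1 \<le> j" for j unfolding ns_def using that Q1 by (intro self_le_power) auto
  have nsN: "N \<le> ns j" if "J \<le> j" for j
    using ns_ge[of j] J that by linarith
  have bad_le: "path_prob (ns j) (Bad (ns j)) \<le> ennreal (f j)" if "J \<le> j" for j
  proof -
    have j1: "1 \<le> j" using that J by linarith
    have "real (ns j) powr (- \<gamma>) = real j powr (- (real Q * \<gamma>))"
      using j1 by (simp add: ns_def powr_realpow[symmetric] powr_powr)
    also have "\<dots> \<le> real j powr (- 2)" using j1 Q\<gamma> by (intro powr_mono) auto
    finally have "C * real (ns j) powr (- \<gamma>) \<le> f j"
      unfolding f_def using C by (intro mult_left_mono)
    then show ?thesis using prob[rule_format, OF nsN[OF that]] by (meson ennreal_leI order.trans)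
  qed
  have tail: "sum f S \<le> a / 4" if S: "finite S" "S \<subseteq> {J..}" for S
  proof -
    have "sum f S = (\<Sum>i\<in>(\<lambda>j. j - J) ` S. f (i + J))"
    proof (subst sum.reindex)
      show "inj_on (\<lambda>j. j - J) S" using S by (intro inj_on_diff_nat) auto
    qed (use S in \<open>auto intro!: sum.cong\<close>)
    also have "\<dots> \<le> (\<Sum>i. f (i + J))"
      using S summ f0 by (intro sum_le_suminf) (auto simp: summable_iff_shift)
    also have "\<dots> \<le> a / 4" using J1[OF J(4)] by simp
    finally show ?thesis .
  qed
  \<comment> \<open>A mesh so fine that every set of the cover gets a level at least J, where all
    the preceding estimates hold.\<close>
  define D0 where "D0 = exp (- (\<Lambda> * real (J ^ Q)))"
  have "hausdorff_pre t D0 Y < ennreal (a / 4)"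
    using Y(2) a by (simp add: hausdorff_measure_0_iff D0_def)
  then have "\<exists>W\<in>{W. Y \<subseteq> (\<Union>n. W n) \<and> (\<forall>n. bounded (W n) \<and> diameter (W n) \<le> D0)}.
      (\<Sum>n. ennreal (diameter (W n) powr t)) < ennreal (a / 4)"
    unfolding hausdorff_pre_def INF_less_iff .
  then obtain W where W0: "W \<in> {W. Y \<subseteq> (\<Union>n. W n) \<and> (\<forall>n. bounded (W n) \<and> diameter (W n) \<le> D0)}"
    and Wsum: "(\<Sum>n. ennreal (diameter (W n) powr t)) < ennreal (a / 4)" by (rule bexE)
  have W: "Y \<subseteq> (\<Union>n::nat. W n)" "\<forall>n. bounded (W n) \<and> diameter (W n) \<le> D0" using CollectD[OF W0] by simp_all
  \<comment> \<open>The covering sets are arbitrary; their closures have the same diameters and give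
    Borel events.\<close>
  define E where "E l = closure (W l)" for l
  have E: "closed (E l)" "bounded (E l)" "diameter (E l) = diameter (W l)" "diameter (E l) \<le> D0" for l
    using W(2) by (simp_all add: E_def diameter_closure bounded_closure)
  \<comment> \<open>The errors for sets of diameter 0, with total a / 4.\<close>
  define e where "e l = a / 4 * (1 / 2) ^ Suc l" for l :: nat
  have e: "0 < e l" for l using a by (simp add: e_def)
  have "\<exists>j\<ge>J. diameter (E l) \<le> exp (- (\<Lambda> * real (j ^ Q))) \<and>
      exp (- (t * \<Lambda> * real (Suc j ^ Q))) \<le> diameter (E l) powr t + e l" for l
    using diameter_ge_0[OF E(2)] E(4)[of l] unfolding D0_def
    by (intro scale_of_diameter \<Lambda> t e Q1)
  then have "\<exists>jf. \<forall>l. jf l \<ge> J \<and> diameter (E l) \<le> exp (- (\<Lambda> * real (jf l ^ Q))) \<and>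
      exp (- (t * \<Lambda> * real (Suc (jf l) ^ Q))) \<le> diameter (E l) powr t + e l"
    by (intro choice allI)
  then obtain jf where jf: "\<forall>l. jf l \<ge> J \<and> diameter (E l) \<le> exp (- (\<Lambda> * real (jf l ^ Q))) \<and>
      exp (- (t * \<Lambda> * real (Suc (jf l) ^ Q))) \<le> diameter (E l) powr t + e l" by (rule exE)
  have GE: "path_prob (ns (jf l)) (G (ns (jf l)) (E l)) \<le> ennreal (diameter (W l) powr t) + ennreal (e l)" for l
  proof -
    have jl: "jf l \<ge> J" "diameter (E l) \<le> exp (- (\<Lambda> * real (ns (jf l))))"
      "exp (- (t * \<Lambda> * real (ns (Suc (jf l))))) \<le> diameter (E l) powr t + e l"
      using jf[THEN spec, of l] by (simp_all add: ns_def)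
    have "path_prob (ns (jf l)) (G (ns (jf l)) (E l))
        \<le> ennreal ((real (ns (jf l)) + 1) * K * exp (- (\<beta> * real (ns (jf l)))))"
      by (rule G_le[OF nsN[OF jl(1)] E(1,2) jl(2)])
    also have "\<dots> \<le> ennreal (diameter (E l) powr t + e l)"
      using J0[of "jf l"] jl(1,3) J(3) by (intro ennreal_leI) linarith
    also have "\<dots> = ennreal (diameter (W l) powr t) + ennreal (e l)"
      using e[of l] E(3) by (simp add: less_imp_le)
    finally show ?thesis .
  qed
  have esum: "(\<Sum>l<M. ennreal (e l)) \<le> ennreal (a / 4)" for M
  proof -
    have "(\<Sum>l. ennreal (e l)) = ennreal (a / 4 * 1)"
      unfolding e_def using a by (intro suminf_ennreal_eq sums_mult power_half_series) simp
    then show ?thesis using sum_le_suminf[OF summableI, of "{..<M}" "\<lambda>l. ennreal (e l)"] by simp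
  qed
  \<comment> \<open>At most a / 4 each for the exceptional events, for the t-th powers of the
    diameters and for the errors e; together less than the mass a of Y.\<close>
  have fin: "emeasure \<nu> (\<Union>l\<in>{..<M}. E l) \<le> ennreal (3 * a / 4)" for M
  proof -
    \<comment> \<open>A length exceeding all levels in use. A set of level n is tested on the last n
      letters, which by \<open>path_prob_suffix\<close> have the law of words of length n and lead
      to the same end point.\<close>
    define Nm where "Nm = (\<Sum>l<M. ns (jf l))"
    have Nm: "ns (jf l) \<le> Nm" if "l < M" for l
      unfolding Nm_def using that by (intro member_le_sum) auto
    \<comment> \<open>Exceptional events are counted once for each level, not for each set: many
      sets may share a level, and only the sum of f over distinct levels is below a / 4.\<close>
    define S where "S = jf ` {..<M}"
    have S: "finite S" "S \<subseteq> {J..}" using jf by (auto simp: S_def)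
    have NmS: "ns j \<le> Nm" if "j \<in> S" for j using that Nm by (auto simp: S_def)
    define A1 where "A1 w = (\<Union>j\<in>S. orbit h (take (Nm - ns j) w) -` Bad (ns j) (drop (Nm - ns j) w))" for w
    define A2 where "A2 w = (\<Union>l\<in>{..<M}. orbit h (take (Nm - ns (jf l)) w) -`
      G (ns (jf l)) (E l) (drop (Nm - ns (jf l)) w))" for w
    have vim: "orbit h (take (Nm - n) w) -` B (drop (Nm - n) w) \<in> sets borel"
      if "w \<in> words k Nm" "n \<le> Nm" and B: "\<And>v. v \<in> words k n \<Longrightarrow> B v \<in> sets borel" for w n B
    proof -
      have "drop (Nm - n) w \<in> words k n" using drop_words[OF that(1), of "Nm - n"] that(2) by simp
      moreover have "take (Nm - n) w \<in> words k (Nm - n)" by (rule take_words[OF that(1)]) simp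
      ultimately have "orbit h (take (Nm - n) w) -` B (drop (Nm - n) w) \<inter> space borel \<in> sets borel"
        using measurable_sets[OF measurable_orbit B] by blast
      then show ?thesis by simp
    qed
    have b1: "orbit h (take (Nm - ns j) w) -` Bad (ns j) (drop (Nm - ns j) w) \<in> sets borel"
      if "w \<in> words k Nm" "j \<in> S" for w j
      using that NmS meas by (intro vim) auto
    have b2: "orbit h (take (Nm - ns (jf l)) w) -` G (ns (jf l)) (E l) (drop (Nm - ns (jf l)) w) \<in> sets borel"
      if "w \<in> words k Nm" "l \<in> {..<M}" for w l
      using that Nm G_borel E(1) by (intro vim) auto
    have sfx: "path_prob Nm (\<lambda>w. orbit h (take (Nm - n) w) -` B (drop (Nm - n) w)) = path_prob n B"
      if "n \<le> Nm" "\<And>v. v \<in> words k n \<Longrightarrow> B v \<in> sets borel" for n B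
      using path_prob_suffix[of n B "Nm - n"] that by simp
    have "emeasure \<nu> (\<Union>l\<in>{..<M}. E l) = path_prob Nm (\<lambda>w. orbit h w -` (\<Union>l\<in>{..<M}. E l))"
      using E(1) by (intro path_prob_orbit[symmetric] sets.finite_UN borel_closed) auto
    also have "\<dots> \<le> path_prob Nm (\<lambda>w. A1 w \<union> A2 w)"
    proof (rule path_prob_mono_AE)
      show "AE x in \<nu>. \<forall>w\<in>words k Nm. x \<in> orbit h w -` (\<Union>l\<in>{..<M}. E l) \<longrightarrow> x \<in> A1 w \<union> A2 w"
        using AE_closure_U
      proof eventually_elim
        fix x assume x: "x \<in> closure U"
        show "\<forall>w\<in>words k Nm. x \<in> orbit h w -` (\<Union>l\<in>{..<M}. E l) \<longrightarrow> x \<in> A1 w \<union> A2 w"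
        proof (intro ballI impI)
          fix w assume w: "w \<in> words k Nm" and xw: "x \<in> orbit h w -` (\<Union>l\<in>{..<M}. E l)"
          then obtain l where l: "l < M" "orbit h w x \<in> E l" by auto
          let ?\<tau> = "Nm - ns (jf l)"
          have "orbit h (take ?\<tau> w) x \<in> closure U"
            using closure_U_invariant take_words[OF w, of ?\<tau>] x
            by (intro orbit_subset[where k = k and n = ?\<tau>]) auto
          moreover have "orbit h (drop ?\<tau> w) (orbit h (take ?\<tau> w) x) = orbit h w x"
            using orbit_append[of h "take ?\<tau> w" "drop ?\<tau> w" x] by simp
          ultimately have "orbit h (take ?\<tau> w) x \<in> Bad (ns (jf l)) (drop ?\<tau> w) \<union> G (ns (jf l)) (E l) (drop ?\<tau> w)"
            using l by (simp add: G_def)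
          then show "x \<in> A1 w \<union> A2 w" using l(1) by (auto simp: A1_def A2_def S_def)
        qed
      qed
    qed
    also have "\<dots> \<le> path_prob Nm A1 + path_prob Nm A2"
      using S b1 b2 unfolding A1_def A2_def by (intro path_prob_Un_le sets.finite_UN) auto
    also have "path_prob Nm A1 \<le> ennreal (a / 4)"
    proof -
      have "path_prob Nm A1 \<le> (\<Sum>j\<in>S. path_prob Nm (\<lambda>w. orbit h (take (Nm - ns j) w) -` Bad (ns j) (drop (Nm - ns j) w)))"
        unfolding A1_def using S b1 by (intro path_prob_UN_le)
      also have "\<dots> = (\<Sum>j\<in>S. path_prob (ns j) (Bad (ns j)))"
        using NmS meas by (intro sum.cong sfx) auto
      also have "\<dots> \<le> (\<Sum>j\<in>S. ennreal (f j))"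
        using S bad_le by (intro sum_mono) auto
      also have "\<dots> = ennreal (sum f S)" using f0 by (intro sum_ennreal)
      also have "\<dots> \<le> ennreal (a / 4)" using tail[OF S] by (rule ennreal_leI)
      finally show ?thesis .
    qed
    also have "path_prob Nm A2 \<le> ennreal (a / 4) + ennreal (a / 4)"
    proof -
      have "path_prob Nm A2 \<le> (\<Sum>l<M. path_prob Nm (\<lambda>w. orbit h (take (Nm - ns (jf l)) w) -`
          G (ns (jf l)) (E l) (drop (Nm - ns (jf l)) w)))"
        unfolding A2_def using b2 by (intro path_prob_UN_le) auto
      also have "\<dots> = (\<Sum>l<M. path_prob (ns (jf l)) (G (ns (jf l)) (E l)))"
        using Nm G_borel E(1) by (intro sum.cong sfx) auto
      also have "\<dots> \<le> (\<Sum>l<M. ennreal (diameter (W l) powr t) + ennreal (e l))"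
        using GE by (intro sum_mono)
      also have "\<dots> = (\<Sum>l<M. ennreal (diameter (W l) powr t)) + (\<Sum>l<M. ennreal (e l))"
        by (rule sum.distrib)
      also have "\<dots> \<le> (\<Sum>l. ennreal (diameter (W l) powr t)) + ennreal (a / 4)"
        by (intro add_mono sum_le_suminf summableI esum) auto
      also have "\<dots> \<le> ennreal (a / 4) + ennreal (a / 4)"
        using Wsum by (intro add_mono) auto
      finally show ?thesis .
    qed
    finally have "emeasure \<nu> (\<Union>l\<in>{..<M}. E l) \<le> ennreal (a / 4) + (ennreal (a / 4) + ennreal (a / 4))"
      by (simp add: add_mono)
    also have "\<dots> = ennreal (3 * a / 4)"
      using a by (simp add: ennreal_plus[symmetric] del: ennreal_plus)
    finally show ?thesis .
  qed
  have "emeasure \<nu> Y \<le> emeasure \<nu> (\<Union>M. \<Union>l\<in>{..<M}. E l)"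
  proof (rule emeasure_mono)
    show "Y \<subseteq> (\<Union>M. \<Union>l\<in>{..<M}. E l)"
    proof
      fix x assume "x \<in> Y"
      then obtain l where "x \<in> W l" using W(1) by blast
      then have "x \<in> E l" using closure_subset by (auto simp: E_def)
      then have "x \<in> (\<Union>l\<in>{..<Suc l}. E l)" by blast
      then show "x \<in> (\<Union>M. \<Union>l\<in>{..<M}. E l)" by (rule UN_I[OF UNIV_I])
    qed
    show "(\<Union>M. \<Union>l\<in>{..<M}. E l) \<in> sets \<nu>"
      using E(1) by (auto intro!: sets.countable_UN sets.finite_UN borel_closed)
  qed
  also have "\<dots> = (SUP M. emeasure \<nu> (\<Union>l\<in>{..<M}. E l))"
  proof (rule SUP_emeasure_incseq[symmetric])
    show "range (\<lambda>M. \<Union>l\<in>{..<M}. E l) \<subseteq> sets \<nu>"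
      using E(1) by (auto intro!: sets.finite_UN borel_closed)
    show "incseq (\<lambda>M. \<Union>l\<in>{..<M}. E l)" by (force simp: incseq_def)
  qed
  also have "\<dots> \<le> ennreal (3 * a / 4)" using fin by (rule SUP_least)
  finally have "ennreal a \<le> ennreal (3 * a / 4)" by (simp add: aY)
  then show False using a by (simp add: ennreal_le_iff)
qed

end

section \<open>The dimension formula\<close>

context conformal_osc
begin

text \<open>Exponents above s give the upper bound by a set of full measure, exponents below s
  exclude every set of positive measure. The remaining inequality is inclusion of the two families
  of sets, both nonempty and bounded below as real infima require.\<close>

lemma hdim_eq: "upper_hdim \<nu> = mean lp / mean L" "lower_hdim \<nu> = mean lp / mean L"
proof -
  define s where "s = mean lp / mean L"
  have s: "0 \<le> s" using lp_mean_nonpos mean_neg by (simp add: s_def divide_nonpos_neg)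
  let ?A = "{hausdorff_dim Y |Y. Y \<in> sets borel \<and> emeasure \<nu> Y = 1}"
  let ?B = "{hausdorff_dim Y |Y. Y \<in> sets borel \<and> emeasure \<nu> Y > 0}"
  have bdd: "bdd_below ?A" "bdd_below ?B"
    using hausdorff_dim_nonneg by (auto intro!: bdd_belowI[of _ 0])
  have "emeasure \<nu> UNIV = 1" using emeasure_space_1 by simp
  then have "hausdorff_dim (UNIV :: 'a set) \<in> ?A"
    by (intro CollectI exI[of _ UNIV]) simp
  then have ne: "?A \<noteq> {}" by blast
  have sub: "?A \<subseteq> ?B" by auto
  have "upper_hdim \<nu> \<le> t" if t: "s < t" for t
  proof -
    have "- mean lp < t * (- mean L)" using t mean_neg by (simp add: s_def neg_divide_less_eq)
    moreover have "0 < t" using t s by simp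
    ultimately obtain Y where Y: "Y \<in> sets borel" "emeasure \<nu> Y = 1" "hausdorff_measure t Y = 0"
      using upper_bound_set by blast
    have "upper_hdim \<nu> \<le> hausdorff_dim Y"
      unfolding upper_hdim_def using Y bdd by (intro cInf_lower) auto
    also have "\<dots> \<le> t" using \<open>0 < t\<close> Y(3) by (rule hausdorff_dim_le)
    finally show ?thesis .
  qed
  then have up: "upper_hdim \<nu> \<le> s" by (rule dense_ge)
  have low: "s \<le> lower_hdim \<nu>"
    unfolding lower_hdim_def
  proof (rule cInf_greatest)
    show "?B \<noteq> {}" using ne sub by blast
    fix x assume "x \<in> ?B"
    then obtain Y where Y: "x = hausdorff_dim Y" "Y \<in> sets borel" "emeasure \<nu> Y > 0" by blast
    have "s \<le> hausdorff_dim Y"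
    proof (rule hausdorff_dim_ge)
      fix t assume t: "0 < t" "t < s"
      then have "t * (- mean L) < - mean lp" using mean_neg by (simp add: s_def neg_less_divide_eq)
      then show "hausdorff_measure t Y \<noteq> 0"
        using null_of_hausdorff_null[OF t(1)] Y by auto
    qed
    then show "s \<le> x" by (simp add: Y)
  qed
  have "lower_hdim \<nu> \<le> upper_hdim \<nu>"
    unfolding lower_hdim_def upper_hdim_def using ne bdd(2) sub by (rule cInf_superset_mono)
  then show "upper_hdim \<nu> = mean lp / mean L" "lower_hdim \<nu> = mean lp / mean L"
    using up low by (simp_all add: s_def)
qed

end

section \<open>From the hypotheses of the theorem to the assumptions of the locales\<close>

lemma exp_le_quadratic: "exp x \<le> 1 + x + x\<^sup>2" if "\<bar>x\<bar> \<le> 1" for x :: real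
proof (cases "0 \<le> x")
  case True
  then show ?thesis using that exp_bound[of x] by simp
next
  case False
  \<comment> \<open>For negative x, multiply by 1 - x > 0: (1 - x) (1 + x + x^2) = 1 - x^3 is at
    least 1.\<close>
  then have "(1 - x) * exp x \<le> 1"
    using exp_ge_add_one_self[of "- x"] by (simp add: exp_minus field_simps)
  moreover have "1 \<le> (1 - x) * (1 + x + x\<^sup>2)"
    using False by (simp add: power2_eq_square algebra_simps mult_nonneg_nonpos zero_le_mult_iff mult_le_0_iff)
  ultimately have "(1 - x) * exp x \<le> (1 - x) * (1 + x + x\<^sup>2)" by linarith
  then show ?thesis using False by (simp add: mult_le_cancel_left)
qed

text \<open>Truncating the logarithms from below at \<^term>\<open>- K\<close> keeps their weighted average below \<^term>\<open>- b\<close>: if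
  some logarithm is below \<^term>\<open>- K\<close>, its weight is at least \<^term>\<open>\<delta>\<close> and the others are at most \<^term>\<open>ln M\<close>.\<close>

lemma average_contraction_exponent:
  fixes h :: "nat \<Rightarrow> 'a::metric_space \<Rightarrow> 'a" and p :: "nat \<Rightarrow> 'a \<Rightarrow> real"
  assumes p: "\<And>i x. i < k \<Longrightarrow> \<delta> \<le> p i x" "0 < \<delta>" "\<And>x. (\<Sum>i<k. p i x) = 1"
    and M: "1 \<le> M" "\<And>i x y. i < k \<Longrightarrow> dist (h i x) (h i y) \<le> M * dist x y"
    and b: "0 < b" and \<alpha>: "0 < \<alpha>"
    and contr: "\<And>x y. x \<noteq> y \<Longrightarrow> (\<exists>j<k. h j x = h j y) \<or>
                  (\<Sum>j<k. p j x * ln (dist (h j x) (h j y) / dist x y)) < - b"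
  obtains q \<rho> where "0 < q" "q \<le> \<alpha>" "0 < \<rho>" "\<rho> < 1"
    "\<And>x y. (\<Sum>i<k. p i x * dist (h i x) (h i y) powr q) \<le> \<rho> * dist x y powr q"
proof -
  \<comment> \<open>Large enough that one truncated logarithm of weight \<delta> forces the average
    below - b, that is ln M - \<delta> K <= - b, and that K bounds all truncated logarithms in
    absolute value.\<close>
  define K where "K = (ln M + b) / \<delta> + ln M"
  have lnM: "0 \<le> ln M" using M by simp
  have K: "0 < K" "ln M \<le> K" "(ln M + b) / \<delta> \<le> K"
    using lnM b p(2) by (auto simp: K_def intro!: add_pos_nonneg divide_nonneg_nonneg)
  \<comment> \<open>q K <= 1 is the range of \<open>exp_le_quadratic\<close>, and q K^2 <= b / 2
    makes the quadratic term at most half of the linear gain q b.\<close>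
  define q where "q = min \<alpha> (min (1 / K) (b / (2 * K\<^sup>2)))"
  have q: "0 < q" "q \<le> \<alpha>" "q \<le> 1 / K" "q \<le> b / (2 * K\<^sup>2)"
    using \<alpha> K b by (auto simp: q_def)
  define \<rho> where "\<rho> = max (1 / 2) (1 - q * b / 2)"
  have \<rho>: "0 < \<rho>" "\<rho> < 1" using q b by (auto simp: \<rho>_def)
  have "(\<Sum>i<k. p i x * dist (h i x) (h i y) powr q) \<le> \<rho> * dist x y powr q" for x y
  proof (cases "x = y")
    case False
    then have d: "0 < dist x y" by simp
    define t where "t i = dist (h i x) (h i y) / dist x y" for i
    have t: "0 \<le> t i" "t i \<le> M" if "i < k" for i
      using M(2)[OF that, of x y] d by (auto simp: t_def pos_divide_le_eq)
    define u where "u i = (if t i = 0 then - K else max (- K) (ln (t i)))" for i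
    have u_le: "u i \<le> ln M" "\<bar>u i\<bar> \<le> K" if "i < k" for i
    proof -
      show "u i \<le> ln M"
      proof (cases "t i = 0")
        case True
        then show ?thesis using K(1) lnM by (simp add: u_def)
      next
        case False
        then have "ln (t i) \<le> ln M" using t[OF that] by simp
        then show ?thesis using False K(1) lnM by (simp add: u_def)
      qed
      then show "\<bar>u i\<bar> \<le> K" using K by (auto simp: u_def abs_le_iff)
    qed
    have p0: "0 \<le> p i x" if "i < k" for i using p(1)[OF that, of x] p(2) by linarith
    have avg: "(\<Sum>i<k. p i x * u i) \<le> - b"
    \<comment> \<open>Points identified by some map belong to the first case: the quotient is 0, its
      \<open>ln\<close> carries no information, and the truncated value - K is used.\<close>
    proof (cases "\<exists>j<k. t j = 0 \<or> ln (t j) < - K")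
      case True
      then obtain j where j: "j < k" "t j = 0 \<or> ln (t j) < - K" by blast
      then have uj: "u j = - K" by (auto simp: u_def)
      have "(\<Sum>i<k. p i x * u i) = p j x * u j + (\<Sum>i\<in>{..<k} - {j}. p i x * u i)"
        using j by (intro sum.remove) auto
      also have "(\<Sum>i\<in>{..<k} - {j}. p i x * u i) \<le> (\<Sum>i\<in>{..<k} - {j}. p i x * ln M)"
        using u_le p0 by (intro sum_mono mult_left_mono) auto
      also have "\<dots> \<le> (\<Sum>i<k. p i x * ln M)"
        using p0 lnM by (intro sum_mono2) auto
      also have "\<dots> = ln M" by (simp add: sum_distrib_right[symmetric] p(3))
      also have "p j x * u j \<le> \<delta> * (- K)"
        unfolding uj using p(1)[OF j(1), of x] K by simp
      also have "\<delta> * (- K) + ln M \<le> - b"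
        using K(3) p(2) by (simp add: field_simps)
      finally show ?thesis by simp
    next
      case False
      have nz: "t i \<noteq> 0" "u i = ln (t i)" if "i < k" for i
      proof -
        have "t i \<noteq> 0 \<and> - K \<le> ln (t i)" using False that by auto
        then show "t i \<noteq> 0" "u i = ln (t i)" by (simp_all add: u_def)
      qed
      then have "\<not> (\<exists>j<k. h j x = h j y)" by (auto simp: t_def)
      then have "(\<Sum>j<k. p j x * ln (t j)) < - b" using contr[OF \<open>x \<noteq> y\<close>] unfolding t_def by blast
      then show ?thesis using nz by simp
    qed
    have tq: "t i powr q \<le> 1 + q * u i + q\<^sup>2 * K\<^sup>2" if i: "i < k" for i
    proof -
      have "t i powr q \<le> exp (q * u i)"
      proof (cases "t i = 0")
        case False
        then have "t i powr q = exp (q * ln (t i))" by (simp add: powr_def)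
        also have "\<dots> \<le> exp (q * u i)" using q False by (auto simp: u_def intro!: mult_left_mono)
        finally show ?thesis .
      qed simp
      also have "\<bar>q * u i\<bar> \<le> 1"
      proof -
        have "\<bar>q * u i\<bar> \<le> (1 / K) * K"
          unfolding abs_mult using q K u_le[OF i] by (intro mult_mono) auto
        then show ?thesis using K by simp
      qed
      then have "exp (q * u i) \<le> 1 + q * u i + (q * u i)\<^sup>2" by (rule exp_le_quadratic)
      also have "(q * u i)\<^sup>2 \<le> q\<^sup>2 * K\<^sup>2"
        unfolding power_mult_distrib using u_le[OF i] K
        by (intro mult_left_mono) (auto simp: abs_le_square_iff[symmetric])
      finally show ?thesis by simp
    qed
    have "(\<Sum>i<k. p i x * t i powr q) \<le> (\<Sum>i<k. p i x * (1 + q * u i + q\<^sup>2 * K\<^sup>2))"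
      using tq p0 by (intro sum_mono mult_left_mono) auto
    also have "\<dots> = (\<Sum>i<k. p i x) * (1 + q\<^sup>2 * K\<^sup>2) + q * (\<Sum>i<k. p i x * u i)"
      unfolding sum_distrib_right sum_distrib_left sum.distrib[symmetric]
      by (intro sum.cong) (simp_all add: algebra_simps)
    also have "\<dots> \<le> 1 + q\<^sup>2 * K\<^sup>2 + q * (- b)"
      using mult_left_mono[OF avg less_imp_le[OF q(1)]] by (simp add: p(3))
    also have "q\<^sup>2 * K\<^sup>2 \<le> q * (b / 2)"
    proof -
      have "q * K\<^sup>2 \<le> b / 2" using q(4) K by (simp add: field_simps)
      then have "q * (q * K\<^sup>2) \<le> q * (b / 2)" using q by (intro mult_left_mono) auto
      then show ?thesis by (simp add: power2_eq_square ac_simps)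
    qed
    finally have sum: "(\<Sum>i<k. p i x * t i powr q) \<le> \<rho>" by (simp add: \<rho>_def mult.commute)
    have "(\<Sum>i<k. p i x * dist (h i x) (h i y) powr q) = (\<Sum>i<k. p i x * t i powr q) * dist x y powr q"
      unfolding sum_distrib_right using d by (intro sum.cong) (auto simp: t_def powr_divide)
    also have "\<dots> \<le> \<rho> * dist x y powr q" using sum by (intro mult_right_mono) auto
    finally show ?thesis .
  qed simp
  then show thesis using q \<rho> that by blast
qed

text \<open>The contraction is passed from distances to derivatives: near x the difference quotients
  are at least s times the norms of the derivatives, so a single y close to x is enough. Then 1 + u
  <= e^u leads from q-th powers to logarithms.\<close>

lemma weighted_log_derivative_neg:
  fixes h :: "nat \<Rightarrow> 'a::euclidean_space \<Rightarrow> 'a"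
  assumes map: "\<And>i. i < k \<Longrightarrow> conformal_map (h i) (Dh i)"
    and nz: "\<And>i x. i < k \<Longrightarrow> Dh i x \<noteq> 0"
    and p: "\<And>i x. i < k \<Longrightarrow> 0 < p i x" "\<And>x. (\<Sum>i<k. p i x) = 1"
    and q: "0 < q" and \<rho>: "0 < \<rho>" "\<rho> < 1"
    and contr: "\<And>x y. (\<Sum>i<k. p i x * dist (h i x) (h i y) powr q) \<le> \<rho> * dist x y powr q"
  shows "(\<Sum>i<k. p i x * ln (norm (Dh i x))) \<le> - ((1 - \<rho>) / (1 + \<rho>) / q)"
proof -
  \<comment> \<open>s^q = (1 + \<rho>) / 2 lies strictly between \<rho> and 1, so after dividing by
    it the constant 2 \<rho> / (1 + \<rho>) is still below 1.\<close>
  define s where "s = ((1 + \<rho>) / 2) powr (1 / q)"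
  have sq: "s powr q = (1 + \<rho>) / 2" using q \<rho> by (simp add: s_def powr_powr)
  have s: "0 < s" "s < 1"
  proof -
    show "0 < s" using \<rho> by (simp add: s_def)
    have "s < 1 powr (1 / q)" unfolding s_def using q \<rho> by (intro powr_less_mono2) auto
    then show "s < 1" by simp
  qed
  have N: "0 < norm (Dh i x)" if "i < k" for i using nz[OF that] by simp
  have "\<forall>\<^sub>F y in at x. s * norm (Dh i x) * dist x y \<le> dist (h i x) (h i y)" if i: "i < k" for i
  proof -
    interpret conformal_map "h i" "Dh i" by (rule map[OF i])
    define e where "e = (1 - s) * norm (Dh i x)"
    have "0 < e" using s N[OF i] by (simp add: e_def)
    then obtain d where d: "0 < d"
      and D: "\<And>y. norm (y - x) < d \<Longrightarrow> norm (h i y - h i x - Dh i x (y - x)) \<le> e * norm (y - x)"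
      using deriv[of x] unfolding has_derivative_at_alt by blast
    have "s * norm (Dh i x) * dist x y \<le> dist (h i x) (h i y)" if "dist y x < d" for y
    proof -
      have "norm (Dh i x) * norm (y - x) = norm (Dh i x (y - x))" by (simp add: conformal)
      also have "\<dots> \<le> norm (h i y - h i x) + norm (h i y - h i x - Dh i x (y - x))"
        using norm_triangle_sub[of "Dh i x (y - x)" "h i y - h i x"] by (simp add: norm_minus_commute)
      also have "norm (h i y - h i x - Dh i x (y - x)) \<le> e * norm (y - x)"
        using that by (intro D) (simp add: dist_norm)
      finally show ?thesis by (simp add: e_def dist_norm norm_minus_commute algebra_simps)
    qed
    then show ?thesis using d unfolding eventually_at by (intro exI[of _ d]) auto
  qed
  then have "\<forall>\<^sub>F y in at x. \<forall>i\<in>{..<k}. s * norm (Dh i x) * dist x y \<le> dist (h i x) (h i y)"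
    by (intro eventually_ball_finite) auto
  then have "\<forall>\<^sub>F y in at x. y \<noteq> x \<and> (\<forall>i\<in>{..<k}. s * norm (Dh i x) * dist x y \<le> dist (h i x) (h i y))"
    using eventually_neq_at_within[of x x UNIV] by eventually_elim simp
  then obtain y where y: "y \<noteq> x" and le: "\<And>i. i < k \<Longrightarrow> s * norm (Dh i x) * dist x y \<le> dist (h i x) (h i y)"
    using eventually_happens'[OF at_neq_bot] by (metis (mono_tags, lifting) lessThan_iff)
  have d: "0 < dist x y powr q" using y by simp
  have "(1 + \<rho>) / 2 * (\<Sum>i<k. p i x * norm (Dh i x) powr q) * dist x y powr q
      = (\<Sum>i<k. p i x * (s * norm (Dh i x) * dist x y) powr q)"
    unfolding sq[symmetric] sum_distrib_left sum_distrib_right using s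
    by (intro sum.cong) (auto simp: powr_mult)
  also have "\<dots> \<le> (\<Sum>i<k. p i x * dist (h i x) (h i y) powr q)"
    using le p(1) q s by (intro sum_mono mult_left_mono powr_mono2) (auto simp: less_imp_le)
  also have "\<dots> \<le> \<rho> * dist x y powr q" by (rule contr)
  finally have "(1 + \<rho>) / 2 * (\<Sum>i<k. p i x * norm (Dh i x) powr q) \<le> \<rho>"
    using d by simp
  then have "(\<Sum>i<k. p i x * norm (Dh i x) powr q) \<le> 2 * \<rho> / (1 + \<rho>)"
    using \<rho> by (simp add: field_simps)
  moreover have "1 + q * (\<Sum>i<k. p i x * ln (norm (Dh i x))) \<le> (\<Sum>i<k. p i x * norm (Dh i x) powr q)"
  proof -
    have "1 + q * (\<Sum>i<k. p i x * ln (norm (Dh i x))) = (\<Sum>i<k. p i x * (1 + q * ln (norm (Dh i x))))"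
      unfolding distrib_left sum.distrib by (simp add: p(2) sum_distrib_left algebra_simps)
    also have "\<dots> \<le> (\<Sum>i<k. p i x * norm (Dh i x) powr q)"
    proof (intro sum_mono mult_left_mono)
      fix i assume "i \<in> {..<k}"
      then show "1 + q * ln (norm (Dh i x)) \<le> norm (Dh i x) powr q"
        using N[of i] exp_ge_add_one_self[of "q * ln (norm (Dh i x))"] by (simp add: powr_def)
    qed (use p in \<open>auto simp: less_imp_le\<close>)
    finally show ?thesis .
  qed
  ultimately have "q * (\<Sum>i<k. p i x * ln (norm (Dh i x))) \<le> 2 * \<rho> / (1 + \<rho>) - 1" by linarith
  also have "2 * \<rho> / (1 + \<rho>) - 1 = - ((1 - \<rho>) / (1 + \<rho>))" using \<rho> by (simp add: field_simps)
  finally have "(\<Sum>i<k. p i x * ln (norm (Dh i x))) \<le> - ((1 - \<rho>) / (1 + \<rho>)) / q"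
    using q by (simp only: pos_le_divide_eq mult.commute)
  then show ?thesis by simp
qed

lemma distortion_of_conformal:
  fixes h :: "nat \<Rightarrow> 'a::euclidean_space \<Rightarrow> 'a"
  assumes map: "\<And>i. i < k \<Longrightarrow> conformal_map (h i) (Dh i)"
    and nz: "\<And>i x. i < k \<Longrightarrow> Dh i x \<noteq> 0"
    and D: "0 \<le> D" "0 < q"
      "\<And>i x y. i < k \<Longrightarrow> \<bar>ln (norm (Dh i x)) - ln (norm (Dh i y))\<bar> \<le> D * dist x y powr q"
    and \<epsilon>: "0 < \<epsilon>"
  shows "\<exists>r0>0. distortion k h (\<lambda>i x. ln (norm (Dh i x))) \<epsilon> r0"
proof -
  \<comment> \<open>At this scale the logarithms vary by at most \<epsilon> / 2; the other half
    provides the strict inequality that \<open>cball_subset_image\<close> requires.\<close>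
  define r0 where "r0 = (\<epsilon> / (2 * (D + 1))) powr (1 / q)"
  have D1: "0 < D + 1" using D by simp
  have r0: "0 < r0" using \<epsilon> D1 by (simp add: r0_def)
  have "r0 powr q = \<epsilon> / (2 * (D + 1))" using \<epsilon> D1 D(2) by (simp add: r0_def powr_powr)
  then have Dr: "(D + 1) * r0 powr q = \<epsilon> / 2" using D1 by (simp add: field_simps)
  have var: "\<bar>ln (norm (Dh i x)) - ln (norm (Dh i y))\<bar> \<le> \<epsilon> / 2" if "i < k" "dist x y \<le> r0" for i x y
  proof -
    have "\<bar>ln (norm (Dh i x)) - ln (norm (Dh i y))\<bar> \<le> D * dist x y powr q" by (rule D(3)[OF that(1)])
    also have "\<dots> \<le> (D + 1) * r0 powr q" using D that by (intro mult_mono powr_mono2) auto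
    finally show ?thesis by (simp add: Dr)
  qed
  have N: "norm (Dh i x) = exp (ln (norm (Dh i x)))" if "i < k" for i x using nz[OF that] by simp
  show ?thesis
  proof (intro exI conjI)
    show "distortion k h (\<lambda>i x. ln (norm (Dh i x))) \<epsilon> r0"
    proof
      fix i and u y :: 'a assume i: "i < k" and d: "dist u y \<le> r0"
      interpret conformal_map "h i" "Dh i" by (rule map[OF i])
      show "dist (h i u) (h i y) \<le> exp (ln (norm (Dh i y)) + \<epsilon>) * dist u y"
      proof (rule dist_le_of_derivative_le[where S = "cball y r0"])
        fix x assume "x \<in> cball y r0"
        then have "dist x y \<le> r0" by (simp add: dist_commute)
        from abs_le_D1[OF var[OF i this]] have "ln (norm (Dh i x)) \<le> ln (norm (Dh i y)) + \<epsilon>"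
          using \<epsilon> by simp
        then show "norm (Dh i x) \<le> exp (ln (norm (Dh i y)) + \<epsilon>)" by (subst N[OF i]) simp
      qed (use d r0 in \<open>auto simp: dist_commute\<close>)
    next
      fix i and u y :: 'a and \<kappa> :: real assume i: "i < k" and \<kappa>: "0 \<le> \<kappa>" and d: "dist u y + \<kappa> \<le> r0"
      interpret conformal_map "h i" "Dh i" by (rule map[OF i])
      show "cball (h i u) (exp (ln (norm (Dh i y)) - \<epsilon>) * \<kappa>) \<subseteq> h i ` cball u \<kappa>"
      proof (rule cball_subset_image)
        fix x assume "x \<in> cball u \<kappa>"
        then have "dist x y \<le> r0" using dist_triangle[of x y u] d by (simp add: dist_commute)
        from abs_le_D2[OF var[OF i this]] have "ln (norm (Dh i y)) - \<epsilon> < ln (norm (Dh i x))"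
          using \<epsilon> by simp
        then show "exp (ln (norm (Dh i y)) - \<epsilon>) < norm (Dh i x)" by (subst N[OF i]) simp
      qed (use \<kappa> in auto)
    qed (use \<epsilon> in simp)
  qed (rule r0)
qed

lemma uniform_holder_of_bounded:
  fixes f :: "nat \<Rightarrow> 'a::metric_space \<Rightarrow> real"
  assumes "\<And>i. i < k \<Longrightarrow> holder \<alpha> (f i)" "\<And>i x. i < k \<Longrightarrow> \<bar>f i x\<bar> \<le> B" "0 < q" "q \<le> \<alpha>" "0 \<le> B"
  shows "\<exists>C\<ge>0. \<forall>i<k. \<forall>x y. \<bar>f i x - f i y\<bar> \<le> C * dist x y powr q"
proof -
  have "\<forall>i. \<exists>C. i < k \<longrightarrow> (\<forall>x y. \<bar>f i x - f i y\<bar> \<le> C * dist x y powr \<alpha>)"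
    using assms(1) unfolding holder_def by blast
  then obtain C where C: "\<And>i x y. i < k \<Longrightarrow> \<bar>f i x - f i y\<bar> \<le> C i * dist x y powr \<alpha>" by metis
  define C0 where "C0 = (\<Sum>i<k. \<bar>C i\<bar>)"
  have "\<bar>f i x - f i y\<bar> \<le> (2 * B + C0) * dist x y powr q" if i: "i < k" for i x y
  proof (rule holder_of_bounded[OF assms(2)[OF i] _ assms(3,4)])
    have "C i \<le> \<bar>C i\<bar>" by simp
    also have "\<dots> \<le> C0" unfolding C0_def using i by (intro member_le_sum) auto
    finally show "\<bar>f i x - f i y\<bar> \<le> C0 * dist x y powr \<alpha>" for x y
      using C[OF i, of x y] by (meson mult_right_mono order.trans powr_ge_zero)
  qed (simp add: C0_def sum_nonneg)
  moreover have "0 \<le> 2 * B + C0" using assms(5) by (simp add: C0_def sum_nonneg)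
  ultimately show ?thesis by blast
qed

theorem theorem1:
  fixes k :: nat and h :: "nat \<Rightarrow> 'a::euclidean_space \<Rightarrow> 'a"
    and Dh :: "nat \<Rightarrow> 'a \<Rightarrow> ('a \<Rightarrow>\<^sub>L 'a)"
    and p :: "nat \<Rightarrow> 'a \<Rightarrow> real" and \<alpha> b :: real and \<nu> :: "'a measure"
  assumes alpha: "0 < \<alpha>" "\<alpha> \<le> 1"
    and deriv: "\<And>i x. i < k \<Longrightarrow> (h i has_derivative blinfun_apply (Dh i x)) (at x)"
    and C1: "\<And>i. i < k \<Longrightarrow> continuous_on UNIV (Dh i)"
    and conformal: "\<And>i x v. i < k \<Longrightarrow> norm (Dh i x v) = norm (Dh i x) * norm v"
    and deriv_nz: "\<And>i x. i < k \<Longrightarrow> Dh i x \<noteq> 0"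
    and log_bdd: "\<And>i. i < k \<Longrightarrow> \<exists>M. \<forall>x. \<bar>ln (norm (Dh i x))\<bar> \<le> M"
    and log_holder: "\<And>i. i < k \<Longrightarrow> holder \<alpha> (\<lambda>x. ln (norm (Dh i x)))"
    and p_range: "\<And>i x. i < k \<Longrightarrow> 0 < p i x \<and> p i x \<le> 1"
    and p_holder: "\<And>i. i < k \<Longrightarrow> holder \<alpha> (p i)"
    and p_away: "\<exists>\<delta>>0. \<forall>i<k. \<forall>x. p i x \<ge> \<delta>"
    and p_sum: "\<And>x. (\<Sum>i<k. p i x) = 1"
    and b_pos: "b > 0"
    and contr: "\<And>x y. x \<noteq> y \<Longrightarrow> (\<exists>j<k. h j x = h j y) \<or>
                  (\<Sum>j<k. p j x * ln (dist (h j x) (h j y) / dist x y)) < - b"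
    and osc: "SOSC k h \<or> ROSC k h"
    and inv: "invariant_measure k h p \<nu>"
  shows "upper_hdim \<nu> = lower_hdim \<nu> \<and>
         lower_hdim \<nu> = (\<integral>x. (\<Sum>i<k. p i x * ln (p i x)) \<partial>\<nu>) /
                         (\<integral>x. (\<Sum>i<k. p i x * ln (norm (Dh i x))) \<partial>\<nu>)"
proof -
  define L where "L i x = ln (norm (Dh i x))" for i x
  have map: "conformal_map (h i) (Dh i)" if "i < k" for i
    using deriv[OF that] conformal[OF that] by unfold_locales
  have Npos: "0 < norm (Dh i x)" if "i < k" for i x using deriv_nz[OF that] by simp
  obtain BL where BL: "0 \<le> BL" "\<And>i x. i < k \<Longrightarrow> \<bar>L i x\<bar> \<le> BL"
  proof -
    have "\<forall>i. \<exists>M. i < k \<longrightarrow> (\<forall>x. \<bar>L i x\<bar> \<le> M)" using log_bdd unfolding L_def by blast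
    then obtain M where M: "\<And>i x. i < k \<Longrightarrow> \<bar>L i x\<bar> \<le> M i" by metis
    have "\<bar>L i x\<bar> \<le> (\<Sum>i<k. \<bar>M i\<bar>)" if "i < k" for i x
    proof -
      have "\<bar>M i\<bar> \<le> (\<Sum>i<k. \<bar>M i\<bar>)" using that by (intro member_le_sum) auto
      then show ?thesis using M[OF that, of x] by linarith
    qed
    then show thesis by (intro that[of "\<Sum>i<k. \<bar>M i\<bar>"]) (auto intro: sum_nonneg)
  qed
  have N_le: "norm (Dh i x) \<le> exp BL" and N_ge: "exp (- BL) \<le> norm (Dh i x)" if "i < k" for i x
  proof -
    have "norm (Dh i x) = exp (L i x)" using Npos[OF that] by (simp add: L_def)
    then show "norm (Dh i x) \<le> exp BL" "exp (- BL) \<le> norm (Dh i x)"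
      using BL(2)[OF that, of x] by (simp_all add: abs_le_iff)
  qed
  have lip: "dist (h i x) (h i y) \<le> exp BL * dist x y" if "i < k" for i x y
    using conformal_map.dist_le_of_derivative_le[OF map[OF that], of UNIV "exp BL" x y] N_le[OF that] by simp
  \<comment> \<open>Bounded logarithms keep the derivative away from 0 and infinity, as the global
    inversion argument requires; halving exp(- BL) makes the lower bound strict.\<close>
  have inj: "inj (h i)" if "i < k" for i
  proof (rule conformal_map.injective_of_derivative_bounds[OF map[OF that] C1[OF that]])
    show "0 < exp (- BL) / 2" by simp
    show "exp (- BL) / 2 < norm (Dh i x)" for x
      using N_ge[OF that, of x] exp_gt_zero[of "- BL"] by linarith
    show "norm (Dh i x) \<le> exp BL" for x by (rule N_le[OF that])
  qed
  obtain \<delta>0 where \<delta>0: "0 < \<delta>0" "\<forall>i<k. \<forall>x. \<delta>0 \<le> p i x" using p_away by blast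
  define \<delta> where "\<delta> = min \<delta>0 (1 / 2)"
  have \<delta>: "0 < \<delta>" "\<delta> < 1" "\<And>i x. i < k \<Longrightarrow> \<delta> \<le> p i x"
    using \<delta>0 by (auto simp: \<delta>_def intro: min.coboundedI1)
  obtain q \<rho> where q: "0 < q" "q \<le> \<alpha>" and \<rho>: "0 < \<rho>" "\<rho> < 1"
    and contr_q: "\<And>x y. (\<Sum>i<k. p i x * dist (h i x) (h i y) powr q) \<le> \<rho> * dist x y powr q"
  proof (rule average_contraction_exponent[of k \<delta> p "exp BL" h b \<alpha>])
    show "1 \<le> exp BL" using BL by simp
  qed (use \<delta> p_sum lip b_pos alpha contr in auto)
  have "\<exists>C\<ge>0. \<forall>i<k. \<forall>x y. \<bar>p i x - p i y\<bar> \<le> C * dist x y powr q"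
    using p_holder q p_range by (intro uniform_holder_of_bounded[where \<alpha> = \<alpha> and B = 1]) (auto simp: abs_le_iff less_imp_le intro: order.trans[of _ 0])
  then obtain Cp where Cp: "0 \<le> Cp" "\<forall>i<k. \<forall>x y. \<bar>p i x - p i y\<bar> \<le> Cp * dist x y powr q" by blast
  have "\<exists>C\<ge>0. \<forall>i<k. \<forall>x y. \<bar>L i x - L i y\<bar> \<le> C * dist x y powr q"
    using log_holder q BL unfolding L_def by (intro uniform_holder_of_bounded[where \<alpha> = \<alpha> and B = BL]) auto
  then obtain DL where DL: "0 \<le> DL" "\<forall>i<k. \<forall>x y. \<bar>L i x - L i y\<bar> \<le> DL * dist x y powr q" by blast
  obtain U where U: "osc_with k h U" using osc unfolding SOSC_def ROSC_def by blast
  interpret average_contraction k h p \<nu> \<delta> q \<rho> Cp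
  proof
    show "continuous_on UNIV (h i)" if "i < k" for i by (rule conformal_map.continuous_h[OF map[OF that]])
  qed (use \<delta> p_range p_sum q \<rho> alpha contr_q Cp inv in auto)
  have L_cont: "continuous_on UNIV (L i)" if "i < k" for i
    using DL(2) that q(1) by (intro continuous_on_of_holder) blast+
  interpret conformal_osc k h p \<nu> \<delta> q \<rho> Cp L BL DL U
  proof
    \<comment> \<open>The negative mean of L comes from the contraction at infinitesimal distance
      and makes the denominator of the formula nonzero.\<close>
    have "mean L \<le> - ((1 - \<rho>) / (1 + \<rho>) / q)"
      unfolding L_def[abs_def]
    proof (rule mean_le)
      show "(\<Sum>i<k. p i x * ln (norm (Dh i x))) \<le> - ((1 - \<rho>) / (1 + \<rho>) / q)" for x
        using map deriv_nz p_pos p_sum q(1) \<rho> contr_q by (rule weighted_log_derivative_neg)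
    qed (use BL L_cont in \<open>auto simp: L_def\<close>)
    also have "\<dots> < 0" using \<rho> q by simp
    finally show "mean L < 0" .
    show "\<exists>r0>0. distortion k h L \<epsilon> r0" if "0 < \<epsilon>" for \<epsilon>
      unfolding L_def[abs_def]
      using map deriv_nz DL(1) q(1) _ that
    proof (rule distortion_of_conformal)
      show "\<bar>ln (norm (Dh i x)) - ln (norm (Dh i y))\<bar> \<le> DL * dist x y powr q" if "i < k" for i x y
        using DL(2) that by (simp add: L_def)
    qed
  qed (use BL DL inj U in auto)
  show ?thesis
    using hdim_eq by (simp add: mean_def lp_def L_def)
qed

end
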